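(* The parametric matroid $\ell$-interdiction problem can be solved in time $$\mathcal{O}\big(m^{\ell+1}\,(m f(m)+k^{\frac13}\,\ell\log(mk))\big).$$
   Context: Let $\mathcal{M}=(E,\mathcal{F})$ be a matroid on a finite ground set $E$ with family of independent sets $\mathcal{F}$, $m=|E|$, and rank $k$. Each $e\in E$ has a parametric weight $w(e,\lambda)=a_e+\lambda b_e$ with $a_e,b_e\in\mathbb{Q}$, where the parameter $\lambda$ ranges over a real interval $I\subseteq\mathbb{R}$; for $A\subseteq E$ put $w(A,\lambda)=\sum_{e\in A}w(e,\lambda)$. Let $\ell\in\mathbb{N}_{>0}$ be the number of elements allowed to be interdicted. For $F\subseteq E$, $\mathcal{M}_F$ denotes the restriction of $\mathcal{M}$ to $E\setminus F$; $B_\lambda^*$ denotes a minimum weight basis of $\mathcal{M}$ at $\lambda$ and $B_\lambda^F$ a minimum weight basis of $\mathcal{M}_F$ at $\lambda$. An equality point is a $\lambda\in I$ with $w(e,\lambda)=w(f,\lambda)$ for some $e\neq f$. Standing assumptions: (a) $\ell$ is constant, not part of the input (so implied constants may depend on $\ell$); (b) for every $F\subseteq E$ with $|F|=\ell$ the matroid $\mathcal{M}_F$ has a basis of cardinality $k$; (c) optimal bases $B_\lambda^*$ and $B_\lambda^F$ are unique (at equality points ties are resolved by a fixed ordering of the elements); (d) no two different pairs of elements have equal weights at the same $\lambda$, and no two elements have identical weight functions. For $F\subseteq E$ with $|F|=\ell$ put $y_F(\lambda)=w(B_\lambda^F,\lambda)$, and let $y(\lambda)=\max\{y_F(\lambda):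 F\subseteq E,\ |F|=\ell\}$. A set $F^*$ with $|F^*|=\ell$ is a set of $\ell$-most vital elements at $\lambda$ if $y_{F^*}(\lambda)=y(\lambda)$. Parametric matroid $\ell$-interdiction problem: given $\mathcal{M}$ with weights $w(e,\lambda)$, the interval $I$, and $\ell$, determine for each $\lambda\in I$ a set $F^*$ of $\ell$-most vital elements and the value $y(\lambda)=y_{F^*}(\lambda)$ (i.e. output the piecewise linear function $y$ by its linear pieces, with an optimal set $F^*$ for each piece). Computational model: $f(m)$ is the time needed for a single independence test in $\mathcal{M}$; arithmetic operations and comparisons of numbers take constant time. *)

theory Defs
  imports "HOL-Analysis.Analysis"
begin

section \<open>Matroids\<close>

definition matroid :: "'a set \<Rightarrow> 'a set set \<Rightarrow> bool" where
  "matroid E \<F> \<longleftrightarrow>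
     finite E \<and> \<F> \<subseteq> Pow E \<and> {} \<in> \<F> \<and>
     (\<forall>A\<in>\<F>. \<forall>B. B \<subseteq> A \<longrightarrow> B \<in> \<F>) \<and>
     (\<forall>A\<in>\<F>. \<forall>B\<in>\<F>. card A < card B \<longrightarrow> (\<exists>x\<in>B - A. insert x A \<in> \<F>))"

definition is_basis :: "'a set set \<Rightarrow> 'a set \<Rightarrow> bool" where
  "is_basis \<F> B \<longleftrightarrow> B \<in> \<F> \<and> (\<forall>A\<in>\<F>. B \<subseteq> A \<longrightarrow> A = B)"

definition rank_of :: "'a set set \<Rightarrow> nat" where
  "rank_of \<F> = Max (card ` \<F>)"

definition restriction :: "'a set set \<Rightarrow> 'a set \<Rightarrow> 'a set set" where
  "restriction \<F> X = {A \<in> \<F>. A \<subseteq> X}"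

definition min_weight_basis :: "('a \<Rightarrow> real) \<Rightarrow> 'a set set \<Rightarrow> 'a set \<Rightarrow> bool" where
  "min_weight_basis v \<F> B \<longleftrightarrow>
     is_basis \<F> B \<and> (\<forall>B'. is_basis \<F> B' \<longrightarrow> sum v B \<le> sum v B')"

text \<open>Ties between minimum weight bases are resolved by the ordering of the elements: of two
  minimum weight bases, the one containing the least element in which they differ is preferred.\<close>

definition optimal_basis :: "('a::linorder \<Rightarrow> real) \<Rightarrow> 'a set set \<Rightarrow> 'a set" where
  "optimal_basis v \<F> = (THE B. min_weight_basis v \<F> B \<and>
     (\<forall>B'. min_weight_basis v \<F> B' \<and> B' \<noteq> B \<longrightarrow> Min ((B - B') \<union> (B' - B)) \<in> B))"


section \<open>The parametric matroid interdiction problem\<close>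

datatype endpoint = Unbounded | Open real | Closed real

fun above :: "endpoint \<Rightarrow> real \<Rightarrow> bool" where
  "above Unbounded x \<longleftrightarrow> True"
| "above (Open u) x \<longleftrightarrow> u < x"
| "above (Closed u) x \<longleftrightarrow> u \<le> x"

fun below :: "endpoint \<Rightarrow> real \<Rightarrow> bool" where
  "below Unbounded x \<longleftrightarrow> True"
| "below (Open u) x \<longleftrightarrow> x < u"
| "below (Closed u) x \<longleftrightarrow> x \<le> u"

definition interval :: "endpoint \<Rightarrow> endpoint \<Rightarrow> real set" where
  "interval p q = {x. above p x \<and> below q x}"

lemma is_interval_iff_endpoints: "is_interval I \<longleftrightarrow> (\<exists>p q. I = interval p q)"
proof
  assume "\<exists>p q. I = interval p q"
  then obtain p q where "I = interval p q" by blast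
  then show "is_interval I"
    unfolding is_interval_1 interval_def by (cases p; cases q) auto
next
  assume I: "is_interval I"
  show "\<exists>p q. I = interval p q"
  proof (cases "I = {}")
    case True
    then have "I = interval (Open 0) (Open 0)" by (auto simp: interval_def)
    then show ?thesis by blast
  next
    case ne: False
    define p where "p = (if \<not> bdd_below I then Unbounded
      else if Inf I \<in> I then Closed (Inf I) else Open (Inf I))"
    define q where "q = (if \<not> bdd_above I then Unbounded
      else if Sup I \<in> I then Closed (Sup I) else Open (Sup I))"
    have p1: "above p x" if "x \<in> I" for x
    proof (cases "bdd_below I")
      case True
      then have "Inf I \<le> x" using cInf_lower that by blast
      moreover have "Inf I \<noteq> x" if "Inf I \<notin> I" using that \<open>x \<in> I\<close> by blast
      ultimately show ?thesis using True by (simp add: p_def less_le)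
    qed (simp add: p_def)
    have q1: "below q x" if "x \<in> I" for x
    proof (cases "bdd_above I")
      case True
      then have "x \<le> Sup I" using cSup_upper that by blast
      moreover have "x \<noteq> Sup I" if "Sup I \<notin> I" using that \<open>x \<in> I\<close> by blast
      ultimately show ?thesis using True by (simp add: q_def less_le)
    qed (simp add: q_def)
    have p2: "\<exists>y\<in>I. y \<le> x" if "above p x" for x
    proof (cases "bdd_below I")
      case False
      then show ?thesis unfolding bdd_below_def using linear by blast
    next
      case True
      show ?thesis
      proof (cases "Inf I \<in> I")
        case True
        then show ?thesis using that \<open>bdd_below I\<close> by (intro bexI[of _ "Inf I"]) (simp_all add: p_def)
      next
        case False
        then have "Inf I < x" using that True by (simp add: p_def)
        then show ?thesis using cInf_less_iff[OF ne True] less_imp_le by blast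
      qed
    qed
    have q2: "\<exists>y\<in>I. x \<le> y" if "below q x" for x
    proof (cases "bdd_above I")
      case False
      then show ?thesis unfolding bdd_above_def using linear by blast
    next
      case True
      show ?thesis
      proof (cases "Sup I \<in> I")
        case True
        then show ?thesis using that \<open>bdd_above I\<close> by (intro bexI[of _ "Sup I"]) (simp_all add: q_def)
      next
        case False
        then have "x < Sup I" using that True by (simp add: q_def)
        then show ?thesis using less_cSup_iff[OF ne True] less_imp_le by blast
      qed
    qed
    have "I = interval p q"
    proof
      show "I \<subseteq> interval p q" using p1 q1 by (auto simp: interval_def)
      show "interval p q \<subseteq> I"
      proof
        fix x assume "x \<in> interval p q"
        then have "above p x" "below q x" by (simp_all add: interval_def)
        from p2[OF this(1)] obtain y where y: "y \<in> I" "y \<le> x" ..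
        from q2[OF \<open>below q x\<close>] obtain z where z: "z \<in> I" "x \<le> z" ..
        from I y z show "x \<in> I" unfolding is_interval_1 by blast
      qed
    qed
    then show ?thesis by blast
  qed
qed

text \<open>The ground set of an instance with \<open>size\<close> elements is \<open>{..<size}\<close>; the element \<open>e\<close> has the
  weight \<open>const_coeff e + lam * slope_coeff e\<close>.\<close>

record problem =
  ground_size :: nat
  indep :: "nat set set"
  const_coeff :: "nat \<Rightarrow> rat"
  slope_coeff :: "nat \<Rightarrow> rat"
  lower_end :: endpoint
  upper_end :: endpoint

definition ground :: "problem \<Rightarrow> nat set" where
  "ground X = {..<ground_size X}"

definition parameters :: "problem \<Rightarrow> real set" where
  "parameters X = interval (lower_end X) (upper_end X)"

definition weight :: "problem \<Rightarrow> real \<Rightarrow> nat \<Rightarrow> real" where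
  "weight X lam e = of_rat (const_coeff X e) + lam * of_rat (slope_coeff X e)"

definition matroid_rank :: "problem \<Rightarrow> nat" where
  "matroid_rank X = rank_of (indep X)"

definition without :: "problem \<Rightarrow> nat set \<Rightarrow> nat set set" where
  "without X F = restriction (indep X) (ground X - F)"

definition removable :: "nat \<Rightarrow> problem \<Rightarrow> nat set set" where
  "removable l X = {F. F \<subseteq> ground X \<and> card F = l}"

text \<open>The condition \<open>l \<le> ground_size X\<close> says that there is at least one set of \<open>l\<close> elements, so that
  the maximum defining the optimal interdiction value exists.\<close>

definition interdiction_instance :: "nat \<Rightarrow> problem \<Rightarrow> bool" where
  "interdiction_instance l X \<longleftrightarrow>
     matroid (ground X) (indep X) \<and>
     l \<le> ground_size X \<and>
     (\<forall>F\<in>removable l X. \<exists>B. is_basis (without X F) B \<and> card B = matroid_rank X) \<and>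
     (\<forall>lam\<in>parameters X. \<forall>e\<in>ground X. \<forall>f\<in>ground X. \<forall>e'\<in>ground X. \<forall>f'\<in>ground X.
        e \<noteq> f \<and> e' \<noteq> f' \<and> weight X lam e = weight X lam f \<and> weight X lam e' = weight X lam f'
          \<longrightarrow> {e, f} = {e', f'}) \<and>
     (\<forall>e\<in>ground X. \<forall>f\<in>ground X. e \<noteq> f \<longrightarrow>
        (const_coeff X e, slope_coeff X e) \<noteq> (const_coeff X f, slope_coeff X f))"

definition removal_value :: "problem \<Rightarrow> nat set \<Rightarrow> real \<Rightarrow> real" where
  "removal_value X F lam = sum (weight X lam) (optimal_basis (weight X lam) (without X F))"

definition interdiction_value :: "nat \<Rightarrow> problem \<Rightarrow> real \<Rightarrow> real" where
  "interdiction_value l X lam = Max ((\<lambda>F. removal_value X F lam) ` removable l X)"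

definition most_vital :: "nat \<Rightarrow> problem \<Rightarrow> real \<Rightarrow> nat set \<Rightarrow> bool" where
  "most_vital l X lam F \<longleftrightarrow>
     F \<in> removable l X \<and> removal_value X F lam = interdiction_value l X lam"

text \<open>A solution is a list of pieces. Piece number \<open>j\<close> extends from its own start to the start of
  the next piece; the first piece extends to the lower end of the parameter interval (its start is
  ignored), the last one to the upper end.\<close>

record piece =
  start :: real
  intercept :: real
  slope :: real
  vital :: "nat set"

definition piece_domain :: "problem \<Rightarrow> piece list \<Rightarrow> nat \<Rightarrow> real set" where
  "piece_domain X ps j = {lam\<in>parameters X. (0 < j \<longrightarrow> start (ps ! j) \<le> lam) \<and>
     (Suc j < length ps \<longrightarrow> lam \<le> start (ps ! Suc j))}"

definition is_solution :: "nat \<Rightarrow> problem \<Rightarrow> piece list \<Rightarrow> bool" where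
  "is_solution l X ps \<longleftrightarrow>
     (\<forall>j. 0 < j \<and> j < length ps \<longrightarrow> start (ps ! j) \<in> parameters X) \<and>
     (\<forall>i j. 0 < i \<and> i < j \<and> j < length ps \<longrightarrow> start (ps ! i) < start (ps ! j)) \<and>
     parameters X = (\<Union>j<length ps. piece_domain X ps j) \<and>
     (\<forall>j<length ps. \<forall>lam\<in>piece_domain X ps j.
        interdiction_value l X lam = intercept (ps ! j) + lam * slope (ps ! j) \<and>
        most_vital l X lam (vital (ps ! j)))"


section \<open>Computational model\<close>

text \<open>A unit-cost real random access machine with an independence oracle, programmed by structured
  commands. The memory consists of named unbounded arrays of natural numbers (which serve as
  indices, so that indirect addressing is possible) and of real numbers; a scalar is cell \<open>0\<close> of an
  array. A program is a finite object, independent of the instance: it mentions finitely many arrays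
  and only rational constants. There is no rounding of reals, hence no conversion of reals to
  indices.\<close>

datatype nexp =
    NConst nat
  | NCell string nexp
  | NAdd nexp nexp
  | NSub nexp nexp
  | NMul nexp nexp

datatype rexp =
    RConst rat
  | RCell string nexp
  | RAdd rexp rexp
  | RSub rexp rexp
  | RMul rexp rexp
  | RDiv rexp rexp

datatype bexp =
    NLess nexp nexp
  | RLess rexp rexp
  | Not bexp
  | And bexp bexp

datatype com =
    Skip
  | NAssign string nexp nexp
  | RAssign string nexp rexp
  | Query string nexp string
  | Seq com com
  | If bexp com com
  | While bexp com

record memory =
  nats :: "string \<Rightarrow> nat \<Rightarrow> nat"
  reals :: "string \<Rightarrow> nat \<Rightarrow> real"

fun nval :: "memory \<Rightarrow> nexp \<Rightarrow> nat" where
  "nval s (NConst n) = n"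
| "nval s (NCell x i) = nats s x (nval s i)"
| "nval s (NAdd a b) = nval s a + nval s b"
| "nval s (NSub a b) = nval s a - nval s b"
| "nval s (NMul a b) = nval s a * nval s b"

fun rval :: "memory \<Rightarrow> rexp \<Rightarrow> real" where
  "rval s (RConst q) = of_rat q"
| "rval s (RCell x i) = reals s x (nval s i)"
| "rval s (RAdd a b) = rval s a + rval s b"
| "rval s (RSub a b) = rval s a - rval s b"
| "rval s (RMul a b) = rval s a * rval s b"
| "rval s (RDiv a b) = rval s a / rval s b"

fun bval :: "memory \<Rightarrow> bexp \<Rightarrow> bool" where
  "bval s (NLess a b) \<longleftrightarrow> nval s a < nval s b"
| "bval s (RLess a b) \<longleftrightarrow> rval s a < rval s b"
| "bval s (Not b) \<longleftrightarrow> \<not> bval s b"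
| "bval s (And b c) \<longleftrightarrow> bval s b \<and> bval s c"

text \<open>Every constant, memory access, arithmetic operation, comparison and Boolean connective costs
  one unit.\<close>

fun ncost :: "nexp \<Rightarrow> nat" where
  "ncost (NConst n) = 1"
| "ncost (NCell x i) = 1 + ncost i"
| "ncost (NAdd a b) = 1 + ncost a + ncost b"
| "ncost (NSub a b) = 1 + ncost a + ncost b"
| "ncost (NMul a b) = 1 + ncost a + ncost b"

fun rcost :: "rexp \<Rightarrow> nat" where
  "rcost (RConst q) = 1"
| "rcost (RCell x i) = 1 + ncost i"
| "rcost (RAdd a b) = 1 + rcost a + rcost b"
| "rcost (RSub a b) = 1 + rcost a + rcost b"
| "rcost (RMul a b) = 1 + rcost a + rcost b"
| "rcost (RDiv a b) = 1 + rcost a + rcost b"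

fun bcost :: "bexp \<Rightarrow> nat" where
  "bcost (NLess a b) = 1 + ncost a + ncost b"
| "bcost (RLess a b) = 1 + rcost a + rcost b"
| "bcost (Not b) = 1 + bcost b"
| "bcost (And b c) = 1 + bcost b + bcost c"

text \<open>\<open>exec \<F> m d P s t s'\<close>: with independence oracle \<open>\<F>\<close> on the ground set \<open>{..<m}\<close>, where a single
  test takes time \<open>d\<close>, the program \<open>P\<close> started in memory \<open>s\<close> terminates in memory \<open>s'\<close> after time \<open>t\<close>.
  The set that is tested is given by its characteristic vector, stored in cells \<open>0, \<dots>, m - 1\<close> of an
  array of natural numbers.\<close>

inductive exec ::
    "nat set set \<Rightarrow> nat \<Rightarrow> nat \<Rightarrow> com \<Rightarrow> memory \<Rightarrow> nat \<Rightarrow> memory \<Rightarrow> bool"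
  for \<F> :: "nat set set" and m d :: nat where
  Skip: "exec \<F> m d Skip s 1 s"
| NAssign: "exec \<F> m d (NAssign x i a) s (1 + ncost i + ncost a)
     (s\<lparr>nats := (nats s)(x := (nats s x)(nval s i := nval s a))\<rparr>)"
| RAssign: "exec \<F> m d (RAssign x i a) s (1 + ncost i + rcost a)
     (s\<lparr>reals := (reals s)(x := (reals s x)(nval s i := rval s a))\<rparr>)"
| Query: "exec \<F> m d (Query x i y) s (1 + ncost i + d)
     (s\<lparr>nats := (nats s)(x := (nats s x)
        (nval s i := (if {e. e < m \<and> nats s y e \<noteq> 0} \<in> \<F> then 1 else 0)))\<rparr>)"
| Seq: "exec \<F> m d P s t s' \<Longrightarrow> exec \<F> m d Q s' u s'' \<Longrightarrow> exec \<F> m d (Seq P Q) s (t + u) s''"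
| IfTrue: "bval s b \<Longrightarrow> exec \<F> m d P s t s' \<Longrightarrow> exec \<F> m d (If b P Q) s (1 + bcost b + t) s'"
| IfFalse: "\<not> bval s b \<Longrightarrow> exec \<F> m d Q s t s' \<Longrightarrow> exec \<F> m d (If b P Q) s (1 + bcost b + t) s'"
| WhileFalse: "\<not> bval s b \<Longrightarrow> exec \<F> m d (While b P) s (1 + bcost b) s"
| WhileTrue: "bval s b \<Longrightarrow> exec \<F> m d P s t s' \<Longrightarrow> exec \<F> m d (While b P) s' u s'' \<Longrightarrow>
     exec \<F> m d (While b P) s (1 + bcost b + t + u) s''"

inductive_cases exec_SkipE: "exec \<F> m d Skip s t s'"
inductive_cases exec_NAssignE: "exec \<F> m d (NAssign x i a) s t s'"
inductive_cases exec_RAssignE: "exec \<F> m d (RAssign x i a) s t s'"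
inductive_cases exec_QueryE: "exec \<F> m d (Query x i y) s t s'"
inductive_cases exec_SeqE: "exec \<F> m d (Seq P Q) s t s'"
inductive_cases exec_IfE: "exec \<F> m d (If b P Q) s t s'"
inductive_cases exec_WhileE: "exec \<F> m d (While b P) s t s'"

lemma exec_deterministic:
  "exec \<F> m d P s t s' \<Longrightarrow> exec \<F> m d P s u s'' \<Longrightarrow> u = t \<and> s'' = s'"
proof (induction arbitrary: u s'' rule: exec.induct)
  case Skip
  from Skip.prems show ?case by (rule exec_SkipE) simp
next
  case NAssign
  from NAssign.prems show ?case by (rule exec_NAssignE) simp
next
  case RAssign
  from RAssign.prems show ?case by (rule exec_RAssignE) simp
next
  case Query
  from Query.prems show ?case by (rule exec_QueryE) simp
next
  case (Seq P s t s' Q t2 s2)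
  from Seq.prems obtain t1 s1 u1 where
    u: "u = t1 + u1" and P: "exec \<F> m d P s t1 s1" and Q: "exec \<F> m d Q s1 u1 s''"
    by (rule exec_SeqE)
  from Seq.IH(1)[OF P] Q have Q': "exec \<F> m d Q s' u1 s''" and "t1 = t" by simp_all
  with Seq.IH(2)[OF Q'] u show ?case by simp
next
  case (IfTrue s b P t s' Q)
  from IfTrue.prems show ?case
  proof (rule exec_IfE)
    fix t1
    assume "bval s b" "u = Suc (bcost b + t1)" and P: "exec \<F> m d P s t1 s''"
    with IfTrue.IH[OF P] show ?thesis by simp
  qed (use IfTrue.hyps in blast)
next
  case (IfFalse s b Q t s' P)
  from IfFalse.prems show ?case
  proof (rule exec_IfE)
    fix t1
    assume "\<not> bval s b" "u = Suc (bcost b + t1)" and Q: "exec \<F> m d Q s t1 s''"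
    with IfFalse.IH[OF Q] show ?thesis by simp
  qed (use IfFalse.hyps in blast)
next
  case (WhileFalse s b P)
  from WhileFalse.prems show ?case
    by (rule exec_WhileE) (use WhileFalse.hyps in simp_all)
next
  case (WhileTrue s b P t s' t2 s2)
  from WhileTrue.prems show ?case
  proof (rule exec_WhileE)
    assume "\<not> bval s b"
    with WhileTrue.hyps(1) show ?thesis by simp
  next
    fix t1 s1 u1
    assume "bval s b" and u: "u = Suc (bcost b + t1 + u1)" and P: "exec \<F> m d P s t1 s1"
      and W: "exec \<F> m d (While b P) s1 u1 s''"
    from WhileTrue.IH(1)[OF P] W have W': "exec \<F> m d (While b P) s' u1 s''" and "t1 = t"
      by simp_all
    with WhileTrue.IH(2)[OF W'] u show ?thesis by simp
  qed
qed


section \<open>Input and output conventions\<close>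

text \<open>The matroid itself is accessible only through the oracle. All cells that are not used for the
  input contain \<open>0\<close>.\<close>

fun endpoint_kind :: "endpoint \<Rightarrow> nat" where
  "endpoint_kind Unbounded = 0"
| "endpoint_kind (Open u) = 1"
| "endpoint_kind (Closed u) = 2"

fun endpoint_value :: "endpoint \<Rightarrow> real" where
  "endpoint_value Unbounded = 0"
| "endpoint_value (Open u) = u"
| "endpoint_value (Closed u) = u"

definition input_memory :: "problem \<Rightarrow> memory" where
  "input_memory X = \<lparr>
     nats = (\<lambda>x i.
       if x = ''size'' \<and> i = 0 then ground_size X
       else if x = ''lower'' \<and> i = 0 then endpoint_kind (lower_end X)
       else if x = ''upper'' \<and> i = 0 then endpoint_kind (upper_end X)
       else 0),
     reals = (\<lambda>x i.
       if x = ''lower'' \<and> i = 0 then endpoint_value (lower_end X)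
       else if x = ''upper'' \<and> i = 0 then endpoint_value (upper_end X)
       else if x = ''const'' \<and> i < ground_size X then of_rat (const_coeff X i)
       else if x = ''slope'' \<and> i < ground_size X then of_rat (slope_coeff X i)
       else 0)\<rparr>"

definition output_pieces :: "nat \<Rightarrow> memory \<Rightarrow> piece list" where
  "output_pieces l s = map (\<lambda>j. \<lparr>
       start = reals s ''out_start'' j,
       intercept = reals s ''out_intercept'' j,
       slope = reals s ''out_slope'' j,
       vital = {nats s ''out_vital'' (l * j + i) | i. i < l}\<rparr>)
     [0..<nats s ''out_length'' 0]"

definition solves_within :: "nat \<Rightarrow> com \<Rightarrow> problem \<Rightarrow> nat \<Rightarrow> real \<Rightarrow> bool" where
  "solves_within l P X d T \<longleftrightarrow>
     (\<exists>t s. exec (indep X) (ground_size X) d P (input_memory X) t s \<and>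
       is_solution l X (output_pieces l s) \<and> real t \<le> T)"

end

theory Submission
  imports Defs
begin

text \<open>The second summand of the bound is not needed: \<open>O(m ^ (l + 2))\<close> steps and independence tests
  suffice. For each of the \<open>N \<le> m ^ l\<close> interdiction sets, a minimum weight basis at the lower end is
  found by the greedy algorithm and then followed through the \<open>O(m\<^sup>2)\<close> equality points. By the
  standing assumptions only one pair of elements changes its order there, so that one independence
  test decides whether these two elements are exchanged.

  Between consecutive equality points the \<open>N\<close> optimal values are lines. When an equality point is
  passed, all the lines that change are shifted by the same amount, because the same pair is
  exchanged in all of them. Hence both the changed and the unchanged lines remain sorted by slope, and
  a single merge sorts all of them in time \<open>O(N)\<close>; the upper envelope of sorted lines is then computed
  with a stack in time \<open>O(N)\<close> as well. No bound on the number of breakpoints enters.\<close>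

section \<open>Minimum weight bases\<close>

text \<open>Which pairs of elements change their order, and when, depends on the weights alone.
  Hence all interdiction sets share a single schedule of attempted exchanges; only the answers of
  the independence tests depend on the set. Each answer is kept as one bit, and the bits are all
  that the pass over the lines needs later. The greedy algorithm is cast in the same form, as
  exchanges with a dummy element of weight 0. The lines can then be started from empty bases, where
  all slopes are 0 and any order is sorted, so that merging is the only sorting of lines that ever
  takes place. The budget is \<open>m ^ (l + 1)\<close> times \<open>m * f m\<close>; since
  \<open>f m\<close> is at least 1, it also has room for \<open>O(m ^ (l + 2))\<close> plain machine
  steps. For \<open>l = 1\<close> this leaves \<open>O(m ^ 3)\<close> for the schedule. Selecting
  the next event among one pending event per element takes \<open>O(m)\<close> for each of the
  \<open>O(m ^ 2)\<close> events and thus fits exactly.\<close>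

lemma
  assumes "matroid E \<F>"
  shows matroid_finite: "finite E"
    and matroid_subset: "A \<in> \<F> \<Longrightarrow> A \<subseteq> E"
    and matroid_empty: "{} \<in> \<F>"
    and matroid_hereditary: "A \<in> \<F> \<Longrightarrow> B \<subseteq> A \<Longrightarrow> B \<in> \<F>"
    and matroid_augment:
      "A \<in> \<F> \<Longrightarrow> B \<in> \<F> \<Longrightarrow> card A < card B \<Longrightarrow> \<exists>x\<in>B - A. insert x A \<in> \<F>"
  using assms by (simp_all add: matroid_def subset_iff)

lemma matroid_finite_indep: "matroid E \<F> \<Longrightarrow> A \<in> \<F> \<Longrightarrow> finite A"
  by (meson finite_subset matroid_finite matroid_subset)

lemma matroid_restriction:
  assumes "matroid E \<F>" "X \<subseteq> E"
  shows "matroid X (restriction \<F> X)"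
  unfolding matroid_def
proof (intro conjI ballI allI impI)
  show "finite X" using assms finite_subset matroid_finite by blast
  show "restriction \<F> X \<subseteq> Pow X" by (auto simp: restriction_def)
  show "{} \<in> restriction \<F> X" using matroid_empty[OF assms(1)] by (simp add: restriction_def)
next
  fix A B assume "A \<in> restriction \<F> X" "B \<subseteq> A"
  then show "B \<in> restriction \<F> X"
    using matroid_hereditary[OF assms(1)] by (auto simp: restriction_def)
next
  fix A B assume "A \<in> restriction \<F> X" "B \<in> restriction \<F> X" "card A < card B"
  then show "\<exists>x\<in>B - A. insert x A \<in> restriction \<F> X"
    using matroid_augment[OF assms(1), of A B] by (auto simp: restriction_def)
qed

section \<open>Cardinalities of bases and the exchange criterion for minimality\<close>

lemma basis_card_max:
  assumes "matroid E \<F>" "is_basis \<F> B" "A \<in> \<F>"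
  shows "card A \<le> card B"
proof (rule ccontr)
  assume "\<not> card A \<le> card B"
  then obtain x where "x \<in> A - B" "insert x B \<in> \<F>"
    using assms matroid_augment[of E \<F> B A] by (auto simp: is_basis_def)
  then show False using assms(2) by (auto simp: is_basis_def)
qed

lemma basis_if_card:
  assumes "matroid E \<F>" "is_basis \<F> B" "A \<in> \<F>" "card A = card B"
  shows "is_basis \<F> A"
  unfolding is_basis_def
proof (intro conjI ballI impI)
  fix C assume C: "C \<in> \<F>" "A \<subseteq> C"
  then have "card C \<le> card A" using basis_card_max assms by metis
  then show "C = A" using C card_seteq matroid_finite_indep[OF assms(1)] by blast
qed fact

lemma augment_to_card:
  assumes M: "matroid E \<F>" and "A \<in> \<F>" "C \<in> \<F>" "card A \<le> card C"
  shows "\<exists>D\<in>\<F>. A \<subseteq> D \<and> D \<subseteq> A \<union> C \<and> card D = card C"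
  using assms(2,4)
proof (induction "card C - card A" arbitrary: A)
  case 0
  then show ?case by auto
next
  case (Suc n)
  then have "card A < card C" by simp
  then obtain x where x: "x \<in> C - A" "insert x A \<in> \<F>"
    using matroid_augment[OF M Suc.prems(1) assms(3)] by blast
  have "card (insert x A) = Suc (card A)"
    using x Suc.prems matroid_finite_indep[OF M] by (auto simp: card_insert_if)
  then have "\<exists>D\<in>\<F>. insert x A \<subseteq> D \<and> D \<subseteq> insert x A \<union> C \<and> card D = card C"
    using Suc.hyps(2) x(2) by (intro Suc.hyps(1)) simp_all
  then show ?case using x by blast
qed

text \<open>Compare the heaviest elements \<open>y\<close> of \<open>B\<close> and \<open>x\<close>
  of \<open>B'\<close>: at the threshold \<open>v x\<close> all of \<open>B'\<close> is counted,
  hence all of \<open>B\<close>, so that \<open>v y \<le> v x\<close>. Removing both keeps the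
  hypothesis, because below \<open>v y\<close> the element \<open>y\<close> was not counted and from
  \<open>v y\<close> on all of \<open>B - {y}\<close> is.\<close>

lemma sum_le_if_threshold_counts:
  fixes v :: "'a \<Rightarrow> real"
  assumes "finite B" "finite B'" "card B = card B'"
    and "\<And>\<theta>. card {x\<in>B'. v x \<le> \<theta>} \<le> card {x\<in>B. v x \<le> \<theta>}"
  shows "sum v B \<le> sum v B'"
  using assms
proof (induction "card B" arbitrary: B B')
  case 0
  then show ?case by simp
next
  case (Suc n)
  then have ne: "B \<noteq> {}" "B' \<noteq> {}" by auto
  obtain y where y: "y \<in> B" "\<And>z. z \<in> B \<Longrightarrow> v z \<le> v y"
    using Suc.prems(1) ne(1) obtains_MAX[of "B" v] by (metis Max_ge finite_imageI imageI)
  obtain x where x: "x \<in> B'" "\<And>z. z \<in> B' \<Longrightarrow> v z \<le> v x"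
    using Suc.prems(2) ne(2) obtains_MAX[of "B'" v] by (metis Max_ge finite_imageI imageI)
  have "{z\<in>B'. v z \<le> v x} = B'" using x by auto
  then have "card B \<le> card {z\<in>B. v z \<le> v x}" using Suc.prems(3) Suc.prems(4)[of "v x"] by simp
  then have "{z\<in>B. v z \<le> v x} = B" using Suc.prems(1) by (intro card_seteq) auto
  then have yx: "v y \<le> v x" using y(1) by auto
  have "sum v (B - {y}) \<le> sum v (B' - {x})"
  proof (rule Suc.hyps(1))
    show "n = card (B - {y})" "finite (B - {y})" "finite (B' - {x})" "card (B - {y}) = card (B' - {x})"
      using Suc.hyps(2) Suc.prems(1-3) y(1) x(1) by simp_all
    fix \<theta>
    show "card {z\<in>B' - {x}. v z \<le> \<theta>} \<le> card {z\<in>B - {y}. v z \<le> \<theta>}"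
    proof (cases "v y \<le> \<theta>")
      case True
      then have "{z\<in>B - {y}. v z \<le> \<theta>} = B - {y}" using y(2) by force
      moreover have "card {z\<in>B' - {x}. v z \<le> \<theta>} \<le> card (B' - {x})"
        using Suc.prems(2) by (intro card_mono) auto
      ultimately show ?thesis using Suc.prems x y by simp
    next
      case False
      then have "{z\<in>B - {y}. v z \<le> \<theta>} = {z\<in>B. v z \<le> \<theta>}" by auto
      moreover have "card {z\<in>B' - {x}. v z \<le> \<theta>} \<le> card {z\<in>B'. v z \<le> \<theta>}"
        using Suc.prems(2) by (intro card_mono) auto
      ultimately show ?thesis using Suc.prems(4)[of \<theta>] by simp
    qed
  qed
  then show ?case
    using yx sum.remove[OF Suc.prems(1) y(1), of v] sum.remove[OF Suc.prems(2) x(1), of v] by simp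
qed

text \<open>Local optimality is global in a matroid. If another basis had more elements of weight at
  most \<theta>, augmentation would add some light \<open>x\<close> to the light part
  \<open>A\<close> of \<open>B\<close>. Completing \<open>insert x A\<close> by elements of
  \<open>B\<close> yields a basis that differs from \<open>B\<close> in a single exchange of a heavy
  \<open>y\<close> for \<open>x\<close>, contrary to the hypothesis.\<close>

lemma exchange_optimal_imp_min_weight:
  assumes M: "matroid E \<F>" and B: "is_basis \<F> B"
    and opt: "\<And>g h. g \<in> B \<Longrightarrow> h \<notin> B \<Longrightarrow> insert h (B - {g}) \<in> \<F> \<Longrightarrow> v g \<le> v h"
  shows "min_weight_basis v \<F> B"
  unfolding min_weight_basis_def
proof (intro conjI allI impI)
  fix B' assume B': "is_basis \<F> B'"
  have mem: "B \<in> \<F>" "B' \<in> \<F>" and fin: "finite B" "finite B'"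
    using B B' matroid_finite_indep[OF M] by (auto simp: is_basis_def)
  show "sum v B \<le> sum v B'"
  proof (rule sum_le_if_threshold_counts[OF fin])
    show "card B = card B'"
      using basis_card_max[OF M B mem(2)] basis_card_max[OF M B' mem(1)] by simp
    fix \<theta>
    define A where "A = {x\<in>B. v x \<le> \<theta>}"
    have A: "A \<in> \<F>" using mem(1) A_def matroid_hereditary[OF M] by auto
    have A': "{x\<in>B'. v x \<le> \<theta>} \<in> \<F>" using mem(2) matroid_hereditary[OF M] by auto
    show "card {x\<in>B'. v x \<le> \<theta>} \<le> card {x\<in>B. v x \<le> \<theta>}"
    proof (rule ccontr)
      assume "\<not> ?thesis"
      then obtain x where x: "x \<in> B'" "v x \<le> \<theta>" "x \<notin> A" "insert x A \<in> \<F>"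
        using matroid_augment[OF M A A'] by (auto simp: A_def)
      have xB: "x \<notin> B" using x A_def by auto
      obtain D where D: "D \<in> \<F>" "insert x A \<subseteq> D" "D \<subseteq> insert x A \<union> B" "card D = card B"
        using augment_to_card[OF M x(4) mem(1)] basis_card_max[OF M B x(4)] by auto
      have finD: "finite D" using D(1) matroid_finite_indep[OF M] by blast
      have DB: "D - {x} \<subseteq> B" using D(3) A_def by auto
      have "card (D - {x}) < card B"
        using D(2,4) finD by (metis card_Diff1_less insert_subset)
      then have "card (B - (D - {x})) = card B - card (D - {x})"
        using DB fin(1) card_Diff_subset finite_subset by metis
      also have "\<dots> = 1"
        using D(2,4) finD \<open>card (D - {x}) < card B\<close> by (auto simp: card_Diff_singleton_if)
      finally obtain y where y: "B - (D - {x}) = {y}" using card_1_singletonE by blast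
      then have "y \<in> B" "D = insert x (B - {y})" using DB D(2) xB by auto
      moreover have "y \<notin> A" using y D(2) x(3) by blast
      ultimately have "\<theta> < v y" using A_def by auto
      moreover have "v y \<le> v x" using opt \<open>y \<in> B\<close> xB D(1) \<open>D = _\<close> by blast
      ultimately show False using x(2) by simp
    qed
  qed
qed fact

lemma basis_exchange:
  assumes M: "matroid E \<F>" and B: "is_basis \<F> B"
    and "g \<in> B" "h \<notin> B" "insert h (B - {g}) \<in> \<F>"
  shows "is_basis \<F> (insert h (B - {g}))"
proof (rule basis_if_card[OF M B assms(5)])
  have "finite B" using B matroid_finite_indep[OF M] by (auto simp: is_basis_def)
  then show "card (insert h (B - {g})) = card B"
    using assms(3,4) card_Suc_Diff1[of B g] by simp
qed

lemma sum_exchange: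
  fixes v :: "'a \<Rightarrow> real"
  assumes "finite B" "g \<in> B" "h \<notin> B"
  shows "sum v (insert h (B - {g})) = sum v B - v g + v h"
  using assms by (simp add: sum_diff1)

lemma min_weight_imp_exchange_optimal:
  assumes M: "matroid E \<F>" and B: "min_weight_basis v \<F> B"
    and gh: "g \<in> B" "h \<notin> B" "insert h (B - {g}) \<in> \<F>"
  shows "v g \<le> v h"
proof -
  have b: "is_basis \<F> B" using B by (simp add: min_weight_basis_def)
  have "finite B" using b matroid_finite_indep[OF M] by (auto simp: is_basis_def)
  moreover have "sum v B \<le> sum v (insert h (B - {g}))"
    using B basis_exchange[OF M b gh] by (simp add: min_weight_basis_def)
  ultimately show ?thesis using sum_exchange[of B g h v] gh by simp
qed

text \<open>Decide the least disputed element \<open>u\<close> first. If some member contains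
  \<open>u\<close>, keep only the members that do: against every other member \<open>u\<close>
  itself is the least difference. If none does, \<open>u\<close> is not disputed. Either way
  \<open>W\<close> loses \<open>u\<close>.\<close>

lemma ex_preferred:
  fixes \<B> :: "'a::linorder set set"
  assumes "finite W" "\<B> \<noteq> {}" "\<And>B B'. B \<in> \<B> \<Longrightarrow> B' \<in> \<B> \<Longrightarrow> (B - B') \<union> (B' - B) \<subseteq> W"
  shows "\<exists>B\<in>\<B>. \<forall>B'\<in>\<B>. B' \<noteq> B \<longrightarrow> Min ((B - B') \<union> (B' - B)) \<in> B"
  using assms
proof (induction "card W" arbitrary: W \<B>)
  case 0
  from 0(3) obtain B where "B \<in> \<B>" by blast
  moreover have "B' = B" if "B' \<in> \<B>" for B'
    using 0(4)[OF \<open>B \<in> \<B>\<close> that] 0(1,2) by auto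
  ultimately show ?case by blast
next
  case (Suc n)
  define u where "u = Min W"
  have "W \<noteq> {}" using Suc.hyps(2) by auto
  then have u: "u \<in> W" and umin: "\<And>x. x \<in> W \<Longrightarrow> u \<le> x"
    using Suc.prems(1) by (auto simp: u_def)
  define \<C> where "\<C> = {B\<in>\<B>. u \<in> B}"
  have card: "n = card (W - {u})" "finite (W - {u})" using u Suc by auto
  show ?case
  proof (cases "\<C> = {}")
    case True
    have "(B - B') \<union> (B' - B) \<subseteq> W - {u}" if "B \<in> \<B>" "B' \<in> \<B>" for B B'
      using Suc.prems(3)[OF that] that True by (auto simp: \<C>_def)
    then show ?thesis by (rule Suc.hyps(1)[OF card Suc.prems(2)])
  next
    case False
    have "(B - B') \<union> (B' - B) \<subseteq> W - {u}" if "B \<in> \<C>" "B' \<in> \<C>" for B B'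
      using Suc.prems(3)[of B B'] that by (auto simp: \<C>_def)
    then have "\<exists>B\<in>\<C>. \<forall>B'\<in>\<C>. B' \<noteq> B \<longrightarrow> Min ((B - B') \<union> (B' - B)) \<in> B"
      by (rule Suc.hyps(1)[OF card False])
    then obtain B where B: "B \<in> \<C>" "\<And>B'. B' \<in> \<C> \<Longrightarrow> B' \<noteq> B \<Longrightarrow> Min ((B - B') \<union> (B' - B)) \<in> B"
      by metis
    have "Min ((B - B') \<union> (B' - B)) \<in> B" if "B' \<in> \<B>" "B' \<noteq> B" for B'
    proof (cases "B' \<in> \<C>")
      case False
      have "(B - B') \<union> (B' - B) \<subseteq> W" using Suc.prems(3) B(1) that by (auto simp: \<C>_def)
      moreover have "u \<in> (B - B') \<union> (B' - B)" using False B(1) that by (auto simp: \<C>_def)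
      ultimately have "Min ((B - B') \<union> (B' - B)) = u"
        using umin Suc.prems(1) by (intro Min_eqI) (auto intro: finite_subset)
      then show ?thesis using B(1) by (auto simp: \<C>_def)
    qed (use B(2) that in blast)
    then show ?thesis using B(1) by (auto simp: \<C>_def)
  qed
qed

text \<open>The description in \<open>optimal_basis\<close> denotes something: two different
  preferred bases would both contain the least element of their symmetric difference, which lies in
  only one of them.\<close>

lemma optimal_basis_min_weight:
  fixes v :: "'a::linorder \<Rightarrow> real"
  assumes M: "matroid E \<F>" and B: "min_weight_basis v \<F> B"
  shows "min_weight_basis v \<F> (optimal_basis v \<F>)"
proof -
  define \<B> where "\<B> = {B. min_weight_basis v \<F> B}"
  have sub: "A \<subseteq> E" if "A \<in> \<B>" for A
    using that matroid_subset[OF M] by (auto simp: \<B>_def min_weight_basis_def is_basis_def)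
  have "\<exists>B\<in>\<B>. \<forall>B'\<in>\<B>. B' \<noteq> B \<longrightarrow> Min ((B - B') \<union> (B' - B)) \<in> B"
    using B sub by (intro ex_preferred[OF matroid_finite[OF M]]) (auto simp: \<B>_def)
  then obtain A where A: "A \<in> \<B>" "\<And>B'. B' \<in> \<B> \<Longrightarrow> B' \<noteq> A \<Longrightarrow> Min ((A - B') \<union> (B' - A)) \<in> A"
    by metis
  have "optimal_basis v \<F> = A"
    unfolding optimal_basis_def
  proof (rule the_equality)
    show "min_weight_basis v \<F> A \<and> (\<forall>B'. min_weight_basis v \<F> B' \<and> B' \<noteq> A \<longrightarrow>
      Min ((A - B') \<union> (B' - A)) \<in> A)" using A by (auto simp: \<B>_def)
    fix C assume C: "min_weight_basis v \<F> C \<and> (\<forall>B'. min_weight_basis v \<F> B' \<and> B' \<noteq> C \<longrightarrow>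
      Min ((C - B') \<union> (B' - C)) \<in> C)"
    show "C = A"
    proof (rule ccontr)
      assume ne: "C \<noteq> A"
      then have "Min ((C - A) \<union> (A - C)) \<in> C" using C A(1) by (auto simp: \<B>_def)
      moreover have "Min ((A - C) \<union> (C - A)) \<in> A" using A(2)[of C] C ne by (auto simp: \<B>_def)
      moreover have "Min ((A - C) \<union> (C - A)) \<in> (A - C) \<union> (C - A)"
        using ne sub[OF A(1)] sub[of C] C matroid_finite[OF M]
        by (intro Min_in) (auto simp: \<B>_def intro: finite_subset)
      ultimately show False by (auto simp: Un_commute)
    qed
  qed
  then show ?thesis using A(1) by (simp add: \<B>_def)
qed

text \<open>All minimum weight bases have the same weight, so that \<open>removal_value\<close> may
  be computed from whichever of them the simulation produces.\<close>

lemma sum_optimal_basis: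
  fixes v :: "'a::linorder \<Rightarrow> real"
  assumes "matroid E \<F>" "min_weight_basis v \<F> B"
  shows "sum v (optimal_basis v \<F>) = sum v B"
  using optimal_basis_min_weight[OF assms] assms(2) by (simp add: min_weight_basis_def antisym)

section \<open>Simulating the parametric greedy algorithm\<close>

locale interdiction =
  fixes l :: nat and X :: problem
  assumes inst: "interdiction_instance l X"
begin

abbreviation "m \<equiv> ground_size X"
abbreviation "a e \<equiv> real_of_rat (const_coeff X e)"
abbreviation "b e \<equiv> real_of_rat (slope_coeff X e)"
abbreviation "w \<equiv> weight X"

definition crossing :: "nat \<Rightarrow> nat \<Rightarrow> real" where
  "crossing e f = (a f - a e) / (b e - b f)"

text \<open>Strict for closed endpoints as well, so that \<open>above_lower\<close> and
  \<open>below_upper\<close> together describe the interior of the interval. They are phrased by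
  kind and value because these are the numbers found in the input.\<close>

definition above_lower :: "real \<Rightarrow> bool" where
  "above_lower x \<longleftrightarrow> endpoint_kind (lower_end X) = 0 \<or> endpoint_value (lower_end X) < x"

definition below_upper :: "real \<Rightarrow> bool" where
  "below_upper x \<longleftrightarrow> endpoint_kind (upper_end X) = 0 \<or> x < endpoint_value (upper_end X)"

text \<open>At an event of \<open>e\<close> and \<open>f\<close> the element \<open>e\<close> becomes more expensive than \<open>f\<close>. Equality points
  at the ends of the parameter interval are irrelevant.\<close>

definition event :: "nat \<Rightarrow> nat \<Rightarrow> bool" where
  "event e f \<longleftrightarrow> e < m \<and> f < m \<and> b f < b e \<and> above_lower (crossing e f) \<and> below_upper (crossing e f)"

text \<open>For parameters tending to minus infinity the lighter of two elements is the one with the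
  larger slope, and equal slopes leave the decision to the constants. At a finite end the weights
  there decide, and equal weights leave the decision to the slopes.\<close>

definition key1 :: "nat \<Rightarrow> real" where
  "key1 e = (if endpoint_kind (lower_end X) = 0 then - b e
     else a e + endpoint_value (lower_end X) * b e)"

definition key2 :: "nat \<Rightarrow> real" where
  "key2 e = (if endpoint_kind (lower_end X) = 0 then a e else b e)"

text \<open>The order of the elements by weight immediately to the right of the lower end.\<close>

definition before :: "nat \<Rightarrow> nat \<Rightarrow> bool" where
  "before e f \<longleftrightarrow> key1 e < key1 f \<or> key1 e = key1 f \<and> key2 e < key2 f"

lemma matroid_ground: "matroid {..<m} (indep X)"
  using inst by (simp add: interdiction_instance_def ground_def)

lemma matroid_without: "matroid ({..<m} - F) (without X F)"
  unfolding without_def ground_def by (rule matroid_restriction[OF matroid_ground]) auto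

lemma l_le: "l \<le> m"
  using inst by (simp add: interdiction_instance_def)

lemma equality_pairs:
  assumes "lam \<in> parameters X" "e < m" "f < m" "g < m" "h < m" "e \<noteq> f" "g \<noteq> h"
    "w lam e = w lam f" "w lam g = w lam h"
  shows "{e, f} = {g, h}"
  using inst assms unfolding interdiction_instance_def ground_def by blast

lemma coeffs_distinct:
  assumes "e < m" "f < m" "a e = a f" "b e = b f"
  shows "e = f"
  using inst assms unfolding interdiction_instance_def ground_def of_rat_eq_iff by blast

lemma w_diff_crossing:
  assumes "b f < b e"
  shows "w lam e - w lam f = (lam - crossing e f) * (b e - b f)"
proof -
  have "b e - b f \<noteq> 0" using assms by linarith
  then have "crossing e f * (b e - b f) = a f - a e"
    unfolding crossing_def by (metis nonzero_mult_div_cancel_right times_divide_eq_left)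
  then show ?thesis by (simp add: weight_def left_diff_distrib) (simp add: algebra_simps)
qed

lemma w_crossing: "b f < b e \<Longrightarrow> w (crossing e f) e = w (crossing e f) f"
  using w_diff_crossing[of f e "crossing e f"] by simp

lemma parameters_lower:
  "lam \<in> parameters X \<Longrightarrow> endpoint_kind (lower_end X) \<noteq> 0 \<Longrightarrow> endpoint_value (lower_end X) \<le> lam"
  by (cases "lower_end X") (auto simp: parameters_def interval_def)

lemma below_upper_trans: "lam \<in> parameters X \<Longrightarrow> x < lam \<Longrightarrow> below_upper x"
  by (cases "upper_end X") (auto simp: parameters_def interval_def below_upper_def)

lemma interior_parameters: "above_lower x \<Longrightarrow> below_upper x \<Longrightarrow> x \<in> parameters X"
  by (cases "lower_end X"; cases "upper_end X")
    (auto simp: parameters_def interval_def above_lower_def below_upper_def)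

lemma event_parameters: "event e f \<Longrightarrow> crossing e f \<in> parameters X"
  by (simp add: event_def interior_parameters)

text \<open>A difference of two weights is linear in the parameter, so a change of its sign between
  \<open>t\<close> and \<open>lam\<close> fixes the sign of its slope and places the zero strictly
  in between. The last assumption admits the finite lower end itself as \<open>t\<close>; the
  crossing is still interior.\<close>

lemma event_between:
  assumes "lam \<in> parameters X" "g < m" "h < m" "w t g < w t h" "w lam h < w lam g" "t < lam"
    and "above_lower t \<or> endpoint_kind (lower_end X) \<noteq> 0 \<and> t = endpoint_value (lower_end X)"
  shows "event g h \<and> t < crossing g h \<and> crossing g h < lam"
proof -
  have "(b g - b h) * (lam - t) = (w lam g - w lam h) - (w t g - w t h)"
    by (simp add: weight_def algebra_simps)
  also have "\<dots> > 0" using assms(4,5) by linarith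
  finally have bb: "b h < b g" using assms(6) by (simp add: zero_less_mult_iff)
  have "(t - crossing g h) * (b g - b h) < 0" "(lam - crossing g h) * (b g - b h) > 0"
    using w_diff_crossing[OF bb, symmetric] assms(4,5) by simp_all
  then have tl: "t < crossing g h" "crossing g h < lam"
    using bb by (simp_all add: zero_less_mult_iff mult_less_0_iff)
  then have "above_lower (crossing g h)" using assms(7) by (auto simp: above_lower_def)
  moreover have "below_upper (crossing g h)" using below_upper_trans[OF assms(1)] tl by simp
  ultimately show ?thesis using bb tl assms(2,3) by (simp add: event_def)
qed

lemma before_total:
  assumes "e < m" "f < m" "e \<noteq> f"
  shows "before e f \<or> before f e"
proof -
  have "key1 e \<noteq> key1 f \<or> key2 e \<noteq> key2 f"
    using coeffs_distinct[of e f] assms by (auto simp: key1_def key2_def split: if_splits)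
  then show ?thesis unfolding before_def by linarith
qed

lemma before_irrefl: "\<not> before e e"
  by (simp add: before_def)

lemma before_trans: "before e f \<Longrightarrow> before f g \<Longrightarrow> before e g"
  unfolding before_def by linarith

text \<open>An inversion at \<open>lam\<close> would need a crossing to the left of
  \<open>lam\<close>, which is an event. Ties at a finite lower end are no exception, as
  \<open>before\<close> resolves them by slope.\<close>

lemma before_weight_le:
  assumes "g < m" "h < m" "before g h" "lam \<in> parameters X"
    and "\<And>e f. event e f \<Longrightarrow> lam \<le> crossing e f"
  shows "w lam g \<le> w lam h"
proof (rule ccontr)
  assume "\<not> ?thesis"
  then have less: "w lam h < w lam g" by simp
  show False
  proof (cases "endpoint_kind (lower_end X) = 0")
    case True
    then have "b h < b g \<or> b g = b h \<and> a g < a h"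
      using assms(3) by (simp add: before_def key1_def key2_def)
    then show False
    proof
      assume bb: "b h < b g"
      have "(lam - crossing g h) * (b g - b h) > 0"
        using w_diff_crossing[OF bb, of lam] less by linarith
      then have "crossing g h < lam" using bb by (simp add: zero_less_mult_iff)
      then have "event g h"
        using True assms below_upper_trans bb by (simp add: event_def above_lower_def)
      then show False using assms(5) \<open>crossing g h < lam\<close> by force
    qed (use less in \<open>simp add: weight_def\<close>)
  next
    case False
    define L where "L = endpoint_value (lower_end X)"
    have L: "L \<le> lam" using parameters_lower assms(4) False by (simp add: L_def)
    have "w L g < w L h \<or> w L g = w L h \<and> b g < b h"
      using assms(3) False by (simp add: before_def key1_def key2_def weight_def L_def)
    then show False
    proof
      assume *: "w L g < w L h"
      then have "L < lam" using less L by (cases "L = lam") auto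
      then show False
        using event_between[OF assms(4,1,2) * less] assms(5)[of g h] False by (simp add: L_def)
    next
      assume *: "w L g = w L h \<and> b g < b h"
      have "w lam g - w lam h = (w L g - w L h) + (lam - L) * (b g - b h)"
        by (simp add: weight_def algebra_simps)
      also have "\<dots> \<le> 0" using * L by (simp add: mult_nonneg_nonpos)
      finally show False using less by simp
    qed
  qed
qed

text \<open>A pair that is strictly ordered at \<open>t\<close> cannot be inverted without a further
  event before \<open>lam\<close>. A pair with equal weights at \<open>t\<close> must be
  \<open>{e, f}\<close>, since no two pairs tie at the same parameter, and of its two orientations
  the one that becomes wrong is excluded.\<close>

lemma weight_le_after_event:
  assumes "event e f" "t = crossing e f" "g < m" "h < m" "w t g \<le> w t h" "(g, h) \<noteq> (e, f)"
    and lam: "lam \<in> parameters X" "t \<le> lam"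
    and none: "\<And>e' f'. event e' f' \<Longrightarrow> t < crossing e' f' \<Longrightarrow> lam \<le> crossing e' f'"
  shows "w lam g \<le> w lam h"
proof (rule ccontr)
  assume "\<not> ?thesis"
  then have less: "w lam h < w lam g" by simp
  then have tl: "t < lam" using lam(2) assms(5) by (cases "t = lam") auto
  have bb: "b f < b e" using assms(1) by (simp add: event_def)
  show False
  proof (cases "w t g < w t h")
    case True
    have "above_lower t" using assms(1,2) by (simp add: event_def)
    then show False
      using event_between[OF lam(1) assms(3,4) True less tl] none[of g h] by force
  next
    case False
    then have eq: "w t g = w t h" using assms(5) by simp
    have "g \<noteq> h" using less by auto
    moreover have "e \<noteq> f" using bb by auto
    ultimately have "{g, h} = {e, f}"
      using equality_pairs[of t g h e f] event_parameters[OF assms(1)] assms(1-4) eq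
        w_crossing[OF bb] by (auto simp: event_def)
    then have gh: "g = f" "h = e" using assms(6) by (auto simp: doubleton_eq_iff)
    have "(lam - t) * (b e - b f) > 0" using tl bb by simp
    then show False using w_diff_crossing[OF bb, of lam] less gh assms(2) by simp
  qed
qed

end

text \<open>Step \<open>j\<close> tries to replace the element \<open>so j\<close> of the current basis by \<open>si j\<close>. The first \<open>m\<close>
  steps are the greedy algorithm at the lower end of the interval; there the dummy \<open>m\<close> stands for
  the missing outgoing element. The remaining steps are the events in increasing order.\<close>

locale schedule = interdiction +
  fixes si so :: "nat \<Rightarrow> nat" and st :: "nat \<Rightarrow> real" and J :: nat
  assumes m_le_J: "m \<le> J"
    and so_dummy: "i < m \<Longrightarrow> so i = m"
    and si_less: "i < m \<Longrightarrow> si i < m"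
    and si_surj: "h < m \<Longrightarrow> \<exists>i<m. si i = h"
    and si_sorted: "i < j \<Longrightarrow> j < m \<Longrightarrow> before (si i) (si j)"
    and steps_event: "m \<le> j \<Longrightarrow> j < J \<Longrightarrow> event (so j) (si j)"
    and steps_time: "m \<le> j \<Longrightarrow> j < J \<Longrightarrow> st j = crossing (so j) (si j)"
    and st_increasing: "m \<le> i \<Longrightarrow> i < j \<Longrightarrow> j < J \<Longrightarrow> st i < st j"
    and events_covered: "event e f \<Longrightarrow> \<exists>j. m \<le> j \<and> j < J \<and> so j = e \<and> si j = f"
begin

section \<open>The simulated basis for one interdiction set\<close>

definition fires :: "nat set \<Rightarrow> nat \<Rightarrow> nat set \<Rightarrow> bool" where
  "fires F j B \<longleftrightarrow> (so j = m \<or> so j \<in> B) \<and> si j \<notin> B \<and> si j \<notin> F \<and>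
     insert (si j) (B - {so j}) \<in> indep X"

fun sim :: "nat set \<Rightarrow> nat \<Rightarrow> nat set" where
  "sim F 0 = {}"
| "sim F (Suc j) = (if fires F j (sim F j) then insert (si j) (sim F j - {so j}) else sim F j)"

lemma si_less_J: "j < J \<Longrightarrow> si j < m"
  using si_less steps_event[of j] by (cases "j < m") (auto simp: event_def)

lemma so_le_J: "j < J \<Longrightarrow> so j \<le> m"
  using so_dummy steps_event[of j] by (cases "j < m") (auto simp: event_def)

lemma sim_subset: "j \<le> J \<Longrightarrow> sim F j \<subseteq> {..<m} - F"
proof (induction j)
  case (Suc j)
  then show ?case using si_less_J[of j] by (auto simp: fires_def)
qed simp

lemma sim_indep: "sim F j \<in> indep X"
  by (induction j) (auto simp: fires_def matroid_empty[OF matroid_ground])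

lemma sim_without: "j \<le> J \<Longrightarrow> sim F j \<in> without X F"
  using sim_subset sim_indep by (simp add: without_def restriction_def ground_def)

lemma without_indep: "A \<in> without X F \<Longrightarrow> A \<in> indep X"
  by (simp add: without_def restriction_def)

lemma sim_Suc_greedy:
  assumes "j < m"
  shows "sim F (Suc j) = (if fires F j (sim F j) then insert (si j) (sim F j) else sim F j)"
proof -
  have "sim F j \<subseteq> {..<m}" using sim_subset[of j F] assms m_le_J by auto
  then have "sim F j - {so j} = sim F j" using so_dummy[OF assms] by auto
  then show ?thesis by simp
qed

lemma greedy_grows: "i \<le> j \<Longrightarrow> j \<le> m \<Longrightarrow> sim F i \<subseteq> sim F j \<and> sim F j \<subseteq> sim F i \<union> si ` {i..<j}"
proof (induction j rule: dec_induct)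
  case (step j)
  have "{i..<Suc j} = insert j {i..<j}" using step.hyps by auto
  then show ?case using step sim_Suc_greedy[of j F] by auto
qed simp

text \<open>No element is ever removed during the greedy phase, so one that is missing at its end
  was refused at its own turn, and the only possible ground was dependence on the elements chosen
  before it.\<close>

lemma greedy_rejects:
  assumes "i < m" "si i \<notin> F" "si i \<notin> sim F m"
  shows "insert (si i) (sim F i) \<notin> indep X"
proof
  assume *: "insert (si i) (sim F i) \<in> indep X"
  have out: "si i \<notin> sim F i" "si i \<notin> sim F (Suc i)"
    using greedy_grows[of i m F] greedy_grows[of "Suc i" m F] assms by auto
  have "sim F i \<subseteq> {..<m}" using sim_subset[of i F] assms(1) m_le_J by auto
  then have "sim F i - {m} = sim F i" by auto
  then have "fires F i (sim F i)"
    using * out assms(2) so_dummy[OF assms(1)] by (simp add: fires_def)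
  then show False using out(2) by simp
qed

lemma greedy_basis: "is_basis (without X F) (sim F m)"
  unfolding is_basis_def
proof (intro conjI ballI impI)
  show "sim F m \<in> without X F" using sim_without m_le_J by blast
  fix A assume A: "A \<in> without X F" "sim F m \<subseteq> A"
  show "A = sim F m"
  proof (rule ccontr)
    assume "A \<noteq> sim F m"
    then obtain h where h: "h \<in> A" "h \<notin> sim F m" using A by blast
    then have "h < m" "h \<notin> F" using A(1) by (auto simp: without_def restriction_def ground_def)
    then obtain i where i: "i < m" "si i = h" using si_surj by blast
    have "insert h (sim F i) \<subseteq> A" using greedy_grows[of i m F] A(2) h(1) i by auto
    then have "insert h (sim F i) \<in> indep X"
      using matroid_hereditary[OF matroid_ground] without_indep[OF A(1)] by blast
    then show False using greedy_rejects[of i F] i h \<open>h \<notin> F\<close> by auto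
  qed
qed

text \<open>If \<open>g\<close> were not among the elements chosen before the turn of
  \<open>h\<close>, the dependent set that led to the refusal of \<open>h\<close> would be contained
  in the independent exchanged set.\<close>

lemma greedy_exchange:
  assumes "g \<in> sim F m" "h \<notin> sim F m" "insert h (sim F m - {g}) \<in> without X F"
  shows "before g h" "g < m" "h < m"
proof -
  show gm: "g < m" using sim_subset[OF m_le_J, of F] assms(1) by auto
  have h: "h < m" "h \<notin> F" using assms(3) by (auto simp: without_def restriction_def ground_def)
  then show "h < m" by simp
  obtain i where i: "i < m" "si i = h" using si_surj h by blast
  have "insert h (sim F i) \<notin> indep X" using greedy_rejects[of i F] i h assms(2) by auto
  then have "\<not> insert h (sim F i) \<subseteq> insert h (sim F m - {g})"
    using matroid_hereditary[OF matroid_ground] without_indep[OF assms(3)] by blast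
  then have "g \<in> sim F i" using greedy_grows[of i m F] i by auto
  then obtain i' where "i' < i" "si i' = g" using greedy_grows[of 0 i F] i by auto
  then show "before g h" using si_sorted[of i' i] i by auto
qed

text \<open>The exchange criterion is carried from event to event. At the time of an event both
  elements have the same weight, so the basis is optimal there before and after the step; afterwards
  only the pair of the event could turn into a profitable exchange, and this exchange has just been
  performed or found impossible.\<close>

theorem sim_min_weight:
  assumes "m \<le> j" "j \<le> J" "lam \<in> parameters X"
    "m < j \<Longrightarrow> st (j - 1) \<le> lam" "j < J \<Longrightarrow> lam \<le> st j"
  shows "min_weight_basis (w lam) (without X F) (sim F j)"
  using assms
proof (induction j arbitrary: lam rule: dec_induct)
  case base
  show ?case
  proof (rule exchange_optimal_imp_min_weight[OF matroid_without greedy_basis])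
    fix g h assume gh: "g \<in> sim F m" "h \<notin> sim F m" "insert h (sim F m - {g}) \<in> without X F"
    show "w lam g \<le> w lam h"
    proof (rule before_weight_le)
      fix e f assume "event e f"
      then obtain j where j: "m \<le> j" "j < J" "so j = e" "si j = f" using events_covered by blast
      then have "st m \<le> st j" using st_increasing[of m j] by (cases "m = j") auto
      then show "lam \<le> crossing e f" using j steps_time[of j] base by auto
    qed (use greedy_exchange[OF gh] base in auto)
  qed
next
  case (step j)
  define B t where "B = sim F j" and "t = st j"
  have jJ: "j < J" using step.prems by simp
  have ev: "event (so j) (si j)" and t: "t = crossing (so j) (si j)"
    using steps_event steps_time step.hyps jJ by (auto simp: t_def)
  \<comment> \<open>The time \<open>t\<close> is the right end of the range for which the induction
    hypothesis speaks, so the old basis is still optimal at \<open>t\<close>.\<close>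
  have "t \<in> parameters X" using event_parameters[OF ev] t by simp
  moreover have "m < j \<Longrightarrow> st (j - 1) \<le> t"
    using st_increasing[of "j - 1" j] jJ by (fastforce simp: t_def)
  ultimately have opt: "min_weight_basis (w t) (without X F) B"
    unfolding B_def by (intro step.IH) (use jJ in \<open>auto simp: t_def\<close>)
  have basis: "is_basis (without X F) B" using opt by (simp add: min_weight_basis_def)
  have finB: "finite B" using matroid_finite_indep[OF matroid_without] basis by (auto simp: is_basis_def)
  have neq: "so j \<noteq> m" "so j \<noteq> si j" using ev by (auto simp: event_def)
  define B' where "B' = sim F (Suc j)"
  have B': "B' = (if fires F j B then insert (si j) (B - {so j}) else B)"
    by (simp add: B'_def B_def)
  have B'mem: "B' \<in> without X F" using sim_without[of "Suc j"] step.prems(1) by (simp add: B'_def)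
  have opt': "min_weight_basis (w t) (without X F) B'"
  proof (cases "fires F j B")
    case True
    then have x: "so j \<in> B" "si j \<notin> B" and B'eq: "B' = insert (si j) (B - {so j})"
      using neq B' by (auto simp: fires_def)
    have "is_basis (without X F) B'"
      using basis_exchange[OF matroid_without basis x] B'mem by (simp add: B'eq)
    moreover have "sum (w t) B' = sum (w t) B"
      using sum_exchange[OF finB x, of "w t"] w_crossing[of "si j" "so j"] ev t
      by (simp add: B'eq event_def)
    ultimately show ?thesis using opt by (simp add: min_weight_basis_def)
  qed (use opt B' in simp)
  have basis': "is_basis (without X F) B'" using opt' by (simp add: min_weight_basis_def)
  show ?case unfolding B'_def[symmetric]
  proof (rule exchange_optimal_imp_min_weight[OF matroid_without basis'])
    fix g h assume gh: "g \<in> B'" "h \<notin> B'" "insert h (B' - {g}) \<in> without X F"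
    have le: "w t g \<le> w t h" by (rule min_weight_imp_exchange_optimal[OF matroid_without opt' gh])
    have gm: "g < m" "h < m"
      using gh B'mem by (auto simp: without_def restriction_def ground_def)
    \<comment> \<open>After a successful exchange \<open>so j\<close> is no longer in the basis. If
      the step did not fire although both memberships were right, then the exchange was dependent or
      \<open>si j\<close> was interdicted.\<close>
    have "(g, h) \<noteq> (so j, si j)"
    proof
      assume "(g, h) = (so j, si j)"
      then have "so j \<in> B'" "si j \<notin> B'" "insert (si j) (B' - {so j}) \<in> without X F" using gh by auto
      then show False using B'
        by (auto simp: fires_def without_def restriction_def ground_def split: if_splits)
    qed
    then show "w lam g \<le> w lam h"
    proof (rule weight_le_after_event[OF ev t gm le _ step.prems(2)])
      show "t \<le> lam" using step.prems(3) step.hyps by (simp add: t_def)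
      fix e f assume "event e f" "t < crossing e f"
      then obtain i where i: "m \<le> i" "i < J" "so i = e" "si i = f" using events_covered by blast
      then have "st i = crossing e f" using steps_time[of i] by simp
      then have "j < i" using \<open>t < crossing e f\<close> st_increasing[of i j] i jJ unfolding t_def
        by (metis linorder_less_linear order_less_asym)
      then have "st (Suc j) \<le> st i" using st_increasing[of "Suc j" i] i step.hyps
        by (cases "Suc j = i") auto
      then show "lam \<le> crossing e f" using step.prems(4) \<open>j < i\<close> i \<open>st i = _\<close> by simp
    qed
  qed
qed

end

section \<open>Verifying programs and their running time\<close>

text \<open>The elapsed time is an argument of the postcondition, so that result, termination and
  running time are proved together.\<close>

definition wp :: "nat set set \<Rightarrow> nat \<Rightarrow> nat \<Rightarrow> com \<Rightarrow> (nat \<Rightarrow> memory \<Rightarrow> bool) \<Rightarrow> memory \<Rightarrow> bool" where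
  "wp \<F> m d P Q s \<longleftrightarrow> (\<exists>t s'. exec \<F> m d P s t s' \<and> Q t s')"

definition setn :: "memory \<Rightarrow> string \<Rightarrow> nat \<Rightarrow> nat \<Rightarrow> memory" where
  "setn s x i v = s\<lparr>nats := (nats s)(x := (nats s x)(i := v))\<rparr>"

definition setr :: "memory \<Rightarrow> string \<Rightarrow> nat \<Rightarrow> real \<Rightarrow> memory" where
  "setr s x i v = s\<lparr>reals := (reals s)(x := (reals s x)(i := v))\<rparr>"

lemma mem_simps [simp]:
  "nats (setn s x i v) = (\<lambda>y j. if y = x \<and> j = i then v else nats s y j)"
  "reals (setn s x i v) = reals s"
  "nats (setr s x i r) = nats s"
  "reals (setr s x i r) = (\<lambda>y j. if y = x \<and> j = i then r else reals s y j)"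
  by (auto simp: setn_def setr_def fun_eq_iff)

lemma wp_mono: "wp \<F> m d P Q s \<Longrightarrow> (\<And>t s'. Q t s' \<Longrightarrow> R t s') \<Longrightarrow> wp \<F> m d P R s"
  unfolding wp_def by blast

lemma wp_Skip: "wp \<F> m d Skip Q s \<longleftrightarrow> Q 1 s"
proof
  show "wp \<F> m d Skip Q s \<Longrightarrow> Q 1 s"
    unfolding wp_def by (auto elim!: exec_SkipE)
  show "Q 1 s \<Longrightarrow> wp \<F> m d Skip Q s"
    unfolding wp_def using exec.Skip by blast
qed

lemma wp_NAssign: "wp \<F> m d (NAssign x i a) Q s \<longleftrightarrow>
    Q (1 + ncost i + ncost a) (setn s x (nval s i) (nval s a))" (is "_ \<longleftrightarrow> ?R")
proof
  show "wp \<F> m d (NAssign x i a) Q s \<Longrightarrow> ?R"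
    unfolding wp_def setn_def by (auto elim!: exec_NAssignE)
  show "?R \<Longrightarrow> wp \<F> m d (NAssign x i a) Q s"
    unfolding wp_def setn_def using exec.NAssign by blast
qed

lemma wp_RAssign: "wp \<F> m d (RAssign x i a) Q s \<longleftrightarrow>
    Q (1 + ncost i + rcost a) (setr s x (nval s i) (rval s a))" (is "_ \<longleftrightarrow> ?R")
proof
  show "wp \<F> m d (RAssign x i a) Q s \<Longrightarrow> ?R"
    unfolding wp_def setr_def by (auto elim!: exec_RAssignE)
  show "?R \<Longrightarrow> wp \<F> m d (RAssign x i a) Q s"
    unfolding wp_def setr_def using exec.RAssign by blast
qed

lemma wp_Query: "wp \<F> m d (Query x i y) Q s \<longleftrightarrow>
    Q (1 + ncost i + d) (setn s x (nval s i) (if {e. e < m \<and> nats s y e \<noteq> 0} \<in> \<F> then 1 else 0))"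
  (is "_ \<longleftrightarrow> ?R")
proof
  show "wp \<F> m d (Query x i y) Q s \<Longrightarrow> ?R"
    unfolding wp_def setn_def by (auto elim!: exec_QueryE)
  show "?R \<Longrightarrow> wp \<F> m d (Query x i y) Q s"
    unfolding wp_def setn_def using exec.Query by blast
qed

lemma wp_Seq: "wp \<F> m d (Seq P R) Q s \<longleftrightarrow> wp \<F> m d P (\<lambda>t. wp \<F> m d R (\<lambda>u. Q (t + u))) s"
  unfolding wp_def by (blast intro: exec.Seq elim: exec_SeqE)

lemma wp_If: "wp \<F> m d (If b P R) Q s \<longleftrightarrow>
    (if bval s b then wp \<F> m d P (\<lambda>t. Q (1 + bcost b + t)) s else wp \<F> m d R (\<lambda>t. Q (1 + bcost b + t)) s)"
  (is "_ \<longleftrightarrow> ?R")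
proof
  show "wp \<F> m d (If b P R) Q s \<Longrightarrow> ?R"
    unfolding wp_def by (auto elim!: exec_IfE)
  show "?R \<Longrightarrow> wp \<F> m d (If b P R) Q s"
    unfolding wp_def using exec.IfTrue[of s b \<F> m d P] exec.IfFalse[of s b \<F> m d R]
    by (cases "bval s b") (simp; blast)+
qed

lemmas wp_simps = wp_Skip wp_NAssign wp_RAssign wp_Query wp_Seq wp_If

section \<open>Frame rule: arrays that a command cannot change\<close>

fun nwrites :: "com \<Rightarrow> string set" where
  "nwrites Skip = {}"
| "nwrites (NAssign x i a) = {x}"
| "nwrites (RAssign x i a) = {}"
| "nwrites (Query x i y) = {x}"
| "nwrites (Seq P Q) = nwrites P \<union> nwrites Q"
| "nwrites (If b P Q) = nwrites P \<union> nwrites Q"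
| "nwrites (While b P) = nwrites P"

fun rwrites :: "com \<Rightarrow> string set" where
  "rwrites Skip = {}"
| "rwrites (NAssign x i a) = {}"
| "rwrites (RAssign x i a) = {x}"
| "rwrites (Query x i y) = {}"
| "rwrites (Seq P Q) = rwrites P \<union> rwrites Q"
| "rwrites (If b P Q) = rwrites P \<union> rwrites Q"
| "rwrites (While b P) = rwrites P"

definition agree_outside :: "string set \<Rightarrow> string set \<Rightarrow> memory \<Rightarrow> memory \<Rightarrow> bool" where
  "agree_outside A B s s' \<longleftrightarrow>
     (\<forall>x. x \<notin> A \<longrightarrow> nats s' x = nats s x) \<and> (\<forall>x. x \<notin> B \<longrightarrow> reals s' x = reals s x)"

lemma agree_outsideD:
  assumes "agree_outside A B s s'"
  shows "x \<notin> A \<Longrightarrow> nats s' x = nats s x" "x \<notin> B \<Longrightarrow> reals s' x = reals s x"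
  using assms by (auto simp: agree_outside_def)

lemma exec_agree: "exec \<F> m d P s t s' \<Longrightarrow> agree_outside (nwrites P) (rwrites P) s s'"
  by (induction rule: exec.induct) (auto simp: agree_outside_def)

lemma wp_frame:
  assumes "wp \<F> m d P Q s"
  shows "wp \<F> m d P (\<lambda>t s'. Q t s' \<and> agree_outside (nwrites P) (rwrites P) s s') s"
  using assms exec_agree unfolding wp_def by blast

text \<open>Every use of a specification also delivers its frame, computed from the program text.
  Specifications therefore mention only the arrays whose new contents matter.\<close>

lemma wp_conseq:
  assumes "wp \<F> m d P Q s"
    and "\<And>t s'. Q t s' \<Longrightarrow> agree_outside (nwrites P) (rwrites P) s s' \<Longrightarrow> Q' t s'"
  shows "wp \<F> m d P Q' s"
  using wp_frame[OF assms(1)] assms(2) unfolding wp_def by blast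

lemma wp_SeqI:
  assumes "wp \<F> m d P Q s"
    and "\<And>t s'. Q t s' \<Longrightarrow> agree_outside (nwrites P) (rwrites P) s s' \<Longrightarrow>
      wp \<F> m d P' (\<lambda>u. Q' (t + u)) s'"
  shows "wp \<F> m d (Seq P P') Q' s"
  unfolding wp_Seq by (rule wp_conseq[OF assms])

section \<open>Notation for commands, and counting loops\<close>

abbreviation N :: "string \<Rightarrow> nexp" where "N x \<equiv> NCell x (NConst 0)"
abbreviation R :: "string \<Rightarrow> rexp" where "R x \<equiv> RCell x (NConst 0)"
abbreviation nset :: "string \<Rightarrow> nexp \<Rightarrow> com" (infix "::=" 62) where "x ::= a \<equiv> NAssign x (NConst 0) a"
abbreviation rset :: "string \<Rightarrow> rexp \<Rightarrow> com" (infix "::~" 62) where "x ::~ a \<equiv> RAssign x (NConst 0) a"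
abbreviation Seq' :: "com \<Rightarrow> com \<Rightarrow> com" (infixr ";;" 61) where "P ;; Q \<equiv> Seq P Q"
abbreviation inc :: "string \<Rightarrow> com" where "inc x \<equiv> x ::= NAdd (N x) (NConst 1)"
abbreviation Or :: "bexp \<Rightarrow> bexp \<Rightarrow> bexp" where "Or b c \<equiv> Not (And (Not b) (Not c))"
abbreviation NZ :: "nexp \<Rightarrow> bexp" where "NZ a \<equiv> NLess (NConst 0) a"

definition For :: "string \<Rightarrow> nexp \<Rightarrow> com \<Rightarrow> com" where
  "For i n P = (i ::= NConst 0 ;; While (NLess (N i) n) (P ;; inc i))"

lemma writes_For [simp]:
  "nwrites (For i n P) = insert i (nwrites P)" "rwrites (For i n P) = rwrites P"
  by (auto simp: For_def)

text \<open>Initialising the counter costs 3, each evaluation of the guard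
  \<open>4 + ncost n\<close>, each increment 6; this gives the bound in \<open>post\<close>. The
  bound \<open>n\<close> is evaluated anew in every round, hence the premise that it keeps the value
  \<open>b\<close>. The invariant is required after the increment, since it is stated about memories
  in which the counter already has its new value.\<close>

lemma wp_For:
  assumes I0: "I 0 (setn s i 0 0)"
    and bound: "\<And>k s'. k \<le> b \<Longrightarrow> I k s' \<Longrightarrow> nats s' i 0 = k \<Longrightarrow>
      agree_outside (insert i (nwrites P)) (rwrites P) s s' \<Longrightarrow> nval s' n = b"
    and step: "\<And>k s'. k < b \<Longrightarrow> I k s' \<Longrightarrow> nats s' i 0 = k \<Longrightarrow>
      agree_outside (insert i (nwrites P)) (rwrites P) s s' \<Longrightarrow>
      wp \<F> m d P (\<lambda>t s''. t \<le> c \<and> nats s'' i 0 = k \<and> I (Suc k) (setn s'' i 0 (Suc k))) s'"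
    and post: "\<And>t s'. t \<le> 7 + ncost n + b * (c + 10 + ncost n) \<Longrightarrow> I b s' \<Longrightarrow> nats s' i 0 = b \<Longrightarrow>
      agree_outside (insert i (nwrites P)) (rwrites P) s s' \<Longrightarrow> Q t s'"
  shows "wp \<F> m d (For i n P) Q s"
proof -
  let ?g = "NLess (N i) n" and ?P = "P ;; inc i"
  let ?A = "agree_outside (insert i (nwrites P)) (rwrites P) s"
  have loop: "\<exists>t s''. exec \<F> m d (While ?g ?P) s' t s'' \<and> t \<le> 4 + ncost n + (b - k) * (c + 10 + ncost n) \<and>
      I b s'' \<and> nats s'' i 0 = b \<and> ?A s''"
    if "k \<le> b" "I k s'" "nats s' i 0 = k" "?A s'" for k s'
    using that
  proof (induction "b - k" arbitrary: k s')
    case 0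
    then have "k = b" by simp
    then have "\<not> bval s' ?g" using bound[of k s'] 0 by simp
    then have "exec \<F> m d (While ?g ?P) s' (1 + bcost ?g) s'" by (rule exec.WhileFalse)
    then show ?case using 0 \<open>k = b\<close> by (intro exI[of _ "1 + bcost ?g"] exI[of _ s']) auto
  next
    case (Suc n')
    then have kb: "k < b" by simp
    then have g: "bval s' ?g" using bound[of k s'] Suc.prems by simp
    obtain t s1 where s1: "exec \<F> m d P s' t s1" "t \<le> c" "nats s1 i 0 = k"
      "I (Suc k) (setn s1 i 0 (Suc k))"
      using step[OF kb Suc.prems(2-4)] unfolding wp_def by blast
    let ?s2 = "setn s1 i 0 (Suc k)"
    have "wp \<F> m d (inc i) (\<lambda>t s'. t = 6 \<and> s' = ?s2) s1"
      by (simp add: wp_NAssign s1(3))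
    then have "exec \<F> m d (inc i) s1 6 ?s2" unfolding wp_def by blast
    then have body: "exec \<F> m d ?P s' (t + 6) ?s2" using s1(1) exec.Seq by blast
    have "?A s1" using exec_agree[OF s1(1)] Suc.prems(4) by (auto simp: agree_outside_def)
    then have "?A ?s2" by (auto simp: agree_outside_def fun_eq_iff)
    then obtain u s3 where s3: "exec \<F> m d (While ?g ?P) ?s2 u s3"
      "u \<le> 4 + ncost n + (b - Suc k) * (c + 10 + ncost n)" "I b s3" "nats s3 i 0 = b" "?A s3"
      using Suc.hyps(1)[of "Suc k" ?s2] Suc.hyps(2) s1(4) kb by (simp only: mem_simps) fastforce
    have "exec \<F> m d (While ?g ?P) s' (1 + bcost ?g + (t + 6) + u) s3"
      by (rule exec.WhileTrue[OF g body s3(1)])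
    moreover have "1 + bcost ?g + (t + 6) + u \<le> 4 + ncost n + (b - k) * (c + 10 + ncost n)"
    proof -
      have "b - k = Suc (b - Suc k)" using kb by simp
      then show ?thesis using s3(2) s1(2) by simp
    qed
    ultimately show ?case using s3 by blast
  qed
  have "?A (setn s i 0 0)" by (auto simp: agree_outside_def fun_eq_iff)
  then obtain t s' where s': "exec \<F> m d (While ?g ?P) (setn s i 0 0) t s'"
    "t \<le> 4 + ncost n + b * (c + 10 + ncost n)" "I b s'" "nats s' i 0 = b" "?A s'"
    using loop[of 0 "setn s i 0 0"] I0 by auto
  have "wp \<F> m d (i ::= NConst 0) (\<lambda>t s'. t = 3 \<and> s' = setn s i 0 0) s"
    by (simp add: wp_NAssign)
  then have "exec \<F> m d (For i n P) s (3 + t) s'"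
    unfolding For_def wp_def using exec.Seq s'(1) by blast
  moreover have "Q (3 + t) s'" using s' by (intro post) auto
  ultimately show ?thesis unfolding wp_def by blast
qed

section \<open>Scheduling the steps\<close>

definition keys_prog :: com where
  "keys_prog = For ''e'' (N ''size'')
    (If (NZ (N ''lower''))
      (RAssign ''k1'' (N ''e'') (RAdd (RCell ''const'' (N ''e'')) (RMul (R ''lower'') (RCell ''slope'' (N ''e'')))) ;;
       RAssign ''k2'' (N ''e'') (RCell ''slope'' (N ''e'')))
      (RAssign ''k1'' (N ''e'') (RSub (RConst 0) (RCell ''slope'' (N ''e''))) ;;
       RAssign ''k2'' (N ''e'') (RCell ''const'' (N ''e''))))"

definition before_test :: bexp where
  "before_test = Or (RLess (RCell ''k1'' (N ''f'')) (RCell ''k1'' (N ''e'')))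
    (And (Not (RLess (RCell ''k1'' (N ''e'')) (RCell ''k1'' (N ''f''))))
      (RLess (RCell ''k2'' (N ''f'')) (RCell ''k2'' (N ''e''))))"

text \<open>Sorting by counting predecessors: the number of smaller elements is the position of
  \<open>e\<close>. The cells of \<open>so\<close> receive the dummy of the greedy steps.\<close>

definition rank_prog :: com where
  "rank_prog = For ''e'' (N ''size'')
    (''r'' ::= NConst 0 ;;
     For ''f'' (N ''size'') (If before_test (inc ''r'') Skip) ;;
     NAssign ''so'' (N ''r'') (N ''size'') ;;
     NAssign ''si'' (N ''r'') (N ''e''))"

text \<open>The pair \<open>lk\<close>, \<open>lv\<close> is a moving lower limit: the lower end of
  the interval at the start, the time of the last logged event later on.\<close>

definition inside_test :: bexp where
  "inside_test = And (Or (Not (NZ (N ''lk''))) (RLess (R ''lv'') (R ''x'')))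
    (Or (Not (NZ (N ''upper''))) (RLess (R ''x'') (R ''upper'')))"

text \<open>Row \<open>e\<close> remembers only the earliest remaining event at which
  \<open>e\<close> becomes the more expensive element: \<open>h\<close> tells whether there is one,
  \<open>nt\<close> is its time and \<open>nf\<close> the partner.\<close>

definition row_prog :: com where
  "row_prog = NAssign ''h'' (N ''e'') (NConst 0) ;;
    For ''f'' (N ''size'')
      (If (RLess (RCell ''slope'' (N ''f'')) (RCell ''slope'' (N ''e'')))
        (''x'' ::~ RDiv (RSub (RCell ''const'' (N ''f'')) (RCell ''const'' (N ''e'')))
            (RSub (RCell ''slope'' (N ''e'')) (RCell ''slope'' (N ''f''))) ;;
         If (And inside_test (Or (Not (NZ (NCell ''h'' (N ''e'')))) (RLess (R ''x'') (RCell ''nt'' (N ''e'')))))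
           (NAssign ''h'' (N ''e'') (NConst 1) ;;
            RAssign ''nt'' (N ''e'') (R ''x'') ;;
            NAssign ''nf'' (N ''e'') (N ''f''))
           Skip)
        Skip)"

definition next_prog :: com where
  "next_prog = ''has'' ::= NConst 0 ;;
    For ''g'' (N ''size'')
      (If (And (NZ (NCell ''h'' (N ''g'')))
          (Or (Not (NZ (N ''has''))) (RLess (RCell ''nt'' (N ''g'')) (RCell ''nt'' (N ''e'')))))
        (''has'' ::= NConst 1 ;; ''e'' ::= N ''g'') Skip)"

definition advance_prog :: com where
  "advance_prog = If (NZ (N ''has''))
    (NAssign ''so'' (N ''J'') (N ''e'') ;;
     NAssign ''si'' (N ''J'') (NCell ''nf'' (N ''e'')) ;;
     RAssign ''st'' (N ''J'') (RCell ''nt'' (N ''e'')) ;;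
     ''lv'' ::~ RCell ''nt'' (N ''e'') ;;
     ''lk'' ::= NConst 1 ;;
     inc ''J'' ;;
     row_prog)
    Skip"

text \<open>Logging an event invalidates the cached entry of one row only, so each of the
  \<open>m * m\<close> rounds takes time \<open>O(m)\<close>. Rounds after the last event do
  nothing.\<close>

definition events_prog :: com where
  "events_prog = ''lk'' ::= N ''lower'' ;; ''lv'' ::~ R ''lower'' ;;
    For ''e'' (N ''size'') row_prog ;;
    ''J'' ::= N ''size'' ;;
    For ''q'' (NMul (N ''size'') (N ''size''))
      (next_prog ;; advance_prog)"

context interdiction
begin

text \<open>The zeros in cell \<open>m\<close> are the coefficients of the dummy element, so that
  one formula for the change of a line serves greedy steps and events alike.\<close>

definition input_ok :: "memory \<Rightarrow> bool" where
  "input_ok s \<longleftrightarrow> nats s ''size'' 0 = m \<and>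
     nats s ''lower'' 0 = endpoint_kind (lower_end X) \<and> nats s ''upper'' 0 = endpoint_kind (upper_end X) \<and>
     reals s ''lower'' 0 = endpoint_value (lower_end X) \<and> reals s ''upper'' 0 = endpoint_value (upper_end X) \<and>
     (\<forall>e<m. reals s ''const'' e = a e \<and> reals s ''slope'' e = b e) \<and>
     reals s ''const'' m = 0 \<and> reals s ''slope'' m = 0"

lemma input_okD:
  assumes "input_ok s"
  shows "nats s ''size'' 0 = m"
    "nats s ''lower'' 0 = endpoint_kind (lower_end X)" "nats s ''upper'' 0 = endpoint_kind (upper_end X)"
    "reals s ''lower'' 0 = endpoint_value (lower_end X)" "reals s ''upper'' 0 = endpoint_value (upper_end X)"
    "e < m \<Longrightarrow> reals s ''const'' e = a e" "e < m \<Longrightarrow> reals s ''slope'' e = b e"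
    "reals s ''const'' m = 0" "reals s ''slope'' m = 0"
  using assms by (auto simp: input_ok_def)

lemma input_ok_agree:
  assumes "input_ok s" "agree_outside A B s s'"
    "''size'' \<notin> A" "''lower'' \<notin> A" "''upper'' \<notin> A"
    "''lower'' \<notin> B" "''upper'' \<notin> B" "''const'' \<notin> B" "''slope'' \<notin> B"
  shows "input_ok s'"
  using assms unfolding input_ok_def agree_outside_def by simp

lemma keys_correct:
  assumes "input_ok s"
  shows "wp \<F> k d keys_prog (\<lambda>t s'. t \<le> 60 * m + 60 \<and>
    (\<forall>e<m. reals s' ''k1'' e = key1 e \<and> reals s' ''k2'' e = key2 e)) s"
  unfolding keys_prog_def
proof (rule wp_For[where b = m and c = 40 and
      I = "\<lambda>k s'. \<forall>e<k. reals s' ''k1'' e = key1 e \<and> reals s' ''k2'' e = key2 e"], goal_cases)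
  case (2 k s')
  then show ?case using agree_outsideD[OF 2(4)] input_okD[OF assms] by simp
next
  case (3 k s')
  then show ?case using agree_outsideD[OF 3(4)] input_okD[OF assms]
    by (simp add: wp_simps key1_def key2_def less_Suc_eq)
qed simp_all

section \<open>Sorting the elements for the greedy phase\<close>

definition rank :: "nat \<Rightarrow> nat" where
  "rank e = card {f. f < m \<and> before f e}"

lemma rank_mono:
  assumes "e < m" "before e f"
  shows "rank e < rank f"
  unfolding rank_def
proof (rule psubset_card_mono)
  show "{g. g < m \<and> before g e} \<subset> {g. g < m \<and> before g f}"
    using assms before_trans before_irrefl by blast
qed simp

lemma rank_inj: "e < m \<Longrightarrow> f < m \<Longrightarrow> rank e = rank f \<Longrightarrow> e = f"
  using rank_mono before_total by (metis less_irrefl)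

lemma rank_less: "e < m \<Longrightarrow> rank e < m"
proof -
  assume "e < m"
  then have "{f. f < m \<and> before f e} \<subset> {..<m}" using before_irrefl by blast
  then have "rank e < card {..<m}" unfolding rank_def by (intro psubset_card_mono) simp_all
  then show ?thesis by simp
qed

lemma card_filter_Suc:
  "card {f. f < Suc k \<and> Q f} = card {f. f < k \<and> Q f} + (if Q k then 1 else 0)"
proof -
  have "{f. f < Suc k \<and> Q f} = (if Q k then insert k {f. f < k \<and> Q f} else {f. f < k \<and> Q f})"
    by (auto simp: less_Suc_eq)
  then show ?thesis by simp
qed

lemma rank_correct:
  assumes "input_ok s" and keys: "\<And>e. e < m \<Longrightarrow> reals s ''k1'' e = key1 e \<and> reals s ''k2'' e = key2 e"
  shows "wp \<F> k d rank_prog (\<lambda>t s'. t \<le> (80 * m + 80) * m + 80 \<and>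
    (\<forall>e<m. nats s' ''si'' (rank e) = e \<and> nats s' ''so'' (rank e) = m)) s"
  unfolding rank_prog_def
proof (rule wp_For[where b = m and c = "70 * m + 60" and
      I = "\<lambda>k s'. \<forall>e<k. nats s' ''si'' (rank e) = e \<and> nats s' ''so'' (rank e) = m"], goal_cases)
  case (2 k s')
  then show ?case using agree_outsideD[OF 2(4)] input_okD[OF assms(1)] by (simp add: before_test_def)
next
  case (3 e s')
  note A = agree_outsideD[OF 3(4)] and inp = input_okD[OF assms(1)]
  have before_iff: "before f g \<longleftrightarrow> key1 f < key1 g \<or> \<not> key1 g < key1 f \<and> key2 f < key2 g" for f g
    unfolding before_def by linarith
  show ?case
    unfolding wp_Seq wp_NAssign
  proof (rule wp_For[where b = m and c = 50 and I = "\<lambda>k s'. nats s' ''r'' 0 = card {f. f < k \<and> before f e}"], goal_cases)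
    case (2 k s2)
    then show ?case using agree_outsideD[OF 2(4)] A inp by (simp add: before_test_def)
  next
    case (3 k s2)
    then show ?case using agree_outsideD[OF 3(4)] A inp keys \<open>nats s' ''e'' 0 = e\<close> \<open>e < m\<close>
      by (simp add: before_test_def wp_simps card_filter_Suc before_iff)
  next
    case (4 t s2)
    have "nats s2 ''r'' 0 = rank e" using 4(2) by (simp add: rank_def)
    moreover have "rank e' \<noteq> rank e" if "e' < e" for e'
      using rank_inj[of e' e] that \<open>e < m\<close> by auto
    ultimately show ?case using agree_outsideD[OF 4(4)] 4(1) A inp 3(1-3)
      by (simp add: before_test_def All_less_Suc wp_simps)
  qed (use A inp in simp_all)
qed (simp_all add: algebra_simps)

section \<open>Producing the events in increasing order\<close>

definition candidate :: "(real \<Rightarrow> bool) \<Rightarrow> nat \<Rightarrow> nat \<Rightarrow> bool" where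
  "candidate U e f \<longleftrightarrow> b f < b e \<and> U (crossing e f)"

definition row_ok :: "(real \<Rightarrow> bool) \<Rightarrow> nat \<Rightarrow> nat \<Rightarrow> nat \<Rightarrow> real \<Rightarrow> nat \<Rightarrow> bool" where
  "row_ok U e k h nt nf \<longleftrightarrow> (if h = 0 then \<forall>f<k. \<not> candidate U e f
     else nf < k \<and> candidate U e nf \<and> nt = crossing e nf \<and> (\<forall>f<k. candidate U e f \<longrightarrow> nt \<le> crossing e f))"

text \<open>The times that still lie ahead of the search. The predicates with an argument
  \<open>U\<close> abstract from the memory in which these times are encoded.\<close>

definition beyond :: "memory \<Rightarrow> real \<Rightarrow> bool" where
  "beyond s x \<longleftrightarrow> (nats s ''lk'' 0 = 0 \<or> reals s ''lv'' 0 < x) \<and> below_upper x"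

lemma row_correct:
  assumes "input_ok s" "nats s ''e'' 0 = e" "e < m"
  shows "wp \<F> k d row_prog (\<lambda>t s'. t \<le> 200 * m + 200 \<and>
    row_ok (beyond s) e m (nats s' ''h'' e) (reals s' ''nt'' e) (nats s' ''nf'' e) \<and>
    (\<forall>g. g \<noteq> e \<longrightarrow> nats s' ''h'' g = nats s ''h'' g \<and> nats s' ''nf'' g = nats s ''nf'' g \<and>
      reals s' ''nt'' g = reals s ''nt'' g)) s"
  unfolding row_prog_def wp_Seq wp_NAssign
proof (rule wp_For[where b = m and c = 150 and
      I = "\<lambda>k s'. row_ok (beyond s) e k (nats s' ''h'' e) (reals s' ''nt'' e) (nats s' ''nf'' e) \<and>
    (\<forall>g. g \<noteq> e \<longrightarrow> nats s' ''h'' g = nats s ''h'' g \<and> nats s' ''nf'' g = nats s ''nf'' g \<and>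
      reals s' ''nt'' g = reals s ''nt'' g)"], goal_cases)
  case 1
  then show ?case using assms by (simp add: row_ok_def)
next
  case (2 k s')
  then show ?case using agree_outsideD[OF 2(4)] input_okD[OF assms(1)] by (simp add: inside_test_def)
next
  case (3 k s')
  note A = agree_outsideD[OF 3(4)] and inp = input_okD[OF assms(1)]
  define h nt nf where "h = nats s' ''h'' e" and "nt = reals s' ''nt'' e" and "nf = nats s' ''nf'' e"
  have row: "row_ok (beyond s) e k h nt nf" using 3(2) by (simp add: h_def nt_def nf_def)
  have skip: "row_ok (beyond s) e (Suc k) h nt nf"
    if "\<not> (b k < b e \<and> beyond s (crossing e k) \<and> (h = 0 \<or> crossing e k < nt))"
    using row that unfolding row_ok_def candidate_def
    by (auto simp: less_Suc_eq not_less split: if_splits)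
  have take: "row_ok (beyond s) e (Suc k) (Suc 0) (crossing e k) k"
    if "b k < b e" "beyond s (crossing e k)" "h = 0 \<or> crossing e k < nt"
    using row that unfolding row_ok_def candidate_def
    by (auto simp: less_Suc_eq not_less split: if_splits)
  have cr: "(a k - a e) / (b e - b k) = crossing e k" by (simp add: crossing_def)
  have "beyond s x \<longleftrightarrow> (nats s ''lk'' 0 = 0 \<or> reals s ''lv'' 0 < x) \<and>
    (nats s ''upper'' 0 = 0 \<or> x < reals s ''upper'' 0)" for x
    by (simp add: beyond_def below_upper_def inp)
  then show ?case using 3(1-3) A inp assms skip take
    by (simp add: wp_simps inside_test_def cr h_def nt_def nf_def)
qed (simp_all add: inside_test_def)

lemma next_correct:
  assumes "input_ok s"
  shows "wp \<F> k d next_prog (\<lambda>t s'. t \<le> 100 * m + 100 \<and>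
    (if nats s' ''has'' 0 = 0 then \<forall>g<m. nats s ''h'' g = 0
     else nats s' ''e'' 0 < m \<and> nats s ''h'' (nats s' ''e'' 0) \<noteq> 0 \<and>
       (\<forall>g<m. nats s ''h'' g \<noteq> 0 \<longrightarrow> reals s ''nt'' (nats s' ''e'' 0) \<le> reals s ''nt'' g))) s"
  unfolding next_prog_def wp_Seq wp_NAssign
proof (rule wp_For[where b = m and c = 60 and I = "\<lambda>k s'.
    if nats s' ''has'' 0 = 0 then \<forall>g<k. nats s ''h'' g = 0
     else nats s' ''e'' 0 < k \<and> nats s ''h'' (nats s' ''e'' 0) \<noteq> 0 \<and>
       (\<forall>g<k. nats s ''h'' g \<noteq> 0 \<longrightarrow> reals s ''nt'' (nats s' ''e'' 0) \<le> reals s ''nt'' g)"], goal_cases)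
  case (2 k s')
  then show ?case using agree_outsideD[OF 2(4)] input_okD[OF assms] by simp
next
  case (3 k s')
  note A = agree_outsideD[OF 3(4)] and inp = input_okD[OF assms]
  have less: "\<forall>g<k. nats s ''h'' g \<noteq> 0 \<longrightarrow> reals s ''nt'' k \<le> reals s ''nt'' g"
    if "reals s ''nt'' k < reals s ''nt'' e" "\<forall>g<k. nats s ''h'' g \<noteq> 0 \<longrightarrow> reals s ''nt'' e \<le> reals s ''nt'' g" for e
    using that by (meson less_le_trans less_imp_le)
  show ?case
  proof (cases "nats s' ''has'' 0 = 0")
    case True
    then show ?thesis using 3(1-3) A inp by (simp add: wp_simps All_less_Suc)
  next
    case False
    then show ?thesis using 3(1-3) A inp less[of "nats s' ''e'' 0"]
      by (simp add: wp_simps All_less_Suc not_less)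
  qed
qed simp_all

definition log_ok :: "(real \<Rightarrow> bool) \<Rightarrow> nat \<Rightarrow> (nat \<Rightarrow> nat) \<Rightarrow> (nat \<Rightarrow> nat) \<Rightarrow> (nat \<Rightarrow> real) \<Rightarrow> bool" where
  "log_ok U J so si st \<longleftrightarrow>
     (\<forall>j. m \<le> j \<and> j < J \<longrightarrow> event (so j) (si j) \<and> st j = crossing (so j) (si j) \<and> \<not> U (st j)) \<and>
     (\<forall>i j. m \<le> i \<and> i < j \<and> j < J \<longrightarrow> st i < st j) \<and>
     (\<forall>e f. event e f \<longrightarrow> U (crossing e f) \<or> (\<exists>j. m \<le> j \<and> j < J \<and> so j = e \<and> si j = f))"

text \<open>Two pairs never tie at the same parameter, and the orientation of a pair can be read off
  its slopes. A time therefore identifies its event, which makes the logged times strictly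
  increasing.\<close>

lemma event_unique:
  assumes "event e f" "event e' f'" "crossing e f = crossing e' f'"
  shows "e = e' \<and> f = f'"
proof -
  have bb: "b f < b e" "b f' < b e'" using assms by (auto simp: event_def)
  have "{e, f} = {e', f'}"
    using equality_pairs[OF event_parameters[OF assms(1)], of e f e' f'] bb assms
      w_crossing[OF bb(1)] w_crossing[OF bb(2)] by (auto simp: event_def)
  then show ?thesis using bb by (auto simp: doubleton_eq_iff)
qed

text \<open>Moving the limit to \<open>t\<close> drops exactly one event from those ahead: later
  ones remain ahead, none is earlier because \<open>t\<close> is least, and by uniqueness no other
  event happens at \<open>t\<close> itself.\<close>

lemma log_ok_step:
  assumes log: "log_ok U J so si st" and "m \<le> J"
    and ev: "event e f" and U: "U t" and t: "t = crossing e f"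
    and least: "\<And>e' f'. event e' f' \<Longrightarrow> U (crossing e' f') \<Longrightarrow> t \<le> crossing e' f'"
    and up: "\<And>x y. U x \<Longrightarrow> x \<le> y \<Longrightarrow> below_upper y \<Longrightarrow> U y"
    and U': "\<And>x. U' x \<longleftrightarrow> t < x \<and> below_upper x"
    and so': "\<And>j. so' j = (if j = J then e else so j)" and si': "\<And>j. si' j = (if j = J then f else si j)"
    and st': "\<And>j. st' j = (if j = J then t else st j)"
  shows "log_ok U' (Suc J) so' si' st'"
proof -
  have old: "event (so j) (si j)" "st j = crossing (so j) (si j)" "st j < t" if "m \<le> j" "j < J" for j
  proof -
    show e: "event (so j) (si j)" and c: "st j = crossing (so j) (si j)"
      using log that by (auto simp: log_ok_def)
    have notU: "\<not> U (st j)" using log that by (auto simp: log_ok_def)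
    show "st j < t"
    proof (rule ccontr)
      assume "\<not> st j < t"
      then have "U (st j)" by (intro up[OF U]) (use e c in \<open>auto simp: event_def\<close>)
      then show False using notU by simp
    qed
  qed
  have cov: "U' (crossing e' f') \<or> (\<exists>j. m \<le> j \<and> j < Suc J \<and> so' j = e' \<and> si' j = f')"
    if "event e' f'" for e' f'
  proof (cases "U (crossing e' f')")
    case False
    then obtain j where "m \<le> j" "j < J" "so j = e'" "si j = f'"
      using log \<open>event e' f'\<close> unfolding log_ok_def by blast
    then show ?thesis by (intro disjI2 exI[of _ j]) (auto simp: so' si')
  next
    case True
    then have "t \<le> crossing e' f'" using least that by blast
    then consider "t < crossing e' f'" | "crossing e f = crossing e' f'" using t by linarith
    then show ?thesis
    proof cases
      case 1
      then show ?thesis using that by (simp add: U' event_def)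
    next
      case 2
      then show ?thesis using event_unique[OF ev that] \<open>m \<le> J\<close>
        by (intro disjI2 exI[of _ J]) (auto simp: so' si')
    qed
  qed
  moreover have "st' i < st' j" if "m \<le> i" "i < j" "j < Suc J" for i j
    using that old(3)[of i] log by (auto simp: st' log_ok_def less_Suc_eq)
  moreover have "event (so' j) (si' j) \<and> st' j = crossing (so' j) (si' j) \<and> \<not> U' (st' j)"
    if "m \<le> j" "j < Suc J" for j
    using that old[of j] ev t by (cases "j = J") (auto simp: so' si' st' U')
  ultimately show ?thesis unfolding log_ok_def by blast
qed

text \<open>The logged events are distinct ordered pairs. Diagonal pairs are not events, and leaving
  out \<open>(0, 0)\<close> suffices for the strict bound, by which \<open>m * m\<close> rounds
  exhaust the search.\<close>

lemma log_ok_length: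
  assumes "log_ok U J so si st"
  shows "J \<le> m + m * m" and "m \<noteq> 0 \<Longrightarrow> J < m + m * m"
proof -
  define g where "g j = (so j, si j)" for j
  have ev: "event (so j) (si j)" "st j = crossing (so j) (si j)" if "m \<le> j" "j < J" for j
    using assms that by (auto simp: log_ok_def)
  have "inj_on g {m..<J}"
  proof (rule linorder_inj_onI)
    fix i j assume *: "i < j" "i \<in> {m..<J}" "j \<in> {m..<J}"
    then have "st i < st j" using assms by (auto simp: log_ok_def)
    then show "g i \<noteq> g j" using ev[of i] ev[of j] * by (auto simp: g_def)
  qed auto
  moreover have sub: "g ` {m..<J} \<subseteq> {..<m} \<times> {..<m} - {(0, 0)}"
    using ev by (fastforce simp: g_def event_def)
  ultimately have "card {m..<J} \<le> card ({..<m} \<times> {..<m} - {(0, 0)})"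
    using card_inj_on_le by (metis finite_Diff finite_SigmaI finite_lessThan)
  moreover have "card ({..<m} \<times> {..<m} - {(0::nat, 0::nat)}) = m * m - (if m = 0 then 0 else 1)"
    by (simp add: card_Diff_singleton_if)
  ultimately have J: "J - m \<le> m * m - (if m = 0 then 0 else 1)" by simp
  then show "J \<le> m + m * m" by linarith
  show "J < m + m * m" if "m \<noteq> 0"
  proof -
    have "0 < m * m" using that by simp
    moreover have "J - m \<le> m * m - 1" using J that by (simp only: if_False)
    ultimately show ?thesis by linarith
  qed
qed

lemma beyond_cong:
  "nats s' ''lk'' = nats s ''lk'' \<Longrightarrow> reals s' ''lv'' = reals s ''lv'' \<Longrightarrow> beyond s' = beyond s"
  by (simp add: beyond_def fun_eq_iff)

lemma beyond_mono: "beyond s x \<Longrightarrow> x \<le> y \<Longrightarrow> below_upper y \<Longrightarrow> beyond s y"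
  by (auto simp: beyond_def)

definition search_ok :: "memory \<Rightarrow> bool" where
  "search_ok s \<longleftrightarrow> m \<le> nats s ''J'' 0 \<and>
     log_ok (beyond s) (nats s ''J'' 0) (nats s ''so'') (nats s ''si'') (reals s ''st'') \<and>
     (\<forall>g<m. row_ok (beyond s) g m (nats s ''h'' g) (reals s ''nt'' g) (nats s ''nf'' g)) \<and>
     (\<forall>x. beyond s x \<longrightarrow> above_lower x)"

text \<open>The final disjunction measures progress: a round either lengthens the log or finds that
  no event is left. As the log cannot grow in all \<open>m * m\<close> rounds, the second case is
  reached in time.\<close>

lemma search_step:
  assumes "input_ok s" "search_ok s"
  shows "wp \<F> k d
    (next_prog ;; advance_prog)
    (\<lambda>t s'. t \<le> 300 * m + 400 \<and> search_ok s' \<and>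
      (\<forall>i<m. nats s' ''so'' i = nats s ''so'' i \<and> nats s' ''si'' i = nats s ''si'' i) \<and>
      (nats s' ''J'' 0 = Suc (nats s ''J'' 0) \<and> (\<exists>e f. event e f \<and> beyond s (crossing e f)) \<or>
       nats s' ''J'' 0 = nats s ''J'' 0 \<and> (\<forall>e f. event e f \<longrightarrow> \<not> beyond s' (crossing e f)))) s"
proof (rule wp_SeqI[OF next_correct[OF assms(1)]], goal_cases)
  case (1 t s1)
  note A = agree_outsideD[OF 1(2)] and inp = input_okD[OF assms(1)]
  have in1: "input_ok s1" by (rule input_ok_agree[OF assms(1) 1(2)]) (simp_all add: next_prog_def)
  define U J so si st where "U = beyond s" and "J = nats s ''J'' 0" and "so = nats s ''so''"
    and "si = nats s ''si''" and "st = reals s ''st''"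
  define h nt nf where "h = nats s ''h''" and "nt = reals s ''nt''" and "nf = nats s ''nf''"
  have "m \<le> J" and log: "log_ok U J so si st" and rows: "\<And>g. g < m \<Longrightarrow> row_ok U g m (h g) (nt g) (nf g)"
    and low: "\<And>x. U x \<Longrightarrow> above_lower x"
    using assms(2) by (auto simp: search_ok_def U_def J_def so_def si_def st_def h_def nt_def nf_def)
  have same: "nats s1 x = nats s x" if "x \<in> {''J'', ''so'', ''si'', ''h'', ''nf'', ''lk''}" for x
    using A(1)[of x] that by (auto simp: next_prog_def)
  have same_r: "reals s1 x = reals s x" for x using A by (simp add: next_prog_def)
  have U1: "beyond s1 = U" unfolding U_def by (rule beyond_cong) (simp_all add: same same_r)
  show ?case
  proof (cases "nats s1 ''has'' 0 = 0")
    case True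
    then have "\<forall>g<m. h g = 0" using 1(1) by (simp add: h_def)
    then have "\<not> U (crossing e f)" if "event e f" for e f
      using rows[of e] that by (auto simp: row_ok_def candidate_def event_def)
    then show ?thesis using True 1(1) assms(2) U1
      by (simp add: advance_prog_def wp_simps search_ok_def same same_r U_def)
  next
    case False
    define e where "e = nats s1 ''e'' 0"
    have e: "e < m" "h e \<noteq> 0" and least: "\<And>g. g < m \<Longrightarrow> h g \<noteq> 0 \<Longrightarrow> nt e \<le> nt g"
      using 1(1) False by (auto simp: e_def h_def nt_def)
    define f t where "f = nf e" and "t = nt e"
    have cand: "b f < b e" "U t" "t = crossing e f" "f < m"
      using rows[OF e(1)] e(2) by (auto simp: row_ok_def candidate_def f_def t_def)
    have t_le: "t \<le> crossing e' f'" if "event e' f'" "U (crossing e' f')" for e' f'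
    proof -
      have "candidate U e' f'" "e' < m" "f' < m" using that by (auto simp: candidate_def event_def)
      then have "h e' \<noteq> 0" "nt e' \<le> crossing e' f'"
        using rows[of e'] by (auto simp: row_ok_def split: if_splits)
      then show ?thesis using least[of e'] \<open>e' < m\<close> by (simp add: t_def)
    qed
    have below: "below_upper t" using cand(2) by (simp add: U_def beyond_def)
    have ev: "event e f" using cand e low[OF cand(2)] below by (simp add: event_def)
    define s2 where "s2 = setn (setn (setr (setr (setn (setn s1 ''so'' J e) ''si'' J f) ''st'' J t) ''lv'' 0 t) ''lk'' 0 1) ''J'' 0 (Suc J)"
    have in2: "input_ok s2" using in1 by (simp add: input_ok_def s2_def)
    have U2: "beyond s2 x \<longleftrightarrow> t < x \<and> below_upper x" for x by (simp add: beyond_def s2_def)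
    have UU: "U x" if "beyond s2 x" for x
      using that beyond_mono[of s t x] cand(2) by (auto simp: U2 U_def)
    have log2: "log_ok (beyond s2) (Suc J) (nats s2 ''so'') (nats s2 ''si'') (reals s2 ''st'')"
    proof (rule log_ok_step[OF log \<open>m \<le> J\<close> ev cand(2,3) t_le _ U2])
      show "U y" if "U x" "x \<le> y" "below_upper y" for x y
        using that beyond_mono by (simp add: U_def)
    qed (auto simp: s2_def same same_r so_def si_def st_def)
    \<comment> \<open>A cached minimum survives the move of the limit: its own event differs from
      the logged one and so comes strictly later, while the set of candidates only shrinks.\<close>
    have row2: "row_ok (beyond s2) g m (h g) (nt g) (nf g)" if "g < m" "g \<noteq> e" for g
    proof (cases "h g = 0")
      case True
      then show ?thesis using rows[OF that(1)] UU by (auto simp: row_ok_def candidate_def)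
    next
      case False
      then have g: "nf g < m" "candidate U g (nf g)" "nt g = crossing g (nf g)"
        "\<And>f'. f' < m \<Longrightarrow> candidate U g f' \<Longrightarrow> nt g \<le> crossing g f'"
        using rows[OF that(1)] by (auto simp: row_ok_def)
      have bel: "below_upper (nt g)" using g(2,3) by (simp add: candidate_def U_def beyond_def)
      then have "event g (nf g)" using g that low by (auto simp: candidate_def event_def)
      then have "nt g \<noteq> t" using event_unique[OF _ ev, of g "nf g"] g(3) cand(3) that(2) by auto
      then have "t < nt g" using least[OF that(1) False] by (simp add: t_def)
      then have "candidate (beyond s2) g (nf g)" using g bel by (auto simp: candidate_def U2)
      then show ?thesis using g False UU by (auto simp: row_ok_def candidate_def)
    qed
    have e2: "nats s2 ''e'' 0 = e" by (simp add: s2_def e_def)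
    have row: "wp \<F> k d row_prog (\<lambda>u s'. u \<le> 200 * m + 200 \<and> search_ok s' \<and>
        nats s' ''J'' 0 = Suc J \<and> (\<forall>i<m. nats s' ''so'' i = so i \<and> nats s' ''si'' i = si i)) s2"
    proof (rule wp_conseq[OF row_correct[OF in2 e2 e(1)]], goal_cases)
      case (1 u s3)
      have B: "x \<notin> {''h'', ''f'', ''nf''} \<Longrightarrow> nats s3 x = nats s2 x"
        "x \<notin> {''x'', ''nt''} \<Longrightarrow> reals s3 x = reals s2 x" for x
        using agree_outsideD[OF 1(2)] by (simp_all add: row_prog_def)
      have U3: "beyond s3 = beyond s2" by (rule beyond_cong) (rule B; simp)+
      have "row_ok (beyond s3) g m (nats s3 ''h'' g) (reals s3 ''nt'' g) (nats s3 ''nf'' g)" if "g < m" for g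
        using 1(1) row2[OF that] U3 by (cases "g = e") (simp_all add: s2_def h_def nt_def nf_def same same_r)
      moreover have "nats s3 ''J'' 0 = Suc J" using B by (simp add: s2_def)
      moreover have "\<forall>i<m. nats s3 ''so'' i = so i \<and> nats s3 ''si'' i = si i"
        using B \<open>m \<le> J\<close> by (simp add: s2_def same so_def si_def)
      moreover have "log_ok (beyond s3) (Suc J) (nats s3 ''so'') (nats s3 ''si'') (reals s3 ''st'')"
        using log2 U3 B by simp
      moreover have "\<forall>x. beyond s3 x \<longrightarrow> above_lower x" using U3 UU low by auto
      ultimately show ?case using 1(1) \<open>m \<le> J\<close> by (simp add: search_ok_def)
    qed
    \<comment> \<open>The local definitions are unfolded so that the statement matches the memory
      produced by symbolic execution.\<close>
    note row' = row[unfolded s2_def J_def f_def t_def nt_def nf_def One_nat_def]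
    show ?thesis
      using False 1(1)
      apply (simp add: advance_prog_def wp_simps same same_r e_def[symmetric])
      apply (rule wp_mono[OF row'])
      using ev cand(2,3)
      apply (auto simp: so_def si_def U_def)
      done
  qed
qed

lemma search_ok_setn: "search_ok (setn s ''q'' i v) = search_ok s"
proof -
  have "beyond (setn s ''q'' i v) = beyond s" by (rule beyond_cong) simp_all
  then show ?thesis by (simp add: search_ok_def)
qed

lemma rank_surj:
  assumes "i < m"
  shows "\<exists>e<m. rank e = i"
proof -
  have "rank ` {..<m} = {..<m}"
    by (rule endo_inj_surj) (auto intro: inj_onI rank_inj simp: rank_less)
  then show ?thesis using assms by (metis image_iff lessThan_iff)
qed

lemma schedule_if_log_ok:
  assumes order: "\<And>e. e < m \<Longrightarrow> si (rank e) = e \<and> so (rank e) = m"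
    and log: "log_ok U J so si st" "m \<le> J" and none: "\<And>e f. event e f \<Longrightarrow> \<not> U (crossing e f)"
  shows "schedule l X si so st J"
proof (intro schedule.intro[OF interdiction_axioms] schedule_axioms.intro)
  show "so i = m" "si i < m" if "i < m" for i
    using rank_surj[OF that] order by auto
  show "\<exists>i<m. si i = h" if "h < m" for h
    using order[OF that] rank_less[OF that] by blast
  show "before (si i) (si j)" if ij: "i < j" "j < m" for i j
  proof -
    obtain e f where "e < m" "rank e = i" "f < m" "rank f = j"
      using rank_surj[OF less_trans[OF ij]] rank_surj[OF ij(2)] by blast
    then show ?thesis using order before_total[of e f] rank_mono[of f e] ij by fastforce
  qed
  show "event (so j) (si j)" "st j = crossing (so j) (si j)" if "m \<le> j" "j < J" for j
    using log(1) that by (simp_all add: log_ok_def)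
  show "st i < st j" if "m \<le> i" "i < j" "j < J" for i j
    using log(1) that unfolding log_ok_def by blast
  show "\<exists>j. m \<le> j \<and> j < J \<and> so j = e \<and> si j = f" if "event e f" for e f
    using log(1) none[OF that] that unfolding log_ok_def by blast
qed fact

lemma events_correct:
  assumes "input_ok s" and order: "\<And>e. e < m \<Longrightarrow> nats s ''si'' (rank e) = e \<and> nats s ''so'' (rank e) = m"
  shows "wp \<F> k d events_prog (\<lambda>t s'. t \<le> 700 * (m * m * m + m * m + m + 1) \<and>
    nats s' ''J'' 0 \<le> m + m * m \<and>
    schedule l X (nats s' ''si'') (nats s' ''so'') (reals s' ''st'') (nats s' ''J'' 0)) s"
proof -
  note inp = input_okD[OF assms(1)]
  define s0 where "s0 = setr (setn s ''lk'' 0 (endpoint_kind (lower_end X))) ''lv'' 0 (endpoint_value (lower_end X))"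
  define U0 where "U0 x \<longleftrightarrow> above_lower x \<and> below_upper x" for x
  have in0: "input_ok s0" using assms(1) by (simp add: input_ok_def s0_def)
  have U0: "beyond s0 = U0" by (simp add: fun_eq_iff beyond_def U0_def above_lower_def s0_def)
  have init: "wp \<F> k d (For ''e'' (N ''size'') row_prog) (\<lambda>t s'. t \<le> 9 + m * (200 * m + 212) \<and>
      (\<forall>g<m. row_ok U0 g m (nats s' ''h'' g) (reals s' ''nt'' g) (nats s' ''nf'' g))) s0"
  proof (rule wp_For[where b = m and c = "200 * m + 200" and
      I = "\<lambda>k s'. \<forall>g<k. row_ok U0 g m (nats s' ''h'' g) (reals s' ''nt'' g) (nats s' ''nf'' g)"], goal_cases)
    case (2 k s')
    then show ?case using agree_outsideD[OF 2(4)] input_okD[OF in0] by (simp add: row_prog_def)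
  next
    case (3 k s')
    have in1: "input_ok s'" by (rule input_ok_agree[OF in0 3(4)]) (simp_all add: row_prog_def)
    have "beyond s' = U0" unfolding U0[symmetric]
      by (rule beyond_cong; rule agree_outsideD[OF 3(4)]) (simp_all add: row_prog_def)
    show ?case
    proof (rule wp_conseq[OF row_correct[OF in1 3(3,1)]], goal_cases)
      case (1 t s2)
      then show ?case using 3(2,3) \<open>beyond s' = U0\<close> agree_outsideD(1)[OF 1(2), of "''e''"]
        by (simp add: All_less_Suc row_prog_def)
    qed
  qed (simp_all add: algebra_simps)
  define step where "step = (next_prog ;; advance_prog)"
  have main: "wp \<F> k d (For ''q'' (NMul (N ''size'') (N ''size'')) step)
      (\<lambda>t s'. t \<le> 12 + m * m * (300 * m + 415) \<and> nats s' ''J'' 0 \<le> m + m * m \<and>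
        schedule l X (nats s' ''si'') (nats s' ''so'') (reals s' ''st'') (nats s' ''J'' 0)) s1"
    if in1: "input_ok s1" and search1: "search_ok s1" and J1: "nats s1 ''J'' 0 = m"
      and order1: "\<And>i. nats s1 ''so'' i = nats s ''so'' i \<and> nats s1 ''si'' i = nats s ''si'' i" for s1
  proof (rule wp_For[where b = "m * m" and c = "300 * m + 400" and I = "\<lambda>k s'. search_ok s' \<and>
      (\<forall>i<m. nats s' ''so'' i = nats s ''so'' i \<and> nats s' ''si'' i = nats s ''si'' i) \<and>
      nats s' ''J'' 0 \<le> m + k \<and>
      (nats s' ''J'' 0 = m + k \<or> (\<forall>e f. event e f \<longrightarrow> \<not> beyond s' (crossing e f)))"], goal_cases)
    case 1
    then show ?case using search1 J1 order1 by (simp add: search_ok_setn)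
  next
    case (2 k s')
    then show ?case using agree_outsideD[OF 2(4)] input_okD[OF in1]
      by (simp add: step_def row_prog_def next_prog_def advance_prog_def)
  next
    case (3 k s')
    have in2: "input_ok s'"
      by (rule input_ok_agree[OF in1 3(4)]) (simp_all add: step_def row_prog_def next_prog_def advance_prog_def)
    have search2: "search_ok s'" using 3 by simp
    show ?case
    proof (rule wp_conseq[OF search_step[OF in2 search2, folded step_def]], goal_cases)
      case (1 t s2)
      have "nats s2 ''q'' = nats s' ''q''"
        using agree_outsideD(1)[OF 1(2), of "''q''"] by (simp add: step_def row_prog_def next_prog_def advance_prog_def)
      moreover have "beyond (setn s2 ''q'' 0 (Suc k)) = beyond s2" by (rule beyond_cong) simp_all
      ultimately show ?case using 1(1) 3(2,3) by (auto simp: search_ok_setn)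
    qed
  next
    case (4 t s')
    have log: "log_ok (beyond s') (nats s' ''J'' 0) (nats s' ''so'') (nats s' ''si'') (reals s' ''st'')"
      and J: "m \<le> nats s' ''J'' 0" using 4(2) by (simp_all add: search_ok_def)
    \<comment> \<open>Growth of the log in every round would give \<open>J = m + m * m\<close>,
      which the strict length bound rules out; the existence of an event ensures
      \<open>m \<noteq> 0\<close>.\<close>
    have "\<not> beyond s' (crossing e f)" if "event e f" for e f
      using 4(2) log_ok_length(2)[OF log] that by (auto simp: event_def)
    then have "schedule l X (nats s' ''si'') (nats s' ''so'') (reals s' ''st'') (nats s' ''J'' 0)"
      using order 4(2) rank_less by (intro schedule_if_log_ok[OF _ log J]) auto
    then show ?case using 4 by (simp add: add.commute)
  qed
  show ?thesis
    unfolding events_prog_def step_def[symmetric]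
    apply (simp add: wp_simps inp s0_def[symmetric])
  proof (rule wp_conseq[OF init], goal_cases)
    case (1 t s1)
    note A = agree_outsideD[OF 1(2)]
    have in1: "input_ok s1" by (rule input_ok_agree[OF in0 1(2)]) (simp_all add: row_prog_def)
    define s2 where "s2 = setn s1 ''J'' 0 (nats s1 ''size'' 0)"
    have J2: "nats s2 ''J'' 0 = m" using input_okD(1)[OF in1] by (simp add: s2_def)
    have U2: "beyond s2 = U0" unfolding U0[symmetric]
      by (rule beyond_cong) (use A in \<open>simp_all add: s2_def row_prog_def\<close>)
    have "log_ok U0 m so si st" for so si st
      by (auto simp: log_ok_def U0_def event_def)
    then have "search_ok s2" using 1(1) by (simp add: search_ok_def J2 U2) (simp add: s2_def U0_def)
    moreover have "input_ok s2" using in1 by (simp add: input_ok_def s2_def)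
    moreover have "nats s2 ''so'' i = nats s ''so'' i \<and> nats s2 ''si'' i = nats s ''si'' i" for i
      using A by (simp add: s2_def s0_def row_prog_def)
    ultimately have "wp \<F> k d (For ''q'' (NMul (N ''size'') (N ''size'')) step)
      (\<lambda>t s'. t \<le> 12 + m * m * (300 * m + 415) \<and> nats s' ''J'' 0 \<le> m + m * m \<and>
        schedule l X (nats s' ''si'') (nats s' ''so'') (reals s' ''st'') (nats s' ''J'' 0)) s2"
      using J2 by (intro main) auto
    then show ?case unfolding s2_def wp_Seq wp_NAssign nval.simps
      by (rule wp_mono) (use 1(1) in \<open>simp add: algebra_simps\<close>)
  qed
qed

end

section \<open>Simulation for all interdiction sets\<close>

text \<open>Cell \<open>m\<close> of \<open>B\<close> is 1 between steps, so that the dummy passes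
  the membership test of the outgoing element. The query reads only cells below \<open>m\<close>;
  both branches after it restore cell \<open>m\<close> if it was cleared. The bits of set
  \<open>n\<close> form row \<open>n\<close> of a table with \<open>J\<close> columns.\<close>

definition step_prog :: com where
  "step_prog = ''o'' ::= NCell ''so'' (N ''j'') ;; ''f'' ::= NCell ''si'' (N ''j'') ;;
    ''ix'' ::= NAdd (NMul (N ''n'') (N ''J'')) (N ''j'') ;;
    NAssign ''mk'' (N ''ix'') (NConst 0) ;;
    If (And (NZ (NCell ''B'' (N ''o''))) (And (Not (NZ (NCell ''B'' (N ''f'')))) (Not (NZ (NCell ''in'' (N ''f''))))))
      (NAssign ''B'' (N ''o'') (NConst 0) ;; NAssign ''B'' (N ''f'') (NConst 1) ;;
       Query ''qr'' (NConst 0) ''B'' ;;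
       If (NZ (N ''qr''))
         (NAssign ''B'' (N ''size'') (NConst 1) ;; NAssign ''mk'' (N ''ix'') (NConst 1))
         (NAssign ''B'' (N ''f'') (NConst 0) ;; NAssign ''B'' (N ''o'') (NConst 1)))
      Skip"

definition sim_prog :: com where
  "sim_prog = For ''e'' (N ''size'') (NAssign ''B'' (N ''e'') (NConst 0)) ;;
    NAssign ''B'' (N ''size'') (NConst 1) ;;
    For ''j'' (N ''J'') step_prog"

context schedule
begin

definition schedule_mem :: "memory \<Rightarrow> bool" where
  "schedule_mem s \<longleftrightarrow> nats s ''size'' 0 = m \<and> nats s ''J'' 0 = J \<and>
     (\<forall>j<J. nats s ''so'' j = so j \<and> nats s ''si'' j = si j)"

lemma schedule_mem_agree:
  assumes "schedule_mem s" "agree_outside A B s s'"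
    "''size'' \<notin> A" "''J'' \<notin> A" "''so'' \<notin> A" "''si'' \<notin> A"
  shows "schedule_mem s'"
  using assms unfolding schedule_mem_def agree_outside_def by simp

definition bits :: "memory \<Rightarrow> nat set \<Rightarrow> bool" where
  "bits s B \<longleftrightarrow> (\<forall>e<m. nats s ''B'' e = (if e \<in> B then 1 else 0)) \<and> nats s ''B'' m = 1"

lemma step_correct:
  assumes mem: "schedule_mem s" and j: "nats s ''j'' 0 = j" "j < J" and n: "nats s ''n'' 0 = n"
    and B: "bits s B" "B \<subseteq> {..<m}" and F: "\<And>e. e < m \<Longrightarrow> nats s ''in'' e = 0 \<longleftrightarrow> e \<notin> F"
  shows "wp (indep X) m d step_prog (\<lambda>t s'. t \<le> 150 + d \<and>
    bits s' (if fires F j B then insert (si j) (B - {so j}) else B) \<and>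
    (\<forall>i. nats s' ''mk'' i = (if i = n * J + j then if fires F j B then 1 else 0 else nats s ''mk'' i))) s"
proof -
  have so: "nats s ''so'' j = so j" and si: "nats s ''si'' j = si j" and J: "nats s ''J'' 0 = J"
    and size: "nats s ''size'' 0 = m" using mem j by (simp_all add: schedule_mem_def)
  have le: "so j \<le> m" "si j < m" and ne: "so j \<noteq> si j" "si j \<noteq> m"
    using so_le_J[OF j(2)] si_less_J[OF j(2)] steps_event[OF _ j(2)] so_dummy[of j]
    by (cases "j < m"; auto simp: event_def)+
  have "nats s ''B'' (so j) = (if so j = m \<or> so j \<in> B then 1 else 0)"
    using B(1) le(1) by (cases "so j = m") (simp_all add: bits_def)
  then have Bo: "nats s ''B'' (so j) = 0 \<longleftrightarrow> \<not> (so j = m \<or> so j \<in> B)"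
    and Bo1: "nats s ''B'' (so j) \<noteq> 0 \<Longrightarrow> nats s ''B'' (so j) = 1"
    by (simp_all split: if_splits)
  have Bf: "nats s ''B'' (si j) = 0 \<longleftrightarrow> si j \<notin> B" using B(1) le by (simp add: bits_def)
  have Ff: "nats s ''in'' (si j) = 0 \<longleftrightarrow> si j \<notin> F" using F le by simp
  \<comment> \<open>The left side is the form in which simplification leaves the tested set after
    the two assignments to \<open>B\<close>.\<close>
  have query: "{e. e \<noteq> so j \<and> (e \<noteq> so j \<longrightarrow> (e = si j \<longrightarrow> si j < m) \<and>
      (e \<noteq> si j \<longrightarrow> e < m \<and> 0 < nats s ''B'' e))} = insert (si j) (B - {so j})"
    using B le ne by (auto simp: bits_def split: if_splits)
  define c where "c \<longleftrightarrow> (so j = m \<or> so j \<in> B) \<and> si j \<notin> B \<and> si j \<notin> F"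
  define I where "I \<longleftrightarrow> insert (si j) (B - {so j}) \<in> indep X"
  have f: "fires F j B \<longleftrightarrow> c \<and> I" by (auto simp: fires_def c_def I_def)
  show ?thesis
  proof (cases c)
    case False
    then consider "nats s ''B'' (so j) = 0" | "nats s ''B'' (si j) \<noteq> 0" | "nats s ''in'' (si j) \<noteq> 0"
      using Bo Bf Ff by (auto simp: c_def)
    then show ?thesis using B(1) False
      by cases (simp_all add: step_prog_def wp_simps j n so si J size f bits_def)
  next
    case True
    then have c: "nats s ''B'' (so j) \<noteq> 0" "nats s ''B'' (si j) = 0" "nats s ''in'' (si j) = 0"
      using Bo Bf Ff by (auto simp: c_def)
    have B': "bits s' (insert (si j) (B - {so j}))"
      if "\<And>e. nats s' ''B'' e = (if e = m then 1 else if e = si j then 1 else if e = so j then 0 else nats s ''B'' e)" for s'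
      using B le ne by (auto simp: bits_def that)
    have so': "so j = m \<or> so j \<in> B" using True by (simp add: c_def)
    have B'': "bits s' B"
      if "\<And>e. nats s' ''B'' e = (if e = so j then 1 else if e = si j then 0 else if e = si j then 1 else if e = so j then 0 else nats s ''B'' e)" for s'
      using B le ne Bo1[OF c(1)] Bf c(2) so' by (auto simp: bits_def that)
    show ?thesis using c True ne
      apply (simp add: step_prog_def wp_simps j n so si J size f)
      apply (simp only: query I_def[symmetric])
      apply (intro conjI impI; (rule B', simp)?; (rule B'', simp)?; simp)
      done
  qed
qed

lemma sim_correct:
  assumes mem: "schedule_mem s" and n: "nats s ''n'' 0 = n"
    and F: "\<And>e. e < m \<Longrightarrow> nats s ''in'' e = 0 \<longleftrightarrow> e \<notin> F"
  shows "wp (indep X) m d sim_prog (\<lambda>t s'. t \<le> (200 + d) * (J + 1) \<and>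
    (\<forall>j<J. nats s' ''mk'' (n * J + j) = (if fires F j (sim F j) then 1 else 0)) \<and>
    (\<forall>i<n * J. nats s' ''mk'' i = nats s ''mk'' i)) s"
proof -
  have size: "nats s ''size'' 0 = m" using mem by (simp add: schedule_mem_def)
  have clear: "wp (indep X) m d (For ''e'' (N ''size'') (NAssign ''B'' (N ''e'') (NConst 0)))
      (\<lambda>t s'. t \<le> 9 + m * 17 \<and> (\<forall>e<m. nats s' ''B'' e = 0)) s"
  proof (rule wp_For[where b = m and c = 5 and I = "\<lambda>k s'. \<forall>e<k. nats s' ''B'' e = 0"], goal_cases)
    case (2 k s')
    then show ?case using agree_outsideD[OF 2(4)] size by simp
  next
    case (3 k s')
    then show ?case by (simp add: wp_simps less_Suc_eq)
  qed simp_all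
  have loop: "wp (indep X) m d (For ''j'' (N ''J'') step_prog) (\<lambda>t s'. t \<le> 9 + J * (162 + d) \<and>
    (\<forall>j<J. nats s' ''mk'' (n * J + j) = (if fires F j (sim F j) then 1 else 0)) \<and>
    (\<forall>i<n * J. nats s' ''mk'' i = nats s ''mk'' i)) s1"
    if A: "schedule_mem s1" "nats s1 ''n'' 0 = n" "nats s1 ''in'' = nats s ''in''" "nats s1 ''mk'' = nats s ''mk''"
      and B: "bits s1 {}" for s1
  proof (rule wp_For[where b = J and c = "150 + d" and I = "\<lambda>k s'. bits s' (sim F k) \<and>
    (\<forall>j<k. nats s' ''mk'' (n * J + j) = (if fires F j (sim F j) then 1 else 0)) \<and>
    (\<forall>i<n * J. nats s' ''mk'' i = nats s ''mk'' i)"], goal_cases)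
    case 1
    then show ?case using A B by (simp add: bits_def)
  next
    case (2 k s')
    then show ?case using agree_outsideD[OF 2(4)] A(1) by (simp add: schedule_mem_def step_prog_def)
  next
    case (3 k s')
    note C = agree_outsideD[OF 3(4)]
    have mem': "schedule_mem s'" by (rule schedule_mem_agree[OF A(1) 3(4)]) (simp_all add: step_prog_def)
    have n': "nats s' ''n'' 0 = n" and F': "\<And>e. e < m \<Longrightarrow> nats s' ''in'' e = 0 \<longleftrightarrow> e \<notin> F"
      using C A F by (simp_all add: step_prog_def)
    have sub: "sim F k \<subseteq> {..<m}" using sim_subset[of k F] 3(1) by auto
    have bits: "bits s' (sim F k)" using 3(2) by simp
    show ?case
    proof (rule wp_conseq[OF step_correct[OF mem' 3(3) 3(1) n' bits sub F']], goal_cases)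
      case (2 t s2)
      have "nats s2 ''j'' 0 = k" using agree_outsideD(1)[OF 2(2), of "''j''"] 3(3) by (simp add: step_prog_def)
      then show ?case using 2(1) 3(1,2) by (simp add: less_Suc_eq bits_def)
    qed
  qed (simp_all add: algebra_simps)
  show ?thesis unfolding sim_prog_def
  proof (rule wp_SeqI[OF clear], goal_cases)
    case (1 t s1)
    note C = agree_outsideD[OF 1(2)]
    have "schedule_mem s1" by (rule schedule_mem_agree[OF mem 1(2)]) simp_all
    then have s1: "schedule_mem (setn s1 ''B'' m 1)" by (simp add: schedule_mem_def)
    have "nats s1 ''size'' 0 = m" using C size by simp
    then show ?case unfolding wp_Seq wp_NAssign nval.simps
      apply simp
      apply (rule wp_mono[OF loop])
      using s1 C n 1(1) m_le_J
      by (simp_all add: bits_def algebra_simps)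
  qed
qed

end

text \<open>The number \<open>l\<close> is a parameter of the program text and not part of the
  input, so a power with exponent \<open>l\<close> is an expression of fixed size.\<close>

fun npow :: "nexp \<Rightarrow> nat \<Rightarrow> nexp" where
  "npow b 0 = NConst 1"
| "npow b (Suc i) = NMul b (npow b i)"

lemma nval_npow [simp]: "nval s (npow b i) = nval s b ^ i"
  by (induction i) auto

lemma ncost_npow [simp]: "ncost (npow b i) = 1 + i * (1 + ncost b)"
  by (induction i) auto

text \<open>A repeated digit is noticed because its cell of \<open>in\<close> is already set. The
  entries of a rejected tuple in \<open>fs\<close> do no harm: \<open>n\<close> is not advanced, so
  they stay outside the table until the next tuple overwrites them.\<close>

definition mark_prog :: "nat \<Rightarrow> com" where
  "mark_prog l = ''ok'' ::= NConst 1 ;;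
    For ''i'' (NConst l)
      (''f'' ::= NCell ''c'' (N ''i'') ;;
       If (NZ (NCell ''in'' (N ''f''))) (''ok'' ::= NConst 0) Skip ;;
       NAssign ''in'' (N ''f'') (NConst 1) ;;
       NAssign ''fs'' (NAdd (NMul (NConst l) (N ''n'')) (N ''i'')) (N ''f''))"

definition clear_prog :: "nat \<Rightarrow> com" where
  "clear_prog l = For ''i'' (NConst l) (NAssign ''in'' (NCell ''c'' (N ''i'')) (NConst 0))"

definition count_prog :: "nat \<Rightarrow> com" where
  "count_prog l = ''ca'' ::= NConst 1 ;;
    For ''i'' (NConst l)
      (NAssign ''c'' (N ''i'') (NAdd (NCell ''c'' (N ''i'')) (N ''ca'')) ;;
       If (NLess (NCell ''c'' (N ''i'')) (N ''size'')) (''ca'' ::= NConst 0)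
         (NAssign ''c'' (N ''i'') (NConst 0)))"

text \<open>The array \<open>c\<close> holds the digits of the counter \<open>t\<close> to base \<open>m\<close>; the tuples of distinct digits
  are the interdiction sets, each occurring in every order of its elements.\<close>

definition tuple_prog :: "nat \<Rightarrow> com" where
  "tuple_prog l = mark_prog l ;;
    If (NZ (N ''ok'')) (sim_prog ;; inc ''n'') Skip ;;
    clear_prog l ;;
    count_prog l"

definition enum_prog :: "nat \<Rightarrow> com" where
  "enum_prog l = ''M'' ::= npow (N ''size'') l ;; ''n'' ::= NConst 0 ;; For ''t'' (N ''M'') (tuple_prog l)"

section \<open>Enumerating tuples by counting in base \<open>m\<close>\<close>

definition digit :: "nat \<Rightarrow> nat \<Rightarrow> nat \<Rightarrow> nat" where
  "digit b t i = t div b ^ i mod b"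

text \<open>A carry reaches digit \<open>i\<close> exactly if \<open>b ^ i\<close> divides
  \<open>Suc t\<close>. The first part is the effect of the carry on the digit, the second its
  propagation; together they describe one round of \<open>count_prog\<close>.\<close>

lemma digit_Suc:
  assumes "0 < b"
  shows "digit b (Suc t) i = (if b ^ i dvd Suc t then if Suc (digit b t i) < b then Suc (digit b t i) else 0
    else digit b t i)"
    and "b ^ Suc i dvd Suc t \<longleftrightarrow> b ^ i dvd Suc t \<and> \<not> Suc (digit b t i) < b"
proof -
  have *: "Suc t div b ^ i = (if b ^ i dvd Suc t then Suc (t div b ^ i) else t div b ^ i)"
    unfolding div_Suc dvd_eq_mod_eq_0 by simp
  have less: "b dvd Suc x \<longleftrightarrow> \<not> Suc (x mod b) < b" for x
    unfolding dvd_eq_mod_eq_0 mod_Suc using mod_less_divisor[OF assms, of x] by auto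
  have "Suc x mod b = (if Suc (x mod b) < b then Suc (x mod b) else 0)" for x
    unfolding mod_Suc using mod_less_divisor[OF assms, of x] by auto
  then show "digit b (Suc t) i = (if b ^ i dvd Suc t then if Suc (digit b t i) < b then Suc (digit b t i) else 0
    else digit b t i)"
    unfolding digit_def * by simp
  have "b ^ Suc i dvd Suc t \<longleftrightarrow> b ^ i dvd Suc t \<and> b dvd Suc t div b ^ i"
  proof (cases "b ^ i dvd Suc t")
    case True
    then show ?thesis using dvd_div_iff_mult[of "b ^ i" "Suc t" b] assms by simp
  next
    case False
    then show ?thesis using dvd_mult_right[of b "b ^ i" "Suc t"] by auto
  qed
  then show "b ^ Suc i dvd Suc t \<longleftrightarrow> b ^ i dvd Suc t \<and> \<not> Suc (digit b t i) < b"
    unfolding digit_def using less[of "t div b ^ i"] * by auto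
qed

lemma ex_digits:
  assumes "\<And>i. i < k \<Longrightarrow> g i < b"
  shows "\<exists>t<b ^ k. \<forall>i<k. digit b t i = g i"
  using assms
proof (induction k arbitrary: g)
  case (Suc k)
  obtain t where t: "t < b ^ k" "\<And>i. i < k \<Longrightarrow> digit b t i = g (Suc i)"
    using Suc.IH[of "\<lambda>i. g (Suc i)"] Suc.prems by auto
  have g0: "g 0 < b" using Suc.prems by simp
  define t' where "t' = b * t + g 0"
  have "digit b t' i = g i" if "i < Suc k" for i
  proof (cases i)
    case 0
    then show ?thesis using g0 by (simp add: digit_def t'_def)
  next
    case (Suc i')
    have "t' div b ^ i = t' div b div b ^ i'" using Suc by (simp add: div_mult2_eq)
    also have "t' div b = t" using g0 by (simp add: t'_def)
    finally show ?thesis using Suc t(2)[of i'] that by (simp add: digit_def)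
  qed
  moreover have "t' < b ^ Suc k"
  proof -
    have "t' < b * (t + 1)" using g0 by (simp add: t'_def)
    also have "\<dots> \<le> b * b ^ k" using t(1) by (intro mult_le_mono2) simp
    finally show ?thesis by simp
  qed
  ultimately show ?case by blast
qed simp

lemma mark_correct:
  assumes "\<And>e. nats s ''in'' e = 0" "\<And>i. i < l \<Longrightarrow> nats s ''c'' i = g i" "nats s ''n'' 0 = n"
  shows "wp \<F> k d (mark_prog l) (\<lambda>t s'. t \<le> 20 + l * 70 \<and>
    (\<forall>e. nats s' ''in'' e \<noteq> 0 \<longleftrightarrow> e \<in> g ` {..<l}) \<and> (nats s' ''ok'' 0 \<noteq> 0 \<longleftrightarrow> inj_on g {..<l}) \<and>
    (\<forall>i<l. nats s' ''fs'' (l * n + i) = g i) \<and> (\<forall>i<l * n. nats s' ''fs'' i = nats s ''fs'' i)) s"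
  unfolding mark_prog_def wp_Seq wp_NAssign
proof (rule wp_For[where b = l and c = 55 and I = "\<lambda>k s'.
    (\<forall>e. nats s' ''in'' e \<noteq> 0 \<longleftrightarrow> e \<in> g ` {..<k}) \<and> (nats s' ''ok'' 0 \<noteq> 0 \<longleftrightarrow> inj_on g {..<k}) \<and>
    (\<forall>i<k. nats s' ''fs'' (l * n + i) = g i) \<and> (\<forall>i<l * n. nats s' ''fs'' i = nats s ''fs'' i)"], goal_cases)
  case (3 k s')
  have c: "nats s' ''c'' k = g k" and n: "nats s' ''n'' 0 = n"
    using agree_outsideD[OF 3(4)] assms 3(1) by simp_all
  have I: "nats s' ''in'' e = 0 \<longleftrightarrow> e \<notin> g ` {..<k}" for e using 3(2) by blast
  have I': "0 < nats s' ''in'' e \<longleftrightarrow> e \<in> g ` {..<k}" for e using I[of e] by auto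
  show ?case using 3(1-3) c n
    by (simp add: wp_simps lessThan_Suc I I' All_less_Suc)
qed (use assms in simp_all)

lemma clear_correct:
  assumes "\<And>i. i < l \<Longrightarrow> nats s ''c'' i = g i" "\<And>e. nats s ''in'' e \<noteq> 0 \<longleftrightarrow> e \<in> g ` {..<l}"
  shows "wp \<F> k d (clear_prog l) (\<lambda>t s'. t \<le> 10 + l * 20 \<and> (\<forall>e. nats s' ''in'' e = 0)) s"
  unfolding clear_prog_def
proof (rule wp_For[where b = l and c = 8 and I = "\<lambda>k s'.
    (\<forall>e. nats s' ''in'' e \<noteq> 0 \<longrightarrow> e \<in> g ` {..<l}) \<and> (\<forall>i<k. nats s' ''in'' (g i) = 0)"], goal_cases)
  case (3 k s')
  have c: "nats s' ''c'' k = g k" using agree_outsideD[OF 3(4)] assms 3(1) by simp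
  show ?case using 3(1-3) c by (simp add: wp_simps All_less_Suc)
next
  case (4 t s')
  then have "nats s' ''in'' e = 0" for e by (metis imageE lessThan_iff)
  then show ?case using 4(1) by simp
qed (use assms in simp_all)

lemma count_correct:
  assumes "0 < b" "nats s ''size'' 0 = b" "\<And>i. i < l \<Longrightarrow> nats s ''c'' i = digit b t i"
  shows "wp \<F> k d (count_prog l) (\<lambda>u s'. u \<le> 20 + l * 60 \<and> (\<forall>i<l. nats s' ''c'' i = digit b (Suc t) i)) s"
  unfolding count_prog_def wp_Seq wp_NAssign
proof (rule wp_For[where b = l and c = 40 and I = "\<lambda>k s'.
    (\<forall>i<l. nats s' ''c'' i = digit b (if i < k then Suc t else t) i) \<and>
    nats s' ''ca'' 0 = (if b ^ k dvd Suc t then 1 else 0)"], goal_cases)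
  case (3 k s')
  note A = agree_outsideD[OF 3(4)]
  have lt: "digit b t k < b" using assms(1) by (simp add: digit_def)
  have c: "nats s' ''c'' k = digit b t k" and size: "nats s' ''size'' 0 = b"
    and ca: "nats s' ''ca'' 0 = (if b ^ k dvd Suc t then 1 else 0)"
    using A assms(2) 3(1,2) by simp_all
  have old: "\<forall>i<l. i \<noteq> k \<longrightarrow> nats s' ''c'' i = digit b (if i < Suc k then Suc t else t) i"
    using 3(2) by (auto simp: less_Suc_eq)
  note d = digit_Suc[OF assms(1), where t = t and i = k]
  show ?case
  proof (cases "b ^ k dvd Suc t \<and> \<not> Suc (digit b t k) < b")
    case True
    then show ?thesis using 3(1,3) old d by (simp add: wp_simps c size ca del: power_Suc)
  next
    case False
    then show ?thesis using 3(1,3) old d lt by (cases "b ^ k dvd Suc t") (simp_all add: wp_simps c size ca del: power_Suc)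
  qed
qed (use assms in simp_all)

context schedule
begin

section \<open>The table of interdiction sets and their exchange bits\<close>

definition fset :: "memory \<Rightarrow> nat \<Rightarrow> nat set" where
  "fset s n = (\<lambda>i. nats s ''fs'' (l * n + i)) ` {..<l}"

definition marks_ok :: "memory \<Rightarrow> nat \<Rightarrow> bool" where
  "marks_ok s n \<longleftrightarrow> fset s n \<in> removable l X \<and>
    (\<forall>j<J. nats s ''mk'' (n * J + j) = (if fires (fset s n) j (sim (fset s n) j) then 1 else 0))"

lemma marks_ok_cong:
  assumes "\<And>i. i < l * K \<Longrightarrow> nats s' ''fs'' i = nats s ''fs'' i"
    "\<And>i. i < K * J \<Longrightarrow> nats s' ''mk'' i = nats s ''mk'' i" "n < K"
  shows "fset s' n = fset s n" "marks_ok s' n = marks_ok s n"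
proof -
  have "l * n + i < l * K" if "i < l" for i
  proof -
    have "l * n + i < l * Suc n" using that by simp
    also have "\<dots> \<le> l * K" using assms(3) by (intro mult_le_mono2) simp
    finally show ?thesis .
  qed
  then show f: "fset s' n = fset s n" using assms(1) by (auto simp: fset_def)
  have "n * J + j < K * J" if "j < J" for j
  proof -
    have "n * J + j < Suc n * J" using that by simp
    also have "\<dots> \<le> K * J" using assms(3) by (intro mult_le_mono1) simp
    finally show ?thesis .
  qed
  then show "marks_ok s' n = marks_ok s n" using assms(2) by (auto simp: marks_ok_def f)
qed

definition table_ok :: "nat \<Rightarrow> memory \<Rightarrow> bool" where
  "table_ok K s \<longleftrightarrow> K \<le> m ^ l \<and> (\<forall>n<K. marks_ok s n) \<and> (\<forall>F\<in>removable l X. \<exists>n<K. fset s n = F)"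

definition enum_inv :: "nat \<Rightarrow> memory \<Rightarrow> bool" where
  "enum_inv t s \<longleftrightarrow> schedule_mem s \<and> (\<forall>e. nats s ''in'' e = 0) \<and> (\<forall>i<l. nats s ''c'' i = digit m t i) \<and>
     nats s ''n'' 0 \<le> t \<and> (\<forall>n<nats s ''n'' 0. marks_ok s n) \<and>
     (\<forall>t'<t. inj_on (digit m t') {..<l} \<longrightarrow> (\<exists>n<nats s ''n'' 0. fset s n = digit m t' ` {..<l}))"

lemma enum_step:
  assumes inv: "enum_inv t s" and m: "0 < m"
  shows "wp (indep X) m d (tuple_prog l)
    (\<lambda>u s'. u \<le> 100 + 200 * l + (200 + d) * (J + 1) \<and> enum_inv (Suc t) s') s"
proof -
  define g K where "g = digit m t" and "K = nats s ''n'' 0"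
  have in0: "\<And>e. nats s ''in'' e = 0" and c: "\<And>i. i < l \<Longrightarrow> nats s ''c'' i = g i"
    and mem: "schedule_mem s" and Kt: "K \<le> t"
    using inv by (simp_all add: enum_inv_def g_def K_def)
  have gm: "g i < m" for i using m by (simp add: g_def digit_def)
  \<comment> \<open>The end of a round is the same for accepted and rejected tuples, so it is
    treated once, for any memory that already covers tuple \<open>t\<close>.\<close>
  have rest: "wp (indep X) m d (clear_prog l ;; count_prog l)
      (\<lambda>u s'. u \<le> 30 + 80 * l \<and> enum_inv (Suc t) s') s2"
    if s2: "schedule_mem s2" "\<And>e. nats s2 ''in'' e \<noteq> 0 \<longleftrightarrow> e \<in> g ` {..<l}"
      "\<And>i. i < l \<Longrightarrow> nats s2 ''c'' i = g i" "nats s2 ''n'' 0 \<le> Suc t"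
      "\<And>n. n < nats s2 ''n'' 0 \<Longrightarrow> marks_ok s2 n"
      "\<And>t'. t' < Suc t \<Longrightarrow> inj_on (digit m t') {..<l} \<Longrightarrow> \<exists>n<nats s2 ''n'' 0. fset s2 n = digit m t' ` {..<l}"
    for s2
  proof (rule wp_SeqI[OF clear_correct[OF s2(3,2)]], goal_cases)
    case (2 u s3)
    note 3 = 2
    note A = agree_outsideD(1)[OF 3(2), unfolded clear_prog_def, simplified]
    have size: "nats s3 ''size'' 0 = m" using A s2(1) by (simp add: schedule_mem_def)
    have c3: "nats s3 ''c'' i = digit m t i" if "i < l" for i using A s2(3) that by (simp add: g_def)
    show ?case
    proof (rule wp_conseq[OF count_correct[OF m size c3]], goal_cases)
      case (2 u' s4)
      note B = agree_outsideD(1)[OF 2(2), unfolded count_prog_def, simplified]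
      have eq: "nats s4 x = nats s2 x" if "x \<in> {''size'', ''J'', ''so'', ''si'', ''n'', ''fs'', ''mk''}" for x
        using that A[of x] B[of x] by auto
      have "nats s4 ''in'' e = 0" for e using B[of "''in''"] 3(1) by simp
      moreover have "fset s4 n = fset s2 n" "marks_ok s4 n = marks_ok s2 n" for n
        by (simp_all add: fset_def marks_ok_def eq)
      moreover have "schedule_mem s4" using s2(1) by (simp add: schedule_mem_def eq)
      ultimately show ?case using 2(1) 3(1) s2(4-6) by (simp add: enum_inv_def eq)
    qed
  qed
  show ?thesis unfolding tuple_prog_def
  proof (rule wp_SeqI[OF mark_correct[OF in0 c K_def[symmetric]]], goal_cases)
    case (2 u s1)
    note A = agree_outsideD(1)[OF 2(2), unfolded mark_prog_def, simplified]
    have in1: "nats s1 ''in'' e \<noteq> 0 \<longleftrightarrow> e \<in> g ` {..<l}" for e using 2(1) by blast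
    have ok1: "nats s1 ''ok'' 0 \<noteq> 0 \<longleftrightarrow> inj_on g {..<l}" using 2(1) by blast
    have fs1: "\<And>i. i < l \<Longrightarrow> nats s1 ''fs'' (l * K + i) = g i"
      "\<And>i. i < l * K \<Longrightarrow> nats s1 ''fs'' i = nats s ''fs'' i" using 2(1) by blast+
    have mem1: "schedule_mem s1" by (rule schedule_mem_agree[OF mem 2(2)]) (simp_all add: mark_prog_def)
    have c1: "\<And>i. i < l \<Longrightarrow> nats s1 ''c'' i = g i" and n1: "nats s1 ''n'' 0 = K"
      using A c by (simp_all add: K_def)
    \<comment> \<open>All writes of this round to \<open>fs\<close> and \<open>mk\<close> go to row
      \<open>K\<close> or beyond, so the rows below \<open>K\<close> are as before.\<close>
    have cong: "fset s' n = fset s n" "marks_ok s' n"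
      if "\<And>i. i < l * K \<Longrightarrow> nats s' ''fs'' i = nats s1 ''fs'' i"
        "\<And>i. i < K * J \<Longrightarrow> nats s' ''mk'' i = nats s1 ''mk'' i" "n < K" for s' n
      using marks_ok_cong[of K s' s n] that fs1 A inv by (auto simp: enum_inv_def K_def)
    have old: "\<exists>n<K. fset s n = digit m t' ` {..<l}" if "t' < t" "inj_on (digit m t') {..<l}" for t'
      using inv that by (simp add: enum_inv_def K_def)
    show ?case
    proof (cases "inj_on g {..<l}")
      case False
      then have "nats s1 ''ok'' 0 = 0" using ok1 by simp
      have cover: "\<exists>n<nats s1 ''n'' 0. fset s1 n = digit m t' ` {..<l}"
        if t': "t' < Suc t" "inj_on (digit m t') {..<l}" for t'
      proof -
        have "t' < t" using False t' by (auto simp: g_def less_Suc_eq)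
        then obtain n where "n < K" "fset s n = digit m t' ` {..<l}" using old t'(2) by blast
        then show ?thesis using cong(1)[of s1 n] n1 by auto
      qed
      note \<open>nats s1 ''ok'' 0 = 0\<close>
      then show ?thesis
        apply (simp add: wp_Seq[of _ _ _ "If _ _ _"] wp_If wp_Skip)
        apply (rule wp_mono[OF rest[OF mem1 in1 c1]])
        subgoal .
        subgoal using n1 Kt by simp
        subgoal for n using n1 cong[of s1 n] by simp
        subgoal by (rule cover)
        subgoal using 2(1) by simp
        done
    next
      case True
      have F1: "nats s1 ''in'' e = 0 \<longleftrightarrow> e \<notin> g ` {..<l}" for e using in1 by blast
      have b: "bval s1 (NZ (N ''ok''))" using ok1 True by simp
      show ?thesis
        unfolding wp_Seq[of _ _ _ "If _ _ _"] wp_If if_P[OF b] wp_Seq[of _ _ _ sim_prog]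
      proof (rule wp_conseq[OF sim_correct[OF mem1 n1 F1]], goal_cases)
        case (1 v s2)
        note 2 = 1 and u = \<open>u \<le> 20 + l * 70 \<and> _\<close>
        note B = agree_outsideD(1)[OF 2(2), unfolded sim_prog_def step_prog_def, simplified]
        define s3 where "s3 = setn s2 ''n'' 0 (Suc K)"
        have eq: "nats s3 x = nats s1 x" if "x \<in> {''size'', ''J'', ''so'', ''si'', ''in'', ''c'', ''fs''}" for x
          using that B[of x] by (auto simp: s3_def)
        have n3: "nats s3 ''n'' 0 = Suc K" by (simp add: s3_def)
        have F3: "fset s3 K = g ` {..<l}" using fs1(1) eq by (simp add: fset_def)
        have "g ` {..<l} \<in> removable l X"
          using gm True by (auto simp: removable_def ground_def card_image)
        moreover have mk3: "nats s3 ''mk'' = nats s2 ''mk''" by (simp add: s3_def)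
        ultimately have K: "marks_ok s3 K" using 2(1) by (simp add: marks_ok_def F3)
        have c3: "fset s3 n = fset s n" "marks_ok s3 n" if "n < K" for n
          using cong[of s3 n] that 2(1) eq[of "''fs''"] by (simp_all add: mk3)
        have finish: "wp (indep X) m d (clear_prog l ;; count_prog l)
          (\<lambda>u s'. u \<le> 30 + 80 * l \<and> enum_inv (Suc t) s') s3"
        proof (rule rest)
          show "schedule_mem s3" using mem1 by (simp add: schedule_mem_def eq)
          show "\<exists>n<nats s3 ''n'' 0. fset s3 n = digit m t' ` {..<l}"
            if t': "t' < Suc t" "inj_on (digit m t') {..<l}" for t'
          proof (cases "t' = t")
            case True
            then show ?thesis using F3 by (auto simp: n3 g_def)
          next
            case False
            then obtain n where "n < K" "fset s n = digit m t' ` {..<l}"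
              using old[of t'] t' by (auto simp: less_Suc_eq)
            then show ?thesis using c3(1)[of n] n3 by (intro exI[of _ n]) simp
          qed
          show "marks_ok s3 n" if "n < nats s3 ''n'' 0" for n
            using that K c3 by (auto simp: n3 less_Suc_eq)
        qed (use in1 c1 Kt in \<open>simp_all add: eq n3\<close>)
        have s3: "setn s2 ''n'' (nval s2 (NConst 0)) (nval s2 (NAdd (N ''n'') (NConst 1))) = s3"
          using B[of "''n''"] n1 by (simp add: s3_def)
        show ?case unfolding wp_NAssign s3
          by (rule wp_mono[OF finish]) (use 2(1) u in simp)
      qed
    qed
  qed
qed

text \<open>Any numbering of \<open>F\<close> by \<open>{..<l}\<close> is an injective tuple of
  numbers below \<open>m\<close>, hence the digits of some counter value.\<close>

lemma fset_cover:
  assumes "\<And>t. t < m ^ l \<Longrightarrow> inj_on (digit m t) {..<l} \<Longrightarrow> \<exists>n<K. fset s n = digit m t ` {..<l}"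
    and "F \<in> removable l X"
  shows "\<exists>n<K. fset s n = F"
proof -
  have F: "F \<subseteq> {..<m}" "card F = l" using assms(2) by (auto simp: removable_def ground_def)
  then have "finite F" using finite_subset by blast
  then obtain g where g: "bij_betw g {..<l} F"
    using F(2) ex_bij_betw_nat_finite[of F] by (auto simp: atLeast0LessThan)
  then have "g i < m" if "i < l" for i using F(1) that by (auto simp: bij_betw_def)
  then obtain t where t: "t < m ^ l" "\<And>i. i < l \<Longrightarrow> digit m t i = g i" using ex_digits[of l g m] by blast
  then have "inj_on (digit m t) {..<l}" "digit m t ` {..<l} = F"
    using g by (auto simp: bij_betw_def inj_on_def)
  then show ?thesis using assms(1)[OF t(1)] by simp
qed

lemma enum_correct:
  assumes mem: "schedule_mem s" and "0 < l" and c: "\<And>i. i < l \<Longrightarrow> nats s ''c'' i = 0"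
    and in0: "\<And>e. nats s ''in'' e = 0"
  shows "wp (indep X) m d (enum_prog l) (\<lambda>t s'. t \<le> 20 + 10 * l + m ^ l * (130 + 200 * l + (200 + d) * (J + 1)) \<and>
    table_ok (nats s' ''n'' 0) s') s"
proof -
  have m: "0 < m" using l_le \<open>0 < l\<close> by simp
  have size: "nats s ''size'' 0 = m" using mem by (simp add: schedule_mem_def)
  define s0 where "s0 = setn (setn s ''M'' 0 (m ^ l)) ''n'' 0 0"
  have "wp (indep X) m d (For ''t'' (N ''M'') (tuple_prog l)) (\<lambda>t s'. t \<le> 9 + m ^ l * (112 + 200 * l + (200 + d) * (J + 1)) \<and>
    table_ok (nats s' ''n'' 0) s') s0"
  proof (rule wp_For[where b = "m ^ l" and c = "100 + 200 * l + (200 + d) * (J + 1)" and I = enum_inv], goal_cases)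
    case 1
    show ?case using mem c in0
      by (simp add: enum_inv_def s0_def schedule_mem_def digit_def)
  next
    case (2 k s')
    then show ?case using agree_outsideD(1)[OF 2(4), of "''M''"]
      by (simp add: tuple_prog_def s0_def mark_prog_def sim_prog_def step_prog_def clear_prog_def count_prog_def)
  next
    case (3 k s')
    show ?case
    proof (rule wp_conseq[OF enum_step[OF 3(2) m]], goal_cases)
      case (1 t s2)
      have "nats s2 ''t'' = nats s' ''t''" using agree_outsideD(1)[OF 1(2), of "''t''"]
        by (simp add: tuple_prog_def mark_prog_def sim_prog_def step_prog_def clear_prog_def count_prog_def)
      moreover have "marks_ok (setn s2 ''t'' 0 v) n = marks_ok s2 n" "fset (setn s2 ''t'' 0 v) n = fset s2 n" for v n
        by (simp_all add: marks_ok_def fset_def)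
      ultimately show ?case using 1(1) 3(3) by (simp add: enum_inv_def schedule_mem_def)
    qed
  next
    case (4 t s')
    have "table_ok (nats s' ''n'' 0) s'" unfolding table_ok_def
    proof (intro conjI ballI)
      fix F assume "F \<in> removable l X"
      then show "\<exists>n<nats s' ''n'' 0. fset s' n = F"
        by (rule fset_cover[rotated]) (use 4(2) in \<open>simp add: enum_inv_def\<close>)
    qed (use 4(2) in \<open>simp_all add: enum_inv_def\<close>)
    then show ?case using 4(1) by simp
  qed
  then show ?thesis
    unfolding enum_prog_def wp_Seq wp_NAssign
    by (simp add: size s0_def) (erule wp_mono, simp add: algebra_simps)
qed

end

section \<open>Keeping the lines sorted by slope\<close>

text \<open>In a greedy step \<open>so\<close> is the dummy with zero coefficients, so that
  \<open>da\<close> and \<open>db\<close> are the coefficients of the incoming element.\<close>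

definition split_prog :: com where
  "split_prog = ''nu'' ::= NConst 0 ;; ''nv'' ::= NConst 0 ;;
    ''da'' ::~ RSub (RCell ''const'' (NCell ''si'' (N ''j''))) (RCell ''const'' (NCell ''so'' (N ''j''))) ;;
    ''db'' ::~ RSub (RCell ''slope'' (NCell ''si'' (N ''j''))) (RCell ''slope'' (NCell ''so'' (N ''j''))) ;;
    For ''i'' (N ''n'')
      (''x'' ::= NCell ''ord'' (N ''i'') ;;
       If (NZ (NCell ''mk'' (NAdd (NMul (N ''x'') (N ''J'')) (N ''j''))))
         (RAssign ''A'' (N ''x'') (RAdd (RCell ''A'' (N ''x'')) (R ''da'')) ;;
          RAssign ''S'' (N ''x'') (RAdd (RCell ''S'' (N ''x'')) (R ''db'')) ;;
          NAssign ''V'' (N ''nv'') (N ''x'') ;; inc ''nv'')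
         (NAssign ''U'' (N ''nu'') (N ''x'') ;; inc ''nu''))"

definition merge_prog :: com where
  "merge_prog = ''iu'' ::= NConst 0 ;; ''iv'' ::= NConst 0 ;;
    For ''i'' (N ''n'')
      (If (And (NLess (N ''iv'') (N ''nv''))
            (Or (Not (NLess (N ''iu'') (N ''nu'')))
              (RLess (RCell ''S'' (NCell ''V'' (N ''iv''))) (RCell ''S'' (NCell ''U'' (N ''iu''))))))
         (NAssign ''ord'' (N ''i'') (NCell ''V'' (N ''iv'')) ;; inc ''iv'')
         (NAssign ''ord'' (N ''i'') (NCell ''U'' (N ''iu'')) ;; inc ''iu''))"

definition sorted_on :: "(nat \<Rightarrow> real) \<Rightarrow> (nat \<Rightarrow> nat) \<Rightarrow> nat \<Rightarrow> bool" where
  "sorted_on S f k \<longleftrightarrow> (\<forall>p q. p < q \<and> q < k \<longrightarrow> S (f p) \<le> S (f q))"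

lemma merge_correct:
  assumes S: "S = reals s ''S''" and U: "sorted_on S (nats s ''U'') nu" and V: "sorted_on S (nats s ''V'') nv"
    and n: "nats s ''n'' 0 = nu + nv" "nats s ''nu'' 0 = nu" "nats s ''nv'' 0 = nv"
  shows "wp \<F> k d merge_prog (\<lambda>t s'. t \<le> 20 + (nu + nv) * 60 \<and>
    nats s' ''ord'' ` {..<nu + nv} = nats s ''U'' ` {..<nu} \<union> nats s ''V'' ` {..<nv} \<and>
    sorted_on S (nats s' ''ord'') (nu + nv)) s"
proof -
  define U' V' where "U' = nats s ''U''" and "V' = nats s ''V''"
  \<comment> \<open>Sortedness of the output is not inductive by itself; it needs that every slope
    written so far is at most every slope still waiting in either list.\<close>
  define I where "I k iu iv f \<longleftrightarrow> iu + iv = k \<and> iu \<le> nu \<and> iv \<le> nv \<and> sorted_on S f k \<and>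
    (\<forall>p<k. \<forall>q. iu \<le> q \<and> q < nu \<longrightarrow> S (f p) \<le> S (U' q)) \<and>
    (\<forall>p<k. \<forall>q. iv \<le> q \<and> q < nv \<longrightarrow> S (f p) \<le> S (V' q)) \<and>
    f ` {..<k} = U' ` {..<iu} \<union> V' ` {..<iv}" for k iu iv f
  have sortU: "p \<le> q \<Longrightarrow> q < nu \<Longrightarrow> S (U' p) \<le> S (U' q)" for p q
    using U by (cases "p = q") (auto simp: sorted_on_def U'_def)
  have sortV: "p \<le> q \<Longrightarrow> q < nv \<Longrightarrow> S (V' p) \<le> S (V' q)" for p q
    using V by (cases "p = q") (auto simp: sorted_on_def V'_def)
  have takeV: "I (Suc k) iu (Suc iv) g"
    if I: "I k iu iv f" and c: "iv < nv" "iu < nu \<longrightarrow> S (V' iv) < S (U' iu)"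
      and g: "\<And>i. g i = (if i = k then V' iv else f i)" for k iu iv f g
  proof -
    have "g ` {..<Suc k} = insert (V' iv) (f ` {..<k})" by (auto simp: lessThan_Suc g)
    then have img: "g ` {..<Suc k} = U' ` {..<iu} \<union> V' ` {..<Suc iv}"
      using I by (auto simp: I_def lessThan_Suc)
    have "sorted_on S g (Suc k)" using I c by (auto simp: I_def sorted_on_def g less_Suc_eq)
    moreover have "S (V' iv) \<le> S (U' q)" if "iu \<le> q" "q < nu" for q
      using c(2) sortU[of iu q] that by fastforce
    moreover have "S (V' iv) \<le> S (V' q)" if "Suc iv \<le> q" "q < nv" for q using sortV[of iv q] that by simp
    ultimately show ?thesis using I c img unfolding I_def by (auto simp: g less_Suc_eq)
  qed
  have takeU: "I (Suc k) (Suc iu) iv g"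
    if I: "I k iu iv f" and k: "k < nu + nv" and c: "\<not> (iv < nv \<and> (iu < nu \<longrightarrow> S (V' iv) < S (U' iu)))"
      and g: "\<And>i. g i = (if i = k then U' iu else f i)" for k iu iv f g
  proof -
    have iu: "iu < nu" using I k c by (auto simp: I_def)
    have "g ` {..<Suc k} = insert (U' iu) (f ` {..<k})" by (auto simp: lessThan_Suc g)
    then have img: "g ` {..<Suc k} = U' ` {..<Suc iu} \<union> V' ` {..<iv}"
      using I by (auto simp: I_def lessThan_Suc)
    have "sorted_on S g (Suc k)" using I iu by (auto simp: I_def sorted_on_def g less_Suc_eq)
    moreover have "S (U' iu) \<le> S (V' q)" if "iv \<le> q" "q < nv" for q
      using c iu sortV[of iv q] that by fastforce
    moreover have "S (U' iu) \<le> S (U' q)" if "Suc iu \<le> q" "q < nu" for q using sortU[of iu q] that by simp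
    ultimately show ?thesis using I iu img unfolding I_def by (auto simp: g less_Suc_eq)
  qed
  show ?thesis
    unfolding merge_prog_def wp_Seq wp_NAssign
  proof (rule wp_For[where b = "nu + nv" and c = 45 and
      I = "\<lambda>k s'. I k (nats s' ''iu'' 0) (nats s' ''iv'' 0) (nats s' ''ord'')"], goal_cases)
    case 1
    then show ?case by (simp add: I_def sorted_on_def)
  next
    case (2 k s')
    then show ?case using agree_outsideD[OF 2(4)] n by simp
  next
    case (3 k s')
    note A = agree_outsideD[OF 3(4)]
    have eq: "nats s' ''U'' = U'" "nats s' ''V'' = V'" "reals s' ''S'' = S"
      "nats s' ''nu'' 0 = nu" "nats s' ''nv'' 0 = nv"
      using A n by (simp_all add: U'_def V'_def S)
    define iu iv where "iu = nats s' ''iu'' 0" and "iv = nats s' ''iv'' 0"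
    show ?case
    proof (cases "iv < nv \<and> (iu < nu \<longrightarrow> S (V' iv) < S (U' iu))")
      case True
      then show ?thesis
        using takeV[OF 3(2)] 3(3) by (simp add: wp_simps eq iu_def iv_def)
    next
      case False
      then show ?thesis
        using takeU[OF 3(2,1)] 3(3) by (simp add: wp_simps eq iu_def iv_def) blast
    qed
  next
    case (4 t s')
    have "nats s' ''iu'' 0 = nu" "nats s' ''iv'' 0 = nv" using 4(2) by (auto simp: I_def)
    then show ?case using 4(1,2) by (simp add: I_def U'_def V'_def)
  qed
qed

text \<open>The parts are stated as filtered lists so that they inherit sortedness directly.
  Injectivity of \<open>ord\<close> ensures that no line is shifted twice.\<close>

lemma split_correct:
  fixes mark :: "nat \<Rightarrow> bool"
  assumes n: "nats s ''n'' 0 = K" and inj: "inj_on (nats s ''ord'') {..<K}"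
    and ordK: "\<And>i. i < K \<Longrightarrow> nats s ''ord'' i < K"
    and mark: "\<And>x. x < K \<Longrightarrow> nats s ''mk'' (x * nats s ''J'' 0 + nats s ''j'' 0) \<noteq> 0 \<longleftrightarrow> mark x"
    and da: "da = reals s ''const'' (nats s ''si'' (nats s ''j'' 0)) - reals s ''const'' (nats s ''so'' (nats s ''j'' 0))"
    and db: "db = reals s ''slope'' (nats s ''si'' (nats s ''j'' 0)) - reals s ''slope'' (nats s ''so'' (nats s ''j'' 0))"
  shows "wp \<F> k d split_prog (\<lambda>t s'. t \<le> 50 + K * 80 \<and>
    map (nats s' ''U'') [0..<nats s' ''nu'' 0] = filter (\<lambda>x. \<not> mark x) (map (nats s ''ord'') [0..<K]) \<and>
    map (nats s' ''V'') [0..<nats s' ''nv'' 0] = filter mark (map (nats s ''ord'') [0..<K]) \<and>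
    (\<forall>x. reals s' ''A'' x = reals s ''A'' x + (if x \<in> nats s ''ord'' ` {..<K} \<and> mark x then da else 0)) \<and>
    (\<forall>x. reals s' ''S'' x = reals s ''S'' x + (if x \<in> nats s ''ord'' ` {..<K} \<and> mark x then db else 0))) s"
  unfolding split_prog_def wp_Seq wp_NAssign wp_RAssign
proof (rule wp_For[where b = K and c = 60 and I = "\<lambda>k s'.
    map (nats s' ''U'') [0..<nats s' ''nu'' 0] = filter (\<lambda>x. \<not> mark x) (map (nats s ''ord'') [0..<k]) \<and>
    map (nats s' ''V'') [0..<nats s' ''nv'' 0] = filter mark (map (nats s ''ord'') [0..<k]) \<and>
    (\<forall>x. reals s' ''A'' x = reals s ''A'' x + (if x \<in> nats s ''ord'' ` {..<k} \<and> mark x then da else 0)) \<and>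
    (\<forall>x. reals s' ''S'' x = reals s ''S'' x + (if x \<in> nats s ''ord'' ` {..<k} \<and> mark x then db else 0))"], goal_cases)
  case (2 k s')
  then show ?case using agree_outsideD[OF 2(4)] n by simp
next
  case (3 k s')
  note A = agree_outsideD[OF 3(4)]
  define x where "x = nats s ''ord'' k"
  have "nats s ''ord'' i \<noteq> x" if "i < k" for i
    using inj_onD[OF inj, of i k] 3(1) that by (auto simp: x_def)
  then have new: "x \<notin> nats s ''ord'' ` {..<k}" by blast
  have eq: "nats s' ''ord'' k = x" "nats s' ''mk'' (x * nats s' ''J'' 0 + nats s' ''j'' 0) \<noteq> 0 \<longleftrightarrow> mark x"
    "reals s' ''da'' 0 = da" "reals s' ''db'' 0 = db"
    using A mark[of x] ordK[OF 3(1)] da db by (simp_all add: x_def)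
  have img: "nats s ''ord'' ` {..<Suc k} = insert x (nats s ''ord'' ` {..<k})"
    by (simp add: lessThan_Suc x_def)
  have upd: "map (\<lambda>j. if j = i then v else f j) [0..<i] = map f [0..<i]" for i f and v :: nat
    by (rule map_cong) auto
  show ?case
  proof (cases "mark x")
    case True
    then show ?thesis using 3(2,3) eq new by (simp add: wp_simps upd img x_def[symmetric])
  next
    case False
    then show ?thesis using 3(2,3) eq new by (simp add: wp_simps upd img x_def[symmetric])
  qed
qed (use assms in simp_all)

lemma sorted_on_map: "sorted_on S f k \<longleftrightarrow> sorted_wrt (\<lambda>x y. S x \<le> S y) (map f [0..<k])"
  by (auto simp: sorted_on_def sorted_wrt_iff_nth_less)

lemma split_merge_correct:
  fixes mark :: "nat \<Rightarrow> bool"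
  assumes n: "nats s ''n'' 0 = K" and perm: "nats s ''ord'' ` {..<K} = {..<K}"
    and sorted: "sorted_on (reals s ''S'') (nats s ''ord'') K"
    and mark: "\<And>x. x < K \<Longrightarrow> nats s ''mk'' (x * nats s ''J'' 0 + nats s ''j'' 0) \<noteq> 0 \<longleftrightarrow> mark x"
    and da: "da = reals s ''const'' (nats s ''si'' (nats s ''j'' 0)) - reals s ''const'' (nats s ''so'' (nats s ''j'' 0))"
    and db: "db = reals s ''slope'' (nats s ''si'' (nats s ''j'' 0)) - reals s ''slope'' (nats s ''so'' (nats s ''j'' 0))"
  shows "wp \<F> k d (split_prog ;; merge_prog) (\<lambda>t s'. t \<le> 70 + K * 140 \<and>
    (\<forall>x<K. reals s' ''A'' x = reals s ''A'' x + (if mark x then da else 0)) \<and>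
    (\<forall>x<K. reals s' ''S'' x = reals s ''S'' x + (if mark x then db else 0)) \<and>
    nats s' ''ord'' ` {..<K} = {..<K} \<and> sorted_on (reals s' ''S'') (nats s' ''ord'') K) s"
proof -
  have inj: "inj_on (nats s ''ord'') {..<K}" by (rule eq_card_imp_inj_on) (simp_all add: perm)
  have ordK: "nats s ''ord'' i < K" if "i < K" for i using perm that by blast
  define os where "os = map (nats s ''ord'') [0..<K]"
  have setos: "set os = {..<K}" using perm by (simp add: os_def atLeast0LessThan)
  have sortos: "sorted_wrt (\<lambda>x y. reals s ''S'' x \<le> reals s ''S'' y) os"
    using sorted by (simp add: sorted_on_map os_def)
  show ?thesis
  proof (rule wp_SeqI[OF split_correct[OF n inj ordK mark da db]], goal_cases)
    case (3 t s1)
    define nu nv where "nu = nats s1 ''nu'' 0" and "nv = nats s1 ''nv'' 0"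
    have U: "map (nats s1 ''U'') [0..<nu] = filter (\<lambda>x. \<not> mark x) os"
      and V: "map (nats s1 ''V'') [0..<nv] = filter mark os"
      and A: "\<And>x. x < K \<Longrightarrow> reals s1 ''A'' x = reals s ''A'' x + (if mark x then da else 0)"
      and S: "\<And>x. x < K \<Longrightarrow> reals s1 ''S'' x = reals s ''S'' x + (if mark x then db else 0)"
      using 3(1) by (simp_all add: nu_def nv_def os_def perm)
    have "nu = length (filter (\<lambda>x. \<not> mark x) os)" using arg_cong[OF U, of length] by simp
    moreover have "nv = length (filter mark os)" using arg_cong[OF V, of length] by simp
    moreover have "length os = K" by (simp add: os_def)
    ultimately have K: "nu + nv = K" using sum_length_filter_compl[of mark os] by simp
    \<comment> \<open>Unmarked slopes have not changed, and the marked ones, treated next, have all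
      moved by \<open>db\<close>; comparisons within either part come out as before.\<close>
    have "sorted_wrt (\<lambda>x y. reals s1 ''S'' x \<le> reals s1 ''S'' y) (filter (\<lambda>x. \<not> mark x) os)"
      by (rule sorted_wrt_mono_rel[OF _ sorted_wrt_filter[OF sortos]]) (use setos S in auto)
    then have sortU: "sorted_on (reals s1 ''S'') (nats s1 ''U'') nu" by (simp add: sorted_on_map U)
    have "sorted_wrt (\<lambda>x y. reals s1 ''S'' x \<le> reals s1 ''S'' y) (filter mark os)"
      by (rule sorted_wrt_mono_rel[OF _ sorted_wrt_filter[OF sortos]]) (use setos S in auto)
    then have sortV: "sorted_on (reals s1 ''S'') (nats s1 ''V'') nv" by (simp add: sorted_on_map V)
    have n1: "nats s1 ''n'' 0 = nu + nv"
      using agree_outsideD(1)[OF 3(2), of "''n''"] n K by (simp add: split_prog_def)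
    have UV: "nats s1 ''U'' ` {..<nu} \<union> nats s1 ''V'' ` {..<nv} = {..<K}"
      using arg_cong[OF U, of set] arg_cong[OF V, of set] setos by (auto simp: atLeast0LessThan)
    show ?case
    proof (rule wp_conseq[OF merge_correct[OF refl sortU sortV n1 nu_def[symmetric] nv_def[symmetric]]], goal_cases)
      case (1 u s2)
      have "reals s2 = reals s1" using agree_outsideD(2)[OF 1(2)] by (simp add: merge_prog_def fun_eq_iff)
      then show ?case using 1(1) 3(1) A S by (simp add: K UV)
    qed
  qed (use assms in auto)
qed

section \<open>Upper envelope of sorted lines\<close>

text \<open>The lines \<open>A n + lam * S n\<close> are inserted by increasing slope into a stack of pieces, which
  occupies the cells \<open>base\<close>, \dots, \<open>len - 1\<close> of the output arrays. While line number \<open>i\<close> pops pieces,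
  the lines that were covered by the popped pieces are covered by line \<open>i\<close>.\<close>

locale envelope =
  fixes A S :: "nat \<Rightarrow> real" and ord :: "nat \<Rightarrow> nat" and K base :: nat and Lv :: real and lo :: bool
    and D R :: "real \<Rightarrow> bool"
  assumes sorted: "sorted_on S ord K"
    and D_lower: "D lam \<Longrightarrow> lo \<or> Lv \<le> lam"
    and D_upper: "D lam \<Longrightarrow> \<not> R x \<Longrightarrow> lam \<le> x"
begin

text \<open>\<open>D\<close> is the range of parameters of this envelope. A point without
  \<open>R\<close> is at or beyond the right end of \<open>D\<close>, so no piece may start there.
  If \<open>lo\<close> holds, the bottom piece has no start, and the value \<open>Lv\<close> stored
  for it is not compared with the next start.\<close>

definition stack_ok :: "nat \<Rightarrow> (nat \<Rightarrow> real) \<Rightarrow> (nat \<Rightarrow> real) \<Rightarrow> (nat \<Rightarrow> real) \<Rightarrow> bool" where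
  "stack_ok len st ic sl \<longleftrightarrow> (base < len \<longrightarrow> st base = Lv) \<and>
     (\<forall>p. base < p \<and> p < len \<longrightarrow> sl (p - 1) < sl p \<and> ic (p - 1) + st p * sl (p - 1) = ic p + st p * sl p \<and>
        (lo \<and> p - 1 = base \<or> st (p - 1) < st p) \<and> R (st p))"

definition pieces_ok :: "nat \<Rightarrow> nat \<Rightarrow> (nat \<Rightarrow> real) \<Rightarrow> (nat \<Rightarrow> real) \<Rightarrow> (nat \<Rightarrow> nat) \<Rightarrow> bool" where
  "pieces_ok i len ic sl vt \<longleftrightarrow> (\<forall>p. base \<le> p \<and> p < len \<longrightarrow>
     vt p \<in> ord ` {..<K} \<and> ic p = A (vt p) \<and> sl p = S (vt p) \<and>
     (\<forall>i'. i \<le> i' \<and> i' < K \<longrightarrow> sl p \<le> S (ord i')))"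

definition covered :: "nat \<Rightarrow> nat \<Rightarrow> (nat \<Rightarrow> real) \<Rightarrow> (nat \<Rightarrow> real) \<Rightarrow> bool" where
  "covered i len ic sl \<longleftrightarrow> (\<forall>i' lam. i' < i \<and> D lam \<longrightarrow>
     (\<exists>p. base \<le> p \<and> p < len \<and> A (ord i') + lam * S (ord i') \<le> ic p + lam * sl p) \<or>
     i < K \<and> A (ord i') + lam * S (ord i') \<le> A (ord i) + lam * S (ord i))"

definition env_inv :: "nat \<Rightarrow> nat \<Rightarrow> (nat \<Rightarrow> real) \<Rightarrow> (nat \<Rightarrow> real) \<Rightarrow> (nat \<Rightarrow> real) \<Rightarrow> (nat \<Rightarrow> nat) \<Rightarrow> bool" where
  "env_inv i len st ic sl vt \<longleftrightarrow> base \<le> len \<and> len \<le> base + i \<and> i \<le> K \<and> stack_ok len st ic sl \<and>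
     pieces_ok i len ic sl vt \<and> covered i len ic sl"

text \<open>For the very first piece, which may have no start, being dominated on its whole domain means
  being dominated everywhere.\<close>

definition dominated :: "nat \<Rightarrow> nat \<Rightarrow> (nat \<Rightarrow> real) \<Rightarrow> (nat \<Rightarrow> real) \<Rightarrow> (nat \<Rightarrow> real) \<Rightarrow> bool" where
  "dominated x p st ic sl \<longleftrightarrow> (if lo \<and> p = base then S x \<le> sl p \<and> ic p \<le> A x
     else ic p + st p * sl p \<le> A x + st p * S x)"

section \<open>Stack operations preserve the envelope\<close>

lemma line_le_right:
  fixes a b c d x y :: real
  assumes "a + x * b \<le> c + x * d" "b \<le> d" "x \<le> y"
  shows "a + y * b \<le> c + y * d"
proof -
  have "0 \<le> (y - x) * (d - b)" using assms by simp
  then show ?thesis using assms(1) by (simp add: algebra_simps)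
qed

lemma line_le_left:
  fixes a b c d x y :: real
  assumes "a + x * b \<le> c + x * d" "d \<le> b" "y \<le> x"
  shows "a + y * b \<le> c + y * d"
proof -
  have "0 \<le> (x - y) * (b - d)" using assms by simp
  then show ?thesis using assms(1) by (simp add: algebra_simps)
qed

lemma env_init: "env_inv 0 base st ic sl vt"
  by (auto simp: env_inv_def stack_ok_def pieces_ok_def covered_def)

lemma env_slope:
  "env_inv i len st ic sl vt \<Longrightarrow> i < K \<Longrightarrow> base \<le> p \<Longrightarrow> p < len \<Longrightarrow> sl p \<le> S (ord i)"
  unfolding env_inv_def pieces_ok_def by blast

lemma env_cases:
  assumes "env_inv i len st ic sl vt" "i' < Suc i" "D lam"
  obtains p where "base \<le> p" "p < len" "A (ord i') + lam * S (ord i') \<le> ic p + lam * sl p"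
    | "A (ord i') + lam * S (ord i') \<le> A (ord i) + lam * S (ord i)"
proof (cases "i' = i")
  case False
  then have "i' < i" using assms(2) by simp
  then have "(\<exists>p. base \<le> p \<and> p < len \<and> A (ord i') + lam * S (ord i') \<le> ic p + lam * sl p) \<or>
      A (ord i') + lam * S (ord i') \<le> A (ord i) + lam * S (ord i)"
    using assms(1,3) unfolding env_inv_def covered_def by blast
  then show ?thesis using that by blast
qed (use that in simp)

text \<open>To the right of the start of the top piece the steeper new line is at least as high; to
  the left the previous piece is. Below the bottom piece there is nothing to cover, as its start is
  the left end of \<open>D\<close>; if it has no start, domination was tested everywhere.\<close>

lemma env_pop:
  assumes inv: "env_inv i len st ic sl vt" and i: "i < K" and ne: "base < len"
    and dom: "dominated (ord i) (len - 1) st ic sl"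
  shows "env_inv i (len - 1) st ic sl vt"
proof -
  define top x where "top = len - 1" and "x = ord i"
  have top: "len = Suc top" "base \<le> top" using ne by (auto simp: top_def)
  have dom': "dominated x top st ic sl" using dom unfolding x_def top_def .
  have slope: "sl top \<le> S x" unfolding x_def by (rule env_slope[OF inv i]) (use top in auto)
  have stack: "stack_ok len st ic sl" using inv by (simp add: env_inv_def)
  have below: "ic top + lam * sl top \<le> A x + lam * S x \<or>
      (base < top \<and> ic top + lam * sl top \<le> ic (top - 1) + lam * sl (top - 1))" if D: "D lam" for lam
  proof (cases "lo \<and> top = base")
    case True
    then have "S x \<le> sl top" "ic top \<le> A x" using dom' unfolding dominated_def by auto
    then have "sl top = S x" using slope by simp
    then show ?thesis using \<open>ic top \<le> A x\<close> by simp
  next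
    case False
    then have d: "ic top + st top * sl top \<le> A x + st top * S x"
      using dom' unfolding dominated_def by auto
    show ?thesis
    proof (cases "st top \<le> lam")
      case True
      then show ?thesis using line_le_right[OF d slope] by simp
    next
      case lam: False
      show ?thesis
      proof (cases "top = base")
        case True
        then have "st top = Lv" using stack ne by (simp add: stack_ok_def)
        then show ?thesis using D_lower[OF D] False True lam by auto
      next
        case ne: False
        then have *: "base < top" using top by simp
        then have "sl (top - 1) < sl top" "ic (top - 1) + st top * sl (top - 1) = ic top + st top * sl top"
          using stack top by (auto simp: stack_ok_def)
        then show ?thesis
          using line_le_left[of "ic top" "st top" "sl top" "ic (top - 1)" "sl (top - 1)" lam] lam * by simp
      qed
    qed
  qed
  have "(\<exists>p. base \<le> p \<and> p < top \<and> A (ord i') + lam * S (ord i') \<le> ic p + lam * sl p) \<or>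
      A (ord i') + lam * S (ord i') \<le> A x + lam * S x" if i': "i' < i" and D: "D lam" for i' lam
  proof (rule env_cases[OF inv less_SucI[OF i'] D])
    fix p assume p: "base \<le> p" "p < len" "A (ord i') + lam * S (ord i') \<le> ic p + lam * sl p"
    show ?thesis
    proof (cases "p = top")
      case True
      with below[OF D] show ?thesis
      proof (elim disjE conjE)
        assume "base < top" "ic top + lam * sl top \<le> ic (top - 1) + lam * sl (top - 1)"
        then show ?thesis using p True by (intro disjI1 exI[of _ "top - 1"]) auto
      qed (use p True in auto)
    next
      case False
      then show ?thesis using p top by (intro disjI1 exI[of _ p]) auto
    qed
  qed (simp add: x_def)
  then have "covered i top ic sl" using i unfolding covered_def x_def by blast
  moreover have "stack_ok top st ic sl" using stack top by (auto simp: stack_ok_def)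
  moreover have "pieces_ok i top ic sl vt" using inv top by (auto simp: env_inv_def pieces_ok_def)
  ultimately show ?thesis
    using inv top unfolding env_inv_def top_def[symmetric] by auto
qed

text \<open>Once the stack is empty, every earlier line is covered by line \<open>i\<close>, which
  may therefore occupy the whole range.\<close>

lemma env_push_first:
  assumes inv: "env_inv i base st ic sl vt" and i: "i < K"
    and st': "\<And>p. st' p = (if p = base then Lv else st p)"
    and ic': "\<And>p. ic' p = (if p = base then A (ord i) else ic p)"
    and sl': "\<And>p. sl' p = (if p = base then S (ord i) else sl p)"
    and vt': "\<And>p. vt' p = (if p = base then ord i else vt p)"
  shows "env_inv (Suc i) (Suc base) st' ic' sl' vt'"
proof -
  have "S (ord i) \<le> S (ord i')" if "Suc i \<le> i'" "i' < K" for i'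
    using sorted that by (auto simp: sorted_on_def)
  then have "pieces_ok (Suc i) (Suc base) ic' sl' vt'"
    using i by (auto simp: pieces_ok_def ic' sl' vt')
  moreover have "A (ord i') + lam * S (ord i') \<le> A (ord i) + lam * S (ord i)"
    if i': "i' < Suc i" and D: "D lam" for i' lam
    by (rule env_cases[OF inv i' D]) auto
  then have "covered (Suc i) (Suc base) ic' sl'"
    unfolding covered_def by (intro allI impI disjI1 exI[of _ base]) (simp add: ic' sl')
  moreover have "stack_ok (Suc base) st' ic' sl'" by (auto simp: stack_ok_def st')
  ultimately show ?thesis using i by (auto simp: env_inv_def)
qed

text \<open>A line parallel to the top piece that does not dominate it lies below it. A steeper line
  overtakes the top piece only at the crossing, and that is not to the left of the right end of
  \<open>D\<close>.\<close>

lemma env_skip: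
  assumes inv: "env_inv i len st ic sl vt" and i: "i < K" and ne: "base < len"
    and dom: "\<not> dominated (ord i) (len - 1) st ic sl"
    and skip: "S (ord i) \<le> sl (len - 1) \<or>
      \<not> R ((ic (len - 1) - A (ord i)) / (S (ord i) - sl (len - 1)))"
  shows "env_inv (Suc i) len st ic sl vt"
proof -
  define top x where "top = len - 1" and "x = ord i"
  have top: "len = Suc top" "base \<le> top" using ne by (auto simp: top_def)
  have dom': "\<not> dominated x top st ic sl" using dom unfolding x_def top_def .
  have slope: "sl top \<le> S x" unfolding x_def by (rule env_slope[OF inv i]) (use top in auto)
  have below: "A x + lam * S x \<le> ic top + lam * sl top" if D: "D lam" for lam
  proof (cases "S x \<le> sl top")
    case True
    then have "sl top = S x" using slope by simp
    then show ?thesis using dom' by (auto simp: dominated_def split: if_splits)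
  next
    case False
    define c where "c = (ic top - A x) / (S x - sl top)"
    have "\<not> R c" using skip False by (simp add: c_def x_def top_def)
    then have "lam \<le> c" by (rule D_upper[OF D])
    then have "lam * (S x - sl top) \<le> ic top - A x" using False by (simp add: c_def pos_le_divide_eq)
    then show ?thesis by (simp add: algebra_simps)
  qed
  have "\<exists>p. base \<le> p \<and> p < len \<and> A (ord i') + lam * S (ord i') \<le> ic p + lam * sl p"
    if i': "i' < Suc i" and D: "D lam" for i' lam
  proof (rule env_cases[OF inv i' D])
    assume "A (ord i') + lam * S (ord i') \<le> A (ord i) + lam * S (ord i)"
    then show ?thesis using below[OF D] top by (intro exI[of _ top]) (auto simp: x_def)
  qed blast
  then have "covered (Suc i) len ic sl" unfolding covered_def by blast
  then show ?thesis using inv i unfolding env_inv_def pieces_ok_def by auto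
qed

text \<open>The new piece starts where its line meets the top piece. Not dominating the top piece at
  its start is precisely what places this point strictly to the right of that start.\<close>

lemma env_push:
  assumes inv: "env_inv i len st ic sl vt" and i: "i < K" and ne: "base < len"
    and dom: "\<not> dominated (ord i) (len - 1) st ic sl"
    and c: "c = (ic (len - 1) - A (ord i)) / (S (ord i) - sl (len - 1))"
    and push: "sl (len - 1) < S (ord i)" "R c"
    and st': "\<And>p. st' p = (if p = len then c else st p)"
    and ic': "\<And>p. ic' p = (if p = len then A (ord i) else ic p)"
    and sl': "\<And>p. sl' p = (if p = len then S (ord i) else sl p)"
    and vt': "\<And>p. vt' p = (if p = len then ord i else vt p)"
  shows "env_inv (Suc i) (Suc len) st' ic' sl' vt'"
proof -
  define top x where "top = len - 1" and "x = ord i"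
  have top: "len = Suc top" "base \<le> top" using ne by (auto simp: top_def)
  have dom': "\<not> dominated x top st ic sl" using dom unfolding x_def top_def .
  have stack: "stack_ok len st ic sl" using inv by (simp add: env_inv_def)
  have cmul: "c * (S x - sl top) = ic top - A x" using push(1) by (simp add: c x_def top_def)
  have meet: "ic top + c * sl top = A x + c * S x" using cmul by (simp add: algebra_simps)
  have start: "lo \<and> top = base \<or> st top < c"
  proof (cases "lo \<and> top = base")
    case False
    then have "A x + st top * S x < ic top + st top * sl top"
      using dom' unfolding dominated_def by auto
    then have "st top * (S x - sl top) < c * (S x - sl top)" using cmul by (simp add: algebra_simps)
    then show ?thesis using push(1) by (simp add: x_def top_def)
  qed simp
  have "stack_ok (Suc len) st' ic' sl'" unfolding stack_ok_def
  proof (intro allI impI conjI)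
    show "st' base = Lv" using stack ne by (simp add: st' stack_ok_def)
    fix p assume p: "base < p \<and> p < Suc len"
    have prev: "p - 1 \<noteq> len" using p by auto
    have "sl' (p - 1) < sl' p \<and> ic' (p - 1) + st' p * sl' (p - 1) = ic' p + st' p * sl' p \<and>
        (lo \<and> p - 1 = base \<or> st' (p - 1) < st' p) \<and> R (st' p)"
    proof (cases "p = len")
      case True
      then have "p - 1 = top" using top by simp
      then show ?thesis using True prev start meet push
        by (simp add: st' ic' sl' x_def top_def)
    next
      case False
      then have "base < p \<and> p < len" using p by simp
      then have "sl (p - 1) < sl p \<and> ic (p - 1) + st p * sl (p - 1) = ic p + st p * sl p \<and>
          (lo \<and> p - 1 = base \<or> st (p - 1) < st p) \<and> R (st p)"
        using stack unfolding stack_ok_def by blast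
      then show ?thesis unfolding st' ic' sl' using prev False by simp
    qed
    then show "sl' (p - 1) < sl' p" "ic' (p - 1) + st' p * sl' (p - 1) = ic' p + st' p * sl' p"
      "lo \<and> p - 1 = base \<or> st' (p - 1) < st' p" "R (st' p)" by blast+
  qed
  moreover have "pieces_ok (Suc i) (Suc len) ic' sl' vt'"
  proof -
    have "S (ord i) \<le> S (ord i')" if "Suc i \<le> i'" "i' < K" for i'
      using sorted that by (auto simp: sorted_on_def)
    then show ?thesis using inv i by (auto simp: env_inv_def pieces_ok_def ic' sl' vt' less_Suc_eq)
  qed
  moreover have "\<exists>p. base \<le> p \<and> p < Suc len \<and> A (ord i') + lam * S (ord i') \<le> ic' p + lam * sl' p"
    if i': "i' < Suc i" and D: "D lam" for i' lam
  proof (rule env_cases[OF inv i' D])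
    fix p assume "base \<le> p" "p < len" "A (ord i') + lam * S (ord i') \<le> ic p + lam * sl p"
    then show ?thesis by (intro exI[of _ p]) (auto simp: ic' sl')
  next
    assume "A (ord i') + lam * S (ord i') \<le> A (ord i) + lam * S (ord i)"
    then show ?thesis using ne by (intro exI[of _ len]) (auto simp: ic' sl')
  qed
  then have "covered (Suc i) (Suc len) ic' sl'" unfolding covered_def by blast
  ultimately show ?thesis using inv i by (auto simp: env_inv_def)
qed

text \<open>Walk from \<open>q\<close> to the active piece \<open>p\<close>. Neighbouring pieces
  agree at their common start, and by monotonicity of the starts \<open>lam\<close> always lies on
  the side where the order of slopes favours the neighbour closer to \<open>p\<close>.\<close>

lemma stack_max:
  assumes stack: "stack_ok len st ic sl" and p: "base \<le> p" "p < len"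
    and act: "base < p \<Longrightarrow> st p \<le> lam" "Suc p < len \<Longrightarrow> lam \<le> st (Suc p)"
    and q: "base \<le> q" "q < len"
  shows "ic q + lam * sl q \<le> ic p + lam * sl p"
proof -
  have link: "sl (r - 1) \<le> sl r" "ic (r - 1) + st r * sl (r - 1) = ic r + st r * sl r"
    if "base < r" "r < len" for r
    using stack that by (auto simp: stack_ok_def less_imp_le)
  have mono: "st r \<le> st r'" if "base < r" "r \<le> r'" "r' < len" for r r'
    using that(2,3)
  proof (induction r' rule: dec_induct)
    case (step r')
    have "base < Suc r'" "r' \<noteq> base" using step.hyps that(1) by auto
    then have "st r' < st (Suc r')"
      using stack step.prems unfolding stack_ok_def by (metis diff_Suc_1)
    then show ?case using step by auto
  qed simp
  show ?thesis
  proof (cases "q \<le> p")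
    case True
    then show ?thesis
    proof (induction rule: inc_induct)
      case (step r)
      then have r: "base < Suc r" "Suc r < len" "st (Suc r) \<le> lam"
        using q p mono[of "Suc r" p] act(1) by auto
      have "ic r + st (Suc r) * sl r \<le> ic (Suc r) + st (Suc r) * sl (Suc r)" "sl r \<le> sl (Suc r)"
        using link[OF r(1,2)] by simp_all
      then have "ic r + lam * sl r \<le> ic (Suc r) + lam * sl (Suc r)"
        using line_le_right r(3) by blast
      then show ?case using step.IH by simp
    qed simp
  next
    case False
    then have "p \<le> q" by simp
    then show ?thesis using q(2)
    proof (induction q rule: dec_induct)
      case (step r)
      then have r: "base < Suc r" "lam \<le> st (Suc r)"
        using p mono[of "Suc p" "Suc r"] act(2) by auto
      have "ic (Suc r) + st (Suc r) * sl (Suc r) \<le> ic r + st (Suc r) * sl r" "sl r \<le> sl (Suc r)"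
        using link[OF r(1) step.prems] by simp_all
      then have "ic (Suc r) + lam * sl (Suc r) \<le> ic r + lam * sl r"
        using line_le_left r(2) by blast
      then show ?case using step by simp
    qed simp
  qed
qed

lemma env_max:
  assumes inv: "env_inv K len st ic sl vt" and p: "base \<le> p" "p < len"
    and act: "base < p \<Longrightarrow> st p \<le> lam" "Suc p < len \<Longrightarrow> lam \<le> st (Suc p)"
    and D: "D lam" and n: "n \<in> ord ` {..<K}"
  shows "A n + lam * S n \<le> ic p + lam * sl p"
proof -
  obtain i where "i < K" "n = ord i" using n by blast
  then obtain q where "base \<le> q" "q < len" "A n + lam * S n \<le> ic q + lam * sl q"
    using inv D unfolding env_inv_def covered_def by blast
  moreover have "stack_ok len st ic sl" using inv by (simp add: env_inv_def)
  ultimately show ?thesis using stack_max[OF _ p act] by force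
qed

end

text \<open>The first piece of the entire output is the only one without a start, and only if the
  lower end is infinite. Hence \<open>lo\<close> together with \<open>top = base\<close> amounts to
  an unbounded lower end and \<open>top = 0\<close>.\<close>

definition dominated_test :: bexp where
  "dominated_test =
    (let first = And (Not (NZ (N ''lower''))) (Not (NZ (N ''top'')));
         value = (\<lambda>a s i. RAdd (RCell a i) (RMul (RCell ''out_start'' (N ''top'')) (RCell s i)))
     in Or (And first (And (Not (RLess (RCell ''out_slope'' (N ''top'')) (RCell ''S'' (N ''x''))))
            (Not (RLess (RCell ''A'' (N ''x'')) (RCell ''out_intercept'' (N ''top''))))))
          (And (Not first) (Not (RLess (value ''A'' ''S'' (N ''x''))
            (value ''out_intercept'' ''out_slope'' (N ''top''))))))"

definition push_prog :: com where
  "push_prog = RAssign ''out_start'' (N ''out_length'') (R ''sv'') ;;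
    RAssign ''out_intercept'' (N ''out_length'') (RCell ''A'' (N ''x'')) ;;
    RAssign ''out_slope'' (N ''out_length'') (RCell ''S'' (N ''x'')) ;;
    NAssign ''vt'' (N ''out_length'') (N ''x'') ;;
    inc ''out_length''"

definition insert_prog :: com where
  "insert_prog = ''x'' ::= NCell ''ord'' (N ''i'') ;;
    If (NLess (N ''base'') (N ''out_length''))
      (''top'' ::= NSub (N ''out_length'') (NConst 1) ;;
       If dominated_test
         (''out_length'' ::= N ''top'')
         (If (RLess (RCell ''out_slope'' (N ''top'')) (RCell ''S'' (N ''x'')))
            (''sv'' ::~ RDiv (RSub (RCell ''out_intercept'' (N ''top'')) (RCell ''A'' (N ''x'')))
                (RSub (RCell ''S'' (N ''x'')) (RCell ''out_slope'' (N ''top''))) ;;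
             If (Or (Not (NZ (N ''rk''))) (RLess (R ''sv'') (R ''rv''))) push_prog Skip)
            Skip ;;
          inc ''i''))
      (''sv'' ::~ R ''Lv'' ;; push_prog ;; inc ''i'')"

text \<open>Popping and inserting are flattened into a single loop with one constant-time action per
  round, because a counting loop needs its number of rounds in advance.\<close>

definition env_loop :: com where
  "env_loop = For ''q'' (NMul (NConst 2) (N ''n'')) (If (NLess (N ''i'') (N ''n'')) insert_prog Skip)"

text \<open>The lines after step \<open>j\<close> are valid from the time of step \<open>j\<close>,
  or from the lower end after the greedy phase, to the time of the next step or to the upper end.
  \<open>rk = 0\<close> stands for a right end at infinity.\<close>

definition env_prog :: com where
  "env_prog = ''base'' ::= N ''out_length'' ;;
    If (NLess (N ''j'') (N ''size'')) (''Lv'' ::~ R ''lower'') (''Lv'' ::~ RCell ''st'' (N ''j'')) ;;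
    If (NLess (NAdd (N ''j'') (NConst 1)) (N ''J''))
      (''rk'' ::= NConst 1 ;; ''rv'' ::~ RCell ''st'' (NAdd (N ''j'') (NConst 1)))
      (''rk'' ::= N ''upper'' ;; ''rv'' ::~ R ''upper'') ;;
    ''i'' ::= NConst 0 ;;
    env_loop"

text \<open>The first envelope belongs to \<open>j = m - 1\<close>, the last greedy step; before it
  the sets are not yet bases and their lines represent no values.\<close>

definition line_step_prog :: com where
  "line_step_prog = split_prog ;; merge_prog ;;
    If (NLess (NAdd (N ''j'') (NConst 1)) (N ''size'')) Skip env_prog"

definition lines_prog :: com where
  "lines_prog = For ''i'' (N ''n'') (NAssign ''ord'' (N ''i'') (N ''i'')) ;;
    For ''j'' (N ''J'') line_step_prog"

text \<open>In each round the number of inserted lines minus half the number of pieces grows, so \<open>2 K\<close>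
  rounds suffice for \<open>K\<close> lines.\<close>

lemma env_loop_correct:
  assumes env: "envelope S ord K Lv lo D ub"
    and A: "reals s ''A'' = A" "reals s ''S'' = S" "nats s ''ord'' = ord" "nats s ''n'' 0 = K"
    and base: "nats s ''base'' 0 = base" "nats s ''out_length'' 0 = base" "nats s ''i'' 0 = 0"
    and Lv: "reals s ''Lv'' 0 = Lv" and lo: "lo \<longleftrightarrow> base = 0 \<and> nats s ''lower'' 0 = 0"
    and ub: "\<And>x. ub x \<longleftrightarrow> nats s ''rk'' 0 = 0 \<or> x < reals s ''rv'' 0"
  shows "wp \<F> k d env_loop (\<lambda>t s'. t \<le> 20 + 2 * K * 250 \<and>
    envelope.env_inv A S ord K base Lv lo D ub K (nats s' ''out_length'' 0) (reals s' ''out_start'')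
      (reals s' ''out_intercept'') (reals s' ''out_slope'') (nats s' ''vt'') \<and>
    (\<forall>p<base. reals s' ''out_start'' p = reals s ''out_start'' p \<and>
      reals s' ''out_intercept'' p = reals s ''out_intercept'' p \<and>
      reals s' ''out_slope'' p = reals s ''out_slope'' p \<and> nats s' ''vt'' p = nats s ''vt'' p)) s"
proof -
  interpret envelope A S ord K base Lv lo D ub by (rule env)
  define inv where "inv s' \<longleftrightarrow> env_inv (nats s' ''i'' 0) (nats s' ''out_length'' 0) (reals s' ''out_start'')
      (reals s' ''out_intercept'') (reals s' ''out_slope'') (nats s' ''vt'')" for s' :: memory
  define kept where "kept s' \<longleftrightarrow> (\<forall>p<base. reals s' ''out_start'' p = reals s ''out_start'' p \<and>
      reals s' ''out_intercept'' p = reals s ''out_intercept'' p \<and>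
      reals s' ''out_slope'' p = reals s ''out_slope'' p \<and> nats s' ''vt'' p = nats s ''vt'' p)" for s' :: memory
  define gain where "gain s' = nats s' ''out_length'' 0 - base" for s' :: memory
  have setq: "inv (setn s' ''q'' 0 v) = inv s'" "kept (setn s' ''q'' 0 v) = kept s'"
    "gain (setn s' ''q'' 0 v) = gain s'" for s' v
    by (simp_all add: inv_def kept_def gain_def)
  show ?thesis unfolding env_loop_def
  proof (rule wp_For[where b = "2 * K" and c = 220 and I = "\<lambda>k s'. inv s' \<and> kept s' \<and>
      (nats s' ''i'' 0 < K \<longrightarrow> k + gain s' \<le> 2 * nats s' ''i'' 0)"], goal_cases)
    case 1
    then show ?case unfolding setq
      using base env_init[of "reals s ''out_start''" "reals s ''out_intercept''" "reals s ''out_slope''" "nats s ''vt''"]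
      by (simp add: inv_def kept_def gain_def)
  next
    case (2 k s')
    then show ?case using agree_outsideD[OF 2(4)] A by (simp add: insert_prog_def push_prog_def)
  next
    case (3 k s')
    have fr: "x \<notin> {''q'', ''x'', ''top'', ''vt'', ''out_length'', ''i''} \<Longrightarrow> nats s' x = nats s x"
      "x \<notin> {''sv'', ''out_start'', ''out_intercept'', ''out_slope''} \<Longrightarrow> reals s' x = reals s x" for x
      using agree_outsideD[OF 3(4)] by (simp_all add: insert_prog_def push_prog_def)
    define i len st ic sl vt where "i = nats s' ''i'' 0" and "len = nats s' ''out_length'' 0"
      and "st = reals s' ''out_start''" and "ic = reals s' ''out_intercept''"
      and "sl = reals s' ''out_slope''" and "vt = nats s' ''vt''"
    note defs = i_def len_def st_def ic_def sl_def vt_def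
    have inv: "env_inv i len st ic sl vt" using 3(2) by (simp add: inv_def defs)
    have len: "base \<le> len" "len \<le> base + i" using inv by (simp_all add: env_inv_def)
    show ?case
    proof (cases "i < K")
      case False
      then show ?thesis using 3(2,3) fr A unfolding setq by (simp add: wp_simps defs)
    next
      case iK: True
      have gain: "k + (len - base) \<le> 2 * i" using 3(2) iK by (simp add: gain_def defs)
      have eq: "reals s' ''A'' = A" "reals s' ''S'' = S" "nats s' ''ord'' = ord" "nats s' ''n'' 0 = K"
        "nats s' ''base'' 0 = base" "reals s' ''Lv'' 0 = Lv" "nats s' ''lower'' 0 = nats s ''lower'' 0"
        "nats s' ''rk'' 0 = nats s ''rk'' 0" "reals s' ''rv'' 0 = reals s ''rv'' 0"
        using fr A base Lv by simp_all
      note defs' = defs[symmetric]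
      show ?thesis
      proof (cases "base < len")
        case False
        then have lb: "len = base" using len by simp
        have "env_inv (Suc i) (Suc base) (\<lambda>p. if p = base then Lv else st p)
          (\<lambda>p. if p = base then A (ord i) else ic p) (\<lambda>p. if p = base then S (ord i) else sl p)
          (\<lambda>p. if p = base then ord i else vt p)"
          by (rule env_push_first[OF inv[unfolded lb] iK]) simp_all
        then show ?thesis unfolding setq
          using 3(2,3) iK False gain
          by (simp add: wp_simps insert_prog_def push_prog_def eq defs' inv_def kept_def gain_def lb cong: if_cong)
      next
        case ne: True
        define x top where "x = ord i" and "top = len - 1"
        have dom: "bval (setn (setn s' ''x'' 0 x) ''top'' 0 top) dominated_test \<longleftrightarrow> dominated x top st ic sl"
        proof -
          have "lo \<and> top = base \<longleftrightarrow> nats s' ''lower'' 0 = 0 \<and> top = 0"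
            using lo fr(1)[of "''lower''"] ne by (auto simp: top_def)
          then show ?thesis unfolding dominated_test_def dominated_def Let_def
            by (simp add: eq defs' not_less)
        qed
        have folds: "ord i = x" "len - Suc 0 = top" "(ic top - A x) / (S x - sl top) = c"
          if "c = (ic top - A x) / (S x - sl top)" for c using that by (simp_all add: x_def top_def)
        \<comment> \<open>A pop leaves \<open>i\<close> unchanged and pays for its round with the
          piece that it removes.\<close>
        have gain': "Suc (k + (top - base)) \<le> 2 * i" using gain ne by (simp add: top_def)
        have dcost: "bcost dominated_test = 70" by (simp add: dominated_test_def Let_def)
        show ?thesis
        proof (cases "dominated x top st ic sl")
          case True
          then have "env_inv i top st ic sl vt"
            using env_pop[OF inv iK ne] by (simp add: x_def top_def)
          then show ?thesis unfolding setq
            using 3(2,3) iK ne gain gain' True len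
            by (simp add: wp_simps insert_prog_def push_prog_def eq defs' inv_def kept_def gain_def dom dcost
                folds(1,2) cong: if_cong)
        next
          case nd: False
          then have nd': "\<not> dominated (ord i) (len - 1) st ic sl" by (simp add: x_def top_def)
          define c where "c = (ic top - A x) / (S x - sl top)"
          define ok where "ok \<longleftrightarrow> nats s ''rk'' 0 = 0 \<or> c < reals s ''rv'' 0"
          have skip: "env_inv (Suc i) len st ic sl vt" if "\<not> sl top < S x \<or> \<not> ok"
            by (rule env_skip[OF inv iK ne nd']) (use that ub in \<open>auto simp: c_def x_def top_def ok_def\<close>)
          have push: "env_inv (Suc i) (Suc len) (\<lambda>p. if p = len then c else st p)
            (\<lambda>p. if p = len then A x else ic p) (\<lambda>p. if p = len then S x else sl p)
            (\<lambda>p. if p = len then x else vt p)" if "sl top < S x" "ok"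
            by (rule env_push[OF inv iK ne nd' c_def[unfolded x_def top_def]])
              (use that ub in \<open>simp_all add: x_def top_def ok_def\<close>)
          have okc: "bval (setr (setn (setn s' ''x'' 0 x) ''top'' 0 top) ''sv'' 0 c)
              (Or (Not (NZ (N ''rk''))) (RLess (R ''sv'') (R ''rv''))) \<longleftrightarrow> ok"
            by (simp add: ok_def eq)
          \<comment> \<open>Finishing a line raises \<open>2 * i\<close> by two, which pays for the
            round and for the piece that may have been pushed.\<close>
          have gain2: "Suc (k + len) - base \<le> Suc (2 * i)" using gain ne by linarith
          show ?thesis unfolding setq
            using 3(2,3) iK ne gain gain2 nd skip push len
            by (cases ok; cases "sl top < S x")
              (simp_all add: wp_simps insert_prog_def push_prog_def eq defs' inv_def kept_def gain_def dom dcost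
                folds(1,2) folds(3)[OF c_def] okc cong: if_cong del: bval.simps(3,4))
        qed
      qed
    qed
  next
    case (4 t s')
    have "nats s' ''i'' 0 \<le> K" using 4(2) by (simp add: inv_def env_inv_def)
    \<comment> \<open>After \<open>2 * K\<close> rounds the invariant would yield
      \<open>2 * K \<le> 2 * i\<close> for some \<open>i < K\<close>.\<close>
    moreover have "\<not> nats s' ''i'' 0 < K" using 4(2) by auto
    ultimately have "nats s' ''i'' 0 = K" by simp
    then show ?case using 4(1,2) by (simp add: inv_def kept_def)
  qed
qed

section \<open>Joining the envelopes of consecutive ranges\<close>

context schedule
begin

text \<open>A correct output for the parameters up to \<open>st j\<close>, or for all parameters
  once \<open>j = J\<close>. The factor \<open>Suc j - m\<close> counts the envelopes built so far,
  each of which adds at most \<open>K\<close> pieces.\<close>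

definition out_ok :: "(nat \<Rightarrow> real \<Rightarrow> real) \<Rightarrow> nat \<Rightarrow> nat \<Rightarrow> nat \<Rightarrow>
    (nat \<Rightarrow> real) \<Rightarrow> (nat \<Rightarrow> real) \<Rightarrow> (nat \<Rightarrow> real) \<Rightarrow> (nat \<Rightarrow> nat) \<Rightarrow> bool" where
  "out_ok val j K len bs ic sl vt \<longleftrightarrow>
     (\<forall>p. 0 < p \<and> p < len \<longrightarrow> above_lower (bs p) \<and> below_upper (bs p) \<and> (j < J \<longrightarrow> bs p < st j)) \<and>
     (\<forall>p q. 0 < p \<and> p < q \<and> q < len \<longrightarrow> bs p < bs q) \<and>
     (\<forall>p lam. p < len \<and> lam \<in> parameters X \<and> (0 < p \<longrightarrow> bs p \<le> lam) \<and>
        (Suc p < len \<longrightarrow> lam \<le> bs (Suc p)) \<and> (Suc p = len \<and> j < J \<longrightarrow> lam \<le> st j) \<longrightarrow>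
        (\<forall>n<K. val n lam \<le> ic p + lam * sl p) \<and> val (vt p) lam = ic p + lam * sl p) \<and>
     (\<forall>p<len. vt p < K) \<and> (parameters X \<noteq> {} \<longrightarrow> 0 < len) \<and> len \<le> (Suc j - m) * K"

definition between :: "nat \<Rightarrow> real \<Rightarrow> bool" where
  "between j lam \<longleftrightarrow> lam \<in> parameters X \<and> (m \<le> j \<longrightarrow> st j \<le> lam) \<and> (Suc j < J \<longrightarrow> lam \<le> st (Suc j))"

text \<open>Strict, in contrast to \<open>between\<close>: a piece has to start strictly before the
  next envelope does, so that the starts of the joined output increase strictly.\<close>

definition under :: "nat \<Rightarrow> real \<Rightarrow> bool" where
  "under j x \<longleftrightarrow> (if Suc j < J then x < st (Suc j) else below_upper x)"

definition left_end :: "nat \<Rightarrow> real" where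
  "left_end j = (if j < m then endpoint_value (lower_end X) else st j)"

lemma st_inside: "m \<le> j \<Longrightarrow> j < J \<Longrightarrow> above_lower (st j) \<and> below_upper (st j)"
  using steps_event[of j] steps_time[of j] by (simp add: event_def)

lemma envelope_between:
  assumes "sorted_on S ord K" "j < m \<Longrightarrow> base = 0" "lo \<longleftrightarrow> base = 0 \<and> endpoint_kind (lower_end X) = 0"
  shows "envelope S ord K (left_end j) lo (between j) (under j)"
proof
  show "lo \<or> left_end j \<le> lam" if "between j lam" for lam
    using that assms(2,3) parameters_lower by (auto simp: between_def left_end_def)
  show "lam \<le> x" if "between j lam" "\<not> under j x" for lam x
  proof (rule ccontr)
    assume "\<not> lam \<le> x"
    then show False
      using that below_upper_trans[of lam x] by (auto simp: between_def under_def split: if_splits)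
  qed
qed fact

text \<open>The new envelope is appended behind the \<open>base\<close> old pieces. Old starts lie
  before \<open>st j\<close>, the first new piece starts exactly there, and the last old piece,
  valid up to \<open>st j\<close>, now ends at that start.\<close>

lemma out_step:
  assumes j: "j < J" "m \<le> Suc j" and K: "0 < K" and perm: "ord ` {..<K} = {..<K}"
    and sorted: "sorted_on S ord K"
    and pre: "j < m \<Longrightarrow> base = 0" "m \<le> j \<Longrightarrow> out_ok val j K base bs0 ic0 sl0 vt0"
    and lines: "\<And>n lam. n < K \<Longrightarrow> between j lam \<Longrightarrow> val n lam = A n + lam * S n"
    and lo: "lo \<longleftrightarrow> base = 0 \<and> endpoint_kind (lower_end X) = 0"
    and inv: "envelope.env_inv A S ord K base (left_end j) lo (between j) (under j) K len bs ic sl vt"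
    and kept: "\<And>p. p < base \<Longrightarrow> bs p = bs0 p \<and> ic p = ic0 p \<and> sl p = sl0 p \<and> vt p = vt0 p"
  shows "out_ok val (Suc j) K len bs ic sl vt"
proof -
  interpret envelope A S ord K base "left_end j" lo "between j" "under j"
    by (rule envelope_between[OF sorted pre(1) lo])
  have len: "base \<le> len" "len \<le> base + K" and stack: "stack_ok len bs ic sl"
    and pieces: "pieces_ok K len ic sl vt" and cov: "covered K len ic sl"
    using inv by (simp_all add: env_inv_def)
  have ne: "base < len" if lam: "between j lam" for lam
  proof -
    obtain p where "base \<le> p" "p < len" using cov K lam unfolding covered_def by blast
    then show ?thesis by simp
  qed
  have b0: "0 < base" "between j (st j)" "base < len" if "m \<le> j"
  proof -
    have in_st: "st j \<in> parameters X" using st_inside[OF that j(1)] interior_parameters by blast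
    then show "0 < base" using pre(2)[OF that] unfolding out_ok_def by blast
    show bt: "between j (st j)"
      using in_st st_increasing[OF that, of "Suc j"] by (auto simp: between_def)
    show "base < len" by (rule ne[OF bt])
  qed
  have base_pos: "m \<le> j" if "0 < base" using pre(1) that by (cases "j < m") auto
  have bs_base: "bs base = left_end j" if "base < len" using stack that by (simp add: stack_ok_def)
  have link: "lo \<and> p = base \<or> bs p < bs (Suc p)" "under j (bs (Suc p))" if "base \<le> p" "Suc p < len" for p
    using stack that unfolding stack_ok_def by (metis diff_Suc_1 le_imp_less_Suc)+
  have mono: "bs p < bs q" if p: "base \<le> p" "0 < p" and q: "p < q" "q < len" for p q
    using q
  proof (induction q)
    case (Suc q)
    have "bs q < bs (Suc q)" using link(1)[of q] lo p Suc.prems by auto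
    then show ?case using Suc p by (cases "p = q") auto
  qed simp
  \<comment> \<open>The successor of a piece without a start has nothing to be compared with, but
    then the lower end is infinite and the claim is trivial.\<close>
  have above: "above_lower (bs p)" if "base \<le> p" "0 < p" "p < len" for p
    using that
  proof (induction p)
    case (Suc p)
    show ?case
    proof (cases "Suc p = base")
      case True
      then have mj: "m \<le> j" using base_pos by simp
      then show ?thesis using bs_base Suc.prems True st_inside[OF mj j(1)] by (simp add: left_end_def)
    next
      case False
      then have p: "base \<le> p" using Suc.prems by simp
      have "lo \<and> p = base \<or> bs p < bs (Suc p)" by (rule link[OF p Suc.prems(3)])
      then show ?thesis
      proof
        assume "lo \<and> p = base"
        then show ?thesis using lo by (simp add: above_lower_def)
      next
        assume less: "bs p < bs (Suc p)"
        show ?thesis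
        proof (cases "p = 0")
          case True
          then have "base = 0" using p by simp
          then have "j < m" using b0(1) by force
          then have "bs p = endpoint_value (lower_end X)"
            using bs_base \<open>base = 0\<close> True Suc.prems by (simp add: left_end_def)
          then show ?thesis using less by (simp add: above_lower_def)
        next
          case False
          then have "above_lower (bs p)" using Suc p by simp
          then show ?thesis using less by (auto simp: above_lower_def)
        qed
      qed
    qed
  qed simp
  have below: "under j (bs p)" if "base \<le> p" "0 < p" "p < len" for p
  proof (cases "p = base")
    case True
    then have mj: "m \<le> j" using base_pos that by simp
    then have "bs p = st j" using bs_base True that by (simp add: left_end_def)
    then show ?thesis using st_increasing[OF mj, of "Suc j"] st_inside[OF mj j(1)] by (simp add: under_def)
  next
    case False
    then show ?thesis using link(2)[of "p - 1"] that by simp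
  qed
  have under_below: "below_upper x \<and> (Suc j < J \<longrightarrow> x < st (Suc j))" if "under j x" for x
  proof (cases "Suc j < J")
    case True
    then have "x < st (Suc j)" "st (Suc j) \<in> parameters X"
      using that st_inside[OF j(2) True] interior_parameters by (auto simp: under_def)
    then show ?thesis using below_upper_trans by blast
  qed (use that in \<open>simp add: under_def\<close>)
  have old: "above_lower (bs p)" "below_upper (bs p)" "bs p < st j" if "0 < p" "p < base" for p
    using pre(2) base_pos that j(1) kept[of p] by (auto simp: out_ok_def)
  show ?thesis unfolding out_ok_def
  proof (intro conjI allI impI; (elim conjE)?)
    fix p assume p: "0 < p" "p < len"
    show "above_lower (bs p)" using above[of p] old[of p] p by (cases "p < base") auto
    show "below_upper (bs p)" using below[of p] under_below[of "bs p"] old[of p] p by (cases "p < base") auto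
    assume J: "Suc j < J"
    show "bs p < st (Suc j)"
    proof (cases "p < base")
      case True
      then have "bs p < st j" "m \<le> j" using old p base_pos by auto
      then show ?thesis using st_increasing[of j "Suc j"] J by auto
    qed (use below[of p] under_below[of "bs p"] p J in auto)
  next
    fix p q assume pq: "0 < p" "p < q" "q < len"
    show "bs p < bs q"
    proof (cases "p < base")
      case True
      then have mj: "m \<le> j" using base_pos pq by simp
      show ?thesis
      proof (cases "q < base")
        case True
        then show ?thesis using pre(2)[OF mj] pq kept[of p] kept[of q] by (auto simp: out_ok_def)
      next
        case False
        have "st j = bs base" using bs_base False pq mj by (simp add: left_end_def)
        moreover have "bs base \<le> bs q" using mono[of base q] False b0(1)[OF mj] pq by (cases "q = base") auto
        ultimately show ?thesis using old(3)[of p] pq True by simp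
      qed
    qed (use mono[of p q] pq in auto)
  next
    fix p assume p: "p < len"
    show "vt p < K"
    proof (cases "p < base")
      case True
      then show ?thesis using pre(2) base_pos kept[of p] by (auto simp: out_ok_def)
    next
      case False
      then show ?thesis using pieces p perm by (auto simp: pieces_ok_def)
    qed
  next
    assume I: "parameters X \<noteq> {}"
    show "0 < len"
    proof (cases "m \<le> j")
      case True
      then show ?thesis using b0(3) by auto
    next
      case False
      show ?thesis
      proof (cases "Suc j < J")
        case True
        have "st (Suc j) \<in> parameters X" using st_inside[OF j(2) True] interior_parameters by blast
        then show ?thesis using ne[of "st (Suc j)"] False by (auto simp: between_def)
      next
        case J: False
        obtain lam where "lam \<in> parameters X" using I by blast
        then show ?thesis using ne[of lam] False J by (auto simp: between_def)
      qed
    qed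
  next
    have "base \<le> (Suc j - m) * K" using pre by (cases "m \<le> j") (auto simp: out_ok_def)
    moreover have "Suc (Suc j) - m = Suc (Suc j - m)" using j(2) by simp
    ultimately show "len \<le> (Suc (Suc j) - m) * K" using len(2) by simp
  next
    fix p lam
    assume p: "p < len" and lam: "lam \<in> parameters X"
      and act: "0 < p \<longrightarrow> bs p \<le> lam" "Suc p < len \<longrightarrow> lam \<le> bs (Suc p)" "Suc p = len \<and> Suc j < J \<longrightarrow> lam \<le> st (Suc j)"
    have "(\<forall>n<K. val n lam \<le> ic p + lam * sl p) \<and> val (vt p) lam = ic p + lam * sl p"
    proof (cases "p < base")
      case True
      then have mj: "m \<le> j" using base_pos by simp
      \<comment> \<open>The last old piece now ends at the start of the first new one. This start is
        \<open>st j\<close>, the limit up to which the old output was correct.\<close>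
      have "lam \<le> st j" if "Suc p = base"
        using act(2) b0(3)[OF mj] bs_base mj that by (simp add: left_end_def)
      moreover have "lam \<le> bs0 (Suc p)" if "Suc p < base"
        using act(2) kept[OF that] len that by simp
      moreover have "0 < p \<longrightarrow> bs0 p \<le> lam" using act(1) kept[OF True] by simp
      ultimately have "(\<forall>n<K. val n lam \<le> ic0 p + lam * sl0 p) \<and> val (vt0 p) lam = ic0 p + lam * sl0 p"
        using pre(2)[OF mj] True lam unfolding out_ok_def by blast
      then show ?thesis using kept[OF True] by simp
    next
      case False
      then have pb: "base \<le> p" by simp
      have D: "between j lam" unfolding between_def
      proof (intro conjI impI lam)
        assume mj: "m \<le> j"
        then have "st j = bs base" using bs_base b0(3) by (simp add: left_end_def)
        also have "\<dots> \<le> bs p" using mono[of base p] pb b0(1)[OF mj] p by (cases "p = base") auto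
        finally show "st j \<le> lam" using act(1) b0(1)[OF mj] pb by simp
      next
        assume J: "Suc j < J"
        show "lam \<le> st (Suc j)"
        proof (cases "Suc p < len")
          case True
          then show ?thesis using act(2) below[of "Suc p"] under_below[of "bs (Suc p)"] J pb by auto
        next
          case False
          then show ?thesis using act(3) p J by simp
        qed
      qed
      have "A n + lam * S n \<le> ic p + lam * sl p" if "n < K" for n
      proof (rule env_max[OF inv pb p _ _ D])
        show "base < p \<Longrightarrow> bs p \<le> lam" using act(1) by simp
        show "Suc p < len \<Longrightarrow> lam \<le> bs (Suc p)" using act(2) by simp
        show "n \<in> ord ` {..<K}" using perm that by simp
      qed
      moreover have "vt p < K" "ic p = A (vt p)" "sl p = S (vt p)"
        using pieces pb p perm by (auto simp: pieces_ok_def)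
      ultimately show ?thesis using lines[OF _ D] by simp
    qed
    then show "\<And>n. n < K \<Longrightarrow> val n lam \<le> ic p + lam * sl p" "val (vt p) lam = ic p + lam * sl p" by blast+
  qed
qed

lemma env_correct:
  assumes inp: "input_ok s" and mem: "schedule_mem s" and times: "\<And>j. m \<le> j \<Longrightarrow> j < J \<Longrightarrow> reals s ''st'' j = st j"
    and j: "nats s ''j'' 0 = j" "j < J" "m \<le> Suc j" and K: "nats s ''n'' 0 = K" "0 < K"
    and perm: "nats s ''ord'' ` {..<K} = {..<K}" and sorted: "sorted_on (reals s ''S'') (nats s ''ord'') K"
    and pre: "j < m \<Longrightarrow> nats s ''out_length'' 0 = 0"
      "m \<le> j \<Longrightarrow> out_ok val j K (nats s ''out_length'' 0) (reals s ''out_start'') (reals s ''out_intercept'')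
        (reals s ''out_slope'') (nats s ''vt'')"
    and lines: "\<And>n lam. n < K \<Longrightarrow> between j lam \<Longrightarrow> val n lam = reals s ''A'' n + lam * reals s ''S'' n"
  shows "wp \<F> k d env_prog (\<lambda>t s'. t \<le> 100 + K * 500 \<and>
    out_ok val (Suc j) K (nats s' ''out_length'' 0) (reals s' ''out_start'') (reals s' ''out_intercept'')
        (reals s' ''out_slope'') (nats s' ''vt'')) s"
proof -
  define base where "base = nats s ''out_length'' 0"
  define lo where "lo \<longleftrightarrow> base = 0 \<and> endpoint_kind (lower_end X) = 0"
  have base0: "j < m \<Longrightarrow> base = 0" using pre(1) by (simp add: base_def)
  define rk where "rk = (if Suc j < J then 1 else endpoint_kind (upper_end X))"
  define rv where "rv = (if Suc j < J then st (Suc j) else endpoint_value (upper_end X))"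
  define s0 where "s0 = setn (setr (setn (setr (setn s ''base'' 0 base) ''Lv'' 0 (left_end j)) ''rk'' 0 rk) ''rv'' 0 rv) ''i'' 0 0"
  have under: "under j x \<longleftrightarrow> nats s0 ''rk'' 0 = 0 \<or> x < reals s0 ''rv'' 0" for x
    by (simp add: s0_def under_def below_upper_def rk_def rv_def)
  define good where "good s' \<longleftrightarrow>
    envelope.env_inv (reals s ''A'') (reals s ''S'') (nats s ''ord'') K base (left_end j) lo (between j) (under j) K
      (nats s' ''out_length'' 0) (reals s' ''out_start'')
      (reals s' ''out_intercept'') (reals s' ''out_slope'') (nats s' ''vt'') \<and>
    (\<forall>p<base. reals s' ''out_start'' p = reals s ''out_start'' p \<and>
      reals s' ''out_intercept'' p = reals s ''out_intercept'' p \<and>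
      reals s' ''out_slope'' p = reals s ''out_slope'' p \<and> nats s' ''vt'' p = nats s ''vt'' p)" for s' :: memory
  have "wp \<F> k d env_loop (\<lambda>t s'. t \<le> 20 + 2 * K * 250 \<and>
    envelope.env_inv (reals s ''A'') (reals s ''S'') (nats s ''ord'') K base (left_end j) lo (between j) (under j) K
      (nats s' ''out_length'' 0) (reals s' ''out_start'')
      (reals s' ''out_intercept'') (reals s' ''out_slope'') (nats s' ''vt'') \<and>
    (\<forall>p<base. reals s' ''out_start'' p = reals s0 ''out_start'' p \<and>
      reals s' ''out_intercept'' p = reals s0 ''out_intercept'' p \<and>
      reals s' ''out_slope'' p = reals s0 ''out_slope'' p \<and> nats s' ''vt'' p = nats s0 ''vt'' p)) s0"
    by (rule env_loop_correct[OF envelope_between[OF sorted base0 lo_def]])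
      (use under K input_okD(2)[OF inp] in \<open>simp_all add: s0_def base_def lo_def\<close>)
  then have loop: "wp \<F> k d env_loop (\<lambda>t s'. t \<le> 20 + 2 * K * 250 \<and> good s') s0"
    by (rule wp_mono) (simp add: good_def s0_def)
  have regs: "nats s ''size'' 0 = m" "nats s ''J'' 0 = J" using mem by (simp_all add: schedule_mem_def)
  have finish: "out_ok val (Suc j) K (nats s' ''out_length'' 0) (reals s' ''out_start'') (reals s' ''out_intercept'')
        (reals s' ''out_slope'') (nats s' ''vt'')" if "good s'" for s'
    by (rule out_step[OF j(2,3) K(2) perm sorted base0 pre(2)[folded base_def] lines lo_def])
      (use that in \<open>simp_all add: good_def\<close>)
  show ?thesis using loop
    apply (cases "j < m"; cases "Suc j < J")
       apply (simp_all add: env_prog_def wp_simps regs input_okD[OF inp] times j s0_def base_def[symmetric]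
        left_end_def rk_def rv_def)
       apply (erule wp_mono, use finish in simp)+
    done
qed

text \<open>Applied to constants and slopes, this gives the update of the lines; the dummy
  contributes 0, just as the cells read for it do.\<close>

lemma sum_step:
  fixes c :: "nat \<Rightarrow> real"
  assumes "j < J"
  shows "sum c (sim F (Suc j)) = sum c (sim F j) +
    (if fires F j (sim F j) then c (si j) - (if so j = m then 0 else c (so j)) else 0)"
proof (cases "fires F j (sim F j)")
  case True
  have sub: "sim F j \<subseteq> {..<m}" using sim_subset[of j F] assms by auto
  then have fin: "finite (sim F j)" using finite_subset by blast
  have new: "si j \<notin> sim F j" and out: "so j = m \<or> so j \<in> sim F j" using True by (auto simp: fires_def)
  show ?thesis
  proof (cases "so j = m")
    case True
    then have "sim F j - {so j} = sim F j" using sub by auto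
    then show ?thesis using \<open>fires F j (sim F j)\<close> True new fin by simp
  next
    case False
    then show ?thesis using \<open>fires F j (sim F j)\<close> out new sum_exchange[OF fin, of "so j" "si j" c] by simp
  qed
qed simp

text \<open>The basis obtained by step \<open>j\<close> stays optimal until the next step, so its
  coefficient sums are intercept and slope of the value on this range.\<close>

lemma removal_value_sim:
  assumes j: "j < J" "m \<le> Suc j" and lam: "between j lam"
  shows "removal_value X F lam = sum a (sim F (Suc j)) + lam * sum b (sim F (Suc j))"
proof -
  have "min_weight_basis (w lam) (without X F) (sim F (Suc j))"
    by (rule sim_min_weight) (use j lam in \<open>auto simp: between_def\<close>)
  then have "removal_value X F lam = sum (w lam) (sim F (Suc j))"
    unfolding removal_value_def by (rule sum_optimal_basis[OF matroid_without])
  also have "\<dots> = sum a (sim F (Suc j)) + lam * sum b (sim F (Suc j))"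
    by (simp add: weight_def sum.distrib sum_distrib_left)
  finally show ?thesis .
qed

end

text \<open>Regroups a sequence so that the joint specification of splitting and merging becomes
  applicable.\<close>

lemma wp_assoc: "wp \<F> m d (Seq P (Seq P1 P2)) = wp \<F> m d (Seq (Seq P P1) P2)"
proof -
  have Seq: "wp \<F> m d (Seq P P') Q = wp \<F> m d P (\<lambda>t. wp \<F> m d P' (\<lambda>u. Q (t + u)))" for P P' Q
    by (rule ext) (rule wp_Seq)
  show ?thesis by (rule ext) (simp add: Seq add.assoc)
qed

lemma writes_lines [simp]:
  "nwrites split_prog = {''nu'', ''nv'', ''i'', ''x'', ''V'', ''U''}"
  "rwrites split_prog = {''da'', ''db'', ''A'', ''S''}"
  "nwrites merge_prog = {''iu'', ''iv'', ''i'', ''ord''}" "rwrites merge_prog = {}"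
  "nwrites push_prog = {''vt'', ''out_length''}"
  "rwrites push_prog = {''out_start'', ''out_intercept'', ''out_slope''}"
  unfolding split_prog_def merge_prog_def push_prog_def by auto

lemma writes_insert [simp]:
  "nwrites insert_prog = {''x'', ''top'', ''out_length'', ''vt'', ''i''}"
  "rwrites insert_prog = {''sv'', ''out_start'', ''out_intercept'', ''out_slope''}"
  unfolding insert_prog_def by auto

lemma writes_env [simp]:
  "nwrites env_prog = {''base'', ''rk'', ''i'', ''q'', ''x'', ''top'', ''out_length'', ''vt''}"
  "rwrites env_prog = {''Lv'', ''rv'', ''sv'', ''out_start'', ''out_intercept'', ''out_slope''}"
  unfolding env_prog_def env_loop_def by auto

text \<open>The stack records only the number of a set, so that pushing takes constant time; the
  elements are written out once the pieces are final.\<close>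

definition output_prog :: "nat \<Rightarrow> com" where
  "output_prog l = For ''p'' (N ''out_length'')
    (For ''i'' (NConst l)
      (NAssign ''out_vital'' (NAdd (NMul (NConst l) (N ''p'')) (N ''i''))
        (NCell ''fs'' (NAdd (NMul (NConst l) (NCell ''vt'' (N ''p''))) (N ''i'')))))"

lemma output_correct:
  assumes len: "nats s ''out_length'' 0 = len"
  shows "wp \<F> k d (output_prog l) (\<lambda>t s'. t \<le> 20 + len * (40 + l * 40) \<and>
    (\<forall>p<len. \<forall>i<l. nats s' ''out_vital'' (l * p + i) = nats s ''fs'' (l * nats s ''vt'' p + i))) s"
  unfolding output_prog_def
proof (rule wp_For[where b = len and c = "20 + l * 40" and I = "\<lambda>k s'.
    \<forall>p<k. \<forall>i<l. nats s' ''out_vital'' (l * p + i) = nats s ''fs'' (l * nats s ''vt'' p + i)"], goal_cases)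
  case (2 k s')
  then show ?case using agree_outsideD[OF 2(4)] len by simp
next
  case (3 k s')
  note A = agree_outsideD[OF 3(4)]
  show ?case
  proof (rule wp_For[where b = l and c = 20 and I = "\<lambda>j s'.
      (\<forall>p<k. \<forall>i<l. nats s' ''out_vital'' (l * p + i) = nats s ''fs'' (l * nats s ''vt'' p + i)) \<and>
      (\<forall>i<j. nats s' ''out_vital'' (l * k + i) = nats s ''fs'' (l * nats s ''vt'' k + i))"], goal_cases)
    case 1
    then show ?case using 3(2) by simp
  next
    case 2
    then show ?case by simp
  next
    case (3 j s2)
    note B = agree_outsideD[OF 3(4)]
    have "l * p + i \<noteq> l * k + j" if "p < k" "i < l" for p i
    proof -
      have "l * p + i < l * Suc p" using that by simp
      also have "\<dots> \<le> l * k" using that by (intro mult_le_mono2) simp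
      finally show ?thesis by simp
    qed
    then show ?case using 3(1-3) A B \<open>nats s' ''p'' 0 = k\<close>
      by (simp add: wp_simps All_less_Suc)
  next
    case (4 t s2)
    then show ?case using A agree_outsideD[OF 4(4)] \<open>nats s' ''p'' 0 = k\<close> by (simp add: All_less_Suc)
  qed
qed (simp_all add: algebra_simps)

section \<open>From exchange bits to the piecewise linear function\<close>

context schedule
begin

definition lines_inv :: "nat \<Rightarrow> nat \<Rightarrow> memory \<Rightarrow> bool" where
  "lines_inv K k s \<longleftrightarrow>
     (\<forall>n<K. reals s ''A'' n = sum a (sim (fset s n) k) \<and> reals s ''S'' n = sum b (sim (fset s n) k)) \<and>
     nats s ''ord'' ` {..<K} = {..<K} \<and> sorted_on (reals s ''S'') (nats s ''ord'') K \<and>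
     (k < m \<longrightarrow> nats s ''out_length'' 0 = 0) \<and>
     (m \<le> k \<longrightarrow> out_ok (\<lambda>n. removal_value X (fset s n)) k K (nats s ''out_length'' 0) (reals s ''out_start'')
       (reals s ''out_intercept'') (reals s ''out_slope'') (nats s ''vt''))"

lemma lines_inv_setn: "lines_inv K k (setn s ''j'' i v) = lines_inv K k s"
proof -
  have "fset (setn s ''j'' i v) = fset s" by (simp add: fset_def fun_eq_iff)
  then show ?thesis by (simp add: lines_inv_def)
qed

lemma lines_step:
  assumes inp: "input_ok s" and mem: "schedule_mem s" and times: "\<And>j. m \<le> j \<Longrightarrow> j < J \<Longrightarrow> reals s ''st'' j = st j"
    and marks: "\<And>n. n < K \<Longrightarrow> marks_ok s n" and K: "nats s ''n'' 0 = K" "0 < K"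
    and j: "nats s ''j'' 0 = j" "j < J" and inv: "lines_inv K j s" and m: "0 < m"
  shows "wp \<F> k d line_step_prog
    (\<lambda>t s'. t \<le> 200 + K * 640 \<and> lines_inv K (Suc j) s') s"
proof -
  define val where "val = (\<lambda>n. removal_value X (fset s n))"
  define mark where "mark x \<longleftrightarrow> fires (fset s x) j (sim (fset s x) j)" for x
  define da db where "da = a (si j) - (if so j = m then 0 else a (so j))"
    and "db = b (si j) - (if so j = m then 0 else b (so j))"
  have J: "nats s ''J'' 0 = J" and so: "nats s ''so'' j = so j" and si: "nats s ''si'' j = si j"
    and size: "nats s ''size'' 0 = m" using mem j by (simp_all add: schedule_mem_def)
  have sij: "si j < m" "so j \<le> m" using si_less_J so_le_J j by auto
  have da: "da = reals s ''const'' (nats s ''si'' (nats s ''j'' 0)) - reals s ''const'' (nats s ''so'' (nats s ''j'' 0))"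
    and db: "db = reals s ''slope'' (nats s ''si'' (nats s ''j'' 0)) - reals s ''slope'' (nats s ''so'' (nats s ''j'' 0))"
    using sij input_okD[OF inp] by (auto simp: j so si da_def db_def)
  have mark: "nats s ''mk'' (x * nats s ''J'' 0 + nats s ''j'' 0) \<noteq> 0 \<longleftrightarrow> mark x" if "x < K" for x
    using marks[OF that] j J by (simp add: marks_ok_def mark_def)
  have perm: "nats s ''ord'' ` {..<K} = {..<K}" and sorted: "sorted_on (reals s ''S'') (nats s ''ord'') K"
    using inv by (simp_all add: lines_inv_def)
  show ?thesis unfolding line_step_prog_def wp_assoc[of _ _ _ split_prog]
  proof (rule wp_SeqI[OF split_merge_correct[OF K(1) perm sorted mark da db]], goal_cases)
    case (2 t s1)
    have fr: "x \<notin> {''nu'', ''nv'', ''i'', ''x'', ''V'', ''U'', ''iu'', ''iv'', ''ord''} \<Longrightarrow> nats s1 x = nats s x"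
      "x \<notin> {''da'', ''db'', ''A'', ''S''} \<Longrightarrow> reals s1 x = reals s x" for x
      using agree_outsideD[OF 2(2)] by simp_all
    have A: "reals s1 ''A'' n = sum a (sim (fset s n) (Suc j))"
      and S: "reals s1 ''S'' n = sum b (sim (fset s n) (Suc j))" if "n < K" for n
      using 2(1) that inv unfolding sum_step[OF j(2)]
      by (simp_all add: lines_inv_def mark_def da_def db_def)
    have perm1: "nats s1 ''ord'' ` {..<K} = {..<K}" and sorted1: "sorted_on (reals s1 ''S'') (nats s1 ''ord'') K"
      and t: "t \<le> 70 + K * 140" using 2(1) by simp_all
    have fs1: "fset s1 = fset s" by (simp add: fset_def fr fun_eq_iff)
    have out1: "nats s1 ''out_length'' 0 = nats s ''out_length'' 0" by (simp add: fr)
    have len0: "j < m \<Longrightarrow> nats s1 ''out_length'' 0 = 0" using inv by (simp add: lines_inv_def out1)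
    show ?case
    proof (cases "Suc j < m")
      case True
      then have "lines_inv K (Suc j) s1"
        using A S perm1 sorted1 len0 by (simp add: lines_inv_def fs1)
      then show ?thesis using True t by (simp add: wp_simps fr j size)
    next
      case False
      have "wp \<F> k d env_prog (\<lambda>t s'. t \<le> 100 + K * 500 \<and>
        out_ok val (Suc j) K (nats s' ''out_length'' 0) (reals s' ''out_start'') (reals s' ''out_intercept'')
          (reals s' ''out_slope'') (nats s' ''vt'')) s1"
      proof (rule env_correct)
        show "input_ok s1" by (rule input_ok_agree[OF inp 2(2)]) simp_all
        show "schedule_mem s1" using mem by (simp add: schedule_mem_def fr)
        show "reals s1 ''st'' j = st j" if "m \<le> j" "j < J" for j using times[OF that] by (simp add: fr)
        show "m \<le> j \<Longrightarrow> out_ok val j K (nats s1 ''out_length'' 0) (reals s1 ''out_start'')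
            (reals s1 ''out_intercept'') (reals s1 ''out_slope'') (nats s1 ''vt'')"
          using inv by (simp add: lines_inv_def val_def fr)
        show "val n lam = reals s1 ''A'' n + lam * reals s1 ''S'' n" if "n < K" "between j lam" for n lam
          using removal_value_sim[OF j(2) _ that(2)] False A S that(1) by (simp add: val_def)
      qed (use False j K perm1 sorted1 len0 in \<open>simp_all add: fr\<close>)
      then have env: "wp \<F> k d env_prog (\<lambda>t s'. t \<le> 100 + K * 500 \<and> lines_inv K (Suc j) s') s1"
      proof (rule wp_conseq, goal_cases)
        case (1 u s2)
        have fr2: "nats s2 ''fs'' = nats s1 ''fs''" "nats s2 ''ord'' = nats s1 ''ord''"
          "reals s2 ''A'' = reals s1 ''A''" "reals s2 ''S'' = reals s1 ''S''"
          by (simp_all add: agree_outsideD[OF 1(2)])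
        have "fset s2 = fset s" using fs1 by (simp add: fset_def fr2 fun_eq_iff)
        then show ?case using 1(1) A S perm1 sorted1 False
          by (simp add: lines_inv_def fr2 val_def)
      qed
      then show ?thesis using False t
        by (simp add: wp_If fr j size) (erule wp_mono, simp)
    qed
  qed
qed

lemma lines_correct:
  assumes inp: "input_ok s" and mem: "schedule_mem s" and times: "\<And>j. m \<le> j \<Longrightarrow> j < J \<Longrightarrow> reals s ''st'' j = st j"
    and marks: "\<And>n. n < K \<Longrightarrow> marks_ok s n" and K: "nats s ''n'' 0 = K" "0 < K" and m: "0 < m"
    and zero: "\<And>n. reals s ''A'' n = 0" "\<And>n. reals s ''S'' n = 0" "nats s ''out_length'' 0 = 0"
  shows "wp \<F> k d lines_prog (\<lambda>t s'. t \<le> 40 + K * 40 + J * (220 + K * 640) \<and> lines_inv K J s') s"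
proof -
  have init: "wp \<F> k d (For ''i'' (N ''n'') (NAssign ''ord'' (N ''i'') (N ''i'')))
      (\<lambda>t s'. t \<le> 9 + K * 20 \<and> (\<forall>i<K. nats s' ''ord'' i = i)) s"
  proof (rule wp_For[where b = K and c = 8 and I = "\<lambda>k s'. \<forall>i<k. nats s' ''ord'' i = i"], goal_cases)
    case (2 k s')
    then show ?case using agree_outsideD[OF 2(4)] K by simp
  next
    case (3 k s')
    then show ?case by (simp add: wp_simps less_Suc_eq)
  qed simp_all
  show ?thesis unfolding lines_prog_def
  proof (rule wp_SeqI[OF init], goal_cases)
    case (1 t s1)
    note A = agree_outsideD[OF 1(2)]
    have img: "nats s1 ''ord'' ` {..<K} = {..<K}" using 1(1) by auto
    show ?case
    proof (rule wp_For[where b = J and c = "200 + K * 640" and I = "lines_inv K"], goal_cases)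
      case 1
      \<comment> \<open>All bases are still empty, so all coefficients are 0 and the identity is an
        order sorted by slope.\<close>
      show ?case unfolding lines_inv_setn
        using A zero m img by (simp add: lines_inv_def sorted_on_def)
    next
      case (2 k s')
      then show ?case using agree_outsideD(1)[OF 2(4), of "''J''"] A mem by (simp add: schedule_mem_def line_step_prog_def)
    next
      case (3 k s')
      have fr: "nats s' ''size'' = nats s ''size''" "nats s' ''J'' = nats s ''J''"
        "nats s' ''so'' = nats s ''so''" "nats s' ''si'' = nats s ''si''" "nats s' ''n'' = nats s ''n''"
        "nats s' ''mk'' = nats s ''mk''" "nats s' ''fs'' = nats s ''fs''"
        "nats s' ''lower'' = nats s ''lower''" "nats s' ''upper'' = nats s ''upper''"
        "reals s' ''const'' = reals s ''const''" "reals s' ''slope'' = reals s ''slope''"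
        "reals s' ''lower'' = reals s ''lower''" "reals s' ''upper'' = reals s ''upper''"
        "reals s' ''st'' = reals s ''st''"
        by (simp_all add: agree_outsideD[OF 3(4)] A line_step_prog_def)
      show ?case unfolding lines_inv_setn
      proof (rule wp_conseq[OF lines_step[OF _ _ _ _ _ K(2) 3(3,1,2) m]], goal_cases)
        case 1
        show ?case using inp by (simp add: input_ok_def fr)
      next
        case 2
        show ?case using mem by (simp add: schedule_mem_def fr)
      next
        case (3 j)
        then show ?case using times by (simp add: fr)
      next
        case (4 n)
        then show ?case using marks[of n] by (simp add: marks_ok_def fset_def fr)
      next
        case 5
        show ?case using K by (simp add: fr)
      next
        case (6 t s2)
        then show ?case using agree_outsideD(1)[OF 6(2), of "''j''"] 3(3) by (simp add: line_step_prog_def)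
      qed
    next
      case (4 u s')
      then show ?case using 1(1) by (simp add: algebra_simps)
    qed
  qed
qed

end

section \<open>The complete algorithm\<close>

definition solve_prog :: "nat \<Rightarrow> com" where
  "solve_prog l = keys_prog ;; rank_prog ;; events_prog ;; enum_prog l ;; lines_prog ;; output_prog l"

text \<open>Every monomial is at most a multiple of \<open>Z = M * (m * m) * d\<close>, where
  \<open>M\<close> will be \<open>m ^ l\<close>; cubes of \<open>m\<close> need
  \<open>m \<le> M\<close>, that is \<open>l \<ge> 1\<close>. The simulation contributes
  \<open>603 = 201 * 3\<close>, from \<open>200 + d \<le> 201 * d\<close> and
  \<open>J + 1 \<le> 3 * (m * m)\<close>. The coefficients sum to 5813 and, for terms with
  \<open>l\<close>, to 290; 10000 and 500 are round upper bounds.\<close>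

lemma time_bound:
  fixes m M d l J :: nat
  assumes "0 < m" "m \<le> M" "0 < d" "J \<le> m + m * m"
  shows "60 * m + 60 + ((80 * m + 80) * m + 80) + 700 * (m * m * m + m * m + m + 1) +
      (20 + 10 * l + M * (130 + 200 * l + (200 + d) * (J + 1)) + (40 + M * 40 + J * (220 + M * 640)) +
       (20 + (m * m + 1) * M * (40 + l * 40))) \<le> (10000 + 500 * l) * (M * (m * m) * d)"
proof -
  define Z where "Z = M * (m * m) * d"
  have M: "0 < M" using assms by simp
  have mm: "m \<le> m * m" "1 \<le> m * m" using assms(1) by (simp_all add: Suc_le_eq)
  have "m * m * (M * d) = Z" by (simp add: Z_def mult_ac)
  have up: "x \<le> Z" if "x \<le> m * m * M" for x
  proof -
    have "x \<le> m * m * M * d" using that assms(3) by (metis le_trans mult_le_mono2 mult.right_neutral Suc_leI One_nat_def)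
    then show ?thesis by (simp add: Z_def mult_ac)
  qed
  have m2: "m * m \<le> Z" by (rule up) (use M in \<open>simp add: Suc_le_eq\<close>)
  have m3: "m * m * m \<le> Z" by (rule up) (use assms(2) in simp)
  have m1: "m \<le> Z" "1 \<le> Z" using mm m2 by linarith+
  have MZ: "M \<le> Z" by (rule up) (use mm in simp)
  have mmM: "m * m * M \<le> Z" by (rule up) simp
  have J: "J + 1 \<le> 3 * (m * m)" "J \<le> 2 * (m * m)" using assms(4) mm by linarith+
  have "J * M \<le> 2 * (m * m * M)" using mult_le_mono1[OF J(2), of M] by (simp only: mult.assoc)
  then have JM: "J * M \<le> 2 * Z" using mmM by linarith
  have "200 + d \<le> 201 * d" using assms(3) by simp
  then have "(200 + d) * (J + 1) \<le> 201 * d * (3 * (m * m))" using J(1) by (rule mult_le_mono)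
  then have "M * ((200 + d) * (J + 1)) \<le> M * (201 * d * (3 * (m * m)))" by (rule mult_le_mono2)
  also have "\<dots> = 603 * Z" by (simp add: Z_def mult_ac)
  finally have dJ: "M * ((200 + d) * (J + 1)) \<le> 603 * Z" .
  have lZ: "l * M \<le> l * Z" "l * (m * m * M) \<le> l * Z" "l \<le> l * Z" using MZ mmM m1 by simp_all
  have "60 * m + 60 + ((80 * m + 80) * m + 80) + 700 * (m * m * m + m * m + m + 1) +
      (20 + 10 * l + M * (130 + 200 * l + (200 + d) * (J + 1)) + (40 + M * 40 + J * (220 + M * 640)) +
       (20 + (m * m + 1) * M * (40 + l * 40))) =
      840 * m + 920 + 780 * (m * m) + 700 * (m * m * m) + 10 * l + 210 * M + 240 * (l * M) +
      M * ((200 + d) * (J + 1)) + 220 * J + 640 * (J * M) + 40 * (m * m * M) + 40 * (l * (m * m * M))"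
    by (simp add: algebra_simps)
  also have "\<dots> \<le> 840 * Z + 920 * Z + 780 * Z + 700 * Z + 10 * (l * Z) + 210 * Z + 240 * (l * Z) +
      603 * Z + 440 * Z + 1280 * Z + 40 * Z + 40 * (l * Z)"
    using m1 m2 m3 MZ JM dJ lZ mmM J(2) by linarith
  also have "\<dots> \<le> (10000 + 500 * l) * Z" by (simp add: algebra_simps)
  finally show ?thesis by (simp add: Z_def)
qed

context schedule
begin

lemma solution_if_out_ok:
  assumes out: "out_ok (\<lambda>n. removal_value X (F n)) J K len bs ic sl vt"
    and F: "\<And>n. n < K \<Longrightarrow> F n \<in> removable l X" and cover: "\<And>G. G \<in> removable l X \<Longrightarrow> \<exists>n<K. F n = G"
  shows "is_solution l X (map (\<lambda>p. \<lparr>start = bs p, intercept = ic p, slope = sl p, vital = F (vt p)\<rparr>) [0..<len])"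
proof -
  let ?ps = "map (\<lambda>p. \<lparr>start = bs p, intercept = ic p, slope = sl p, vital = F (vt p)\<rparr>) [0..<len]"
  have start: "above_lower (bs p)" "below_upper (bs p)" if "0 < p" "p < len" for p
    using out that unfolding out_ok_def by blast+
  have increasing: "bs p < bs q" if "0 < p" "p < q" "q < len" for p q
    using out that unfolding out_ok_def by blast
  have vt: "vt p < K" if "p < len" for p using out that unfolding out_ok_def by blast
  have dom: "lam \<in> piece_domain X ?ps p \<longleftrightarrow> lam \<in> parameters X \<and> (0 < p \<longrightarrow> bs p \<le> lam) \<and>
      (Suc p < len \<longrightarrow> lam \<le> bs (Suc p))" if "p < len" for p lam
    using that by (auto simp: piece_domain_def)
  have fin: "finite (removable l X)"
    by (rule finite_subset[of _ "Pow (ground X)"]) (auto simp: removable_def ground_def)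
  have union: "\<exists>p<len. lam \<in> piece_domain X ?ps p" if lam: "lam \<in> parameters X" for lam
  proof -
    \<comment> \<open>The piece responsible for \<open>lam\<close> is the last one that has started;
      piece 0 counts as always started.\<close>
    define P where "P = {p. p < len \<and> (0 < p \<longrightarrow> bs p \<le> lam)}"
    have "finite P" by (simp add: P_def)
    moreover have "0 < len" using out lam unfolding out_ok_def by blast
    then have "P \<noteq> {}" by (auto simp: P_def)
    ultimately have P: "Max P \<in> P" "\<And>q. q \<in> P \<Longrightarrow> q \<le> Max P" by simp_all
    have "lam \<le> bs (Suc (Max P))" if "Suc (Max P) < len"
    proof -
      have "Suc (Max P) \<notin> P" using P(2)[of "Suc (Max P)"] by auto
      then show ?thesis using that by (simp add: P_def)
    qed
    then show ?thesis using P(1) lam dom by (intro exI[of _ "Max P"]) (auto simp: P_def)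
  qed
  have best: "interdiction_value l X lam = ic p + lam * sl p \<and> most_vital l X lam (F (vt p))"
    if p: "p < len" and lam: "lam \<in> piece_domain X ?ps p" for p lam
  proof -
    have le: "removal_value X (F n) lam \<le> ic p + lam * sl p" if "n < K" for n
      using out p lam that unfolding out_ok_def dom[OF p] by blast
    have eq: "removal_value X (F (vt p)) lam = ic p + lam * sl p"
      using out p lam unfolding out_ok_def dom[OF p] by blast
    have "interdiction_value l X lam = ic p + lam * sl p"
      unfolding interdiction_value_def
    proof (rule Max_eqI)
      show "y \<le> ic p + lam * sl p" if "y \<in> (\<lambda>F. removal_value X F lam) ` removable l X" for y
        using that cover le by force
      show "ic p + lam * sl p \<in> (\<lambda>F. removal_value X F lam) ` removable l X"
        using F[OF vt[OF p]] eq by force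
    qed (simp add: fin)
    then show ?thesis using F[OF vt[OF p]] eq by (simp add: most_vital_def)
  qed
  show ?thesis unfolding is_solution_def
  proof (intro conjI allI impI ballI)
    show "parameters X = (\<Union>p<length ?ps. piece_domain X ?ps p)"
    proof (intro equalityI subsetI)
      fix lam assume "lam \<in> parameters X"
      then show "lam \<in> (\<Union>p<length ?ps. piece_domain X ?ps p)" using union[of lam] by simp blast
    qed (auto simp: piece_domain_def)
  next
    fix p assume "0 < p \<and> p < length ?ps"
    then show "start (?ps ! p) \<in> parameters X" using start interior_parameters by simp
  next
    fix p q assume "0 < p \<and> p < q \<and> q < length ?ps"
    then show "start (?ps ! p) < start (?ps ! q)" using increasing by simp
  next
    fix p lam assume "p < length ?ps" "lam \<in> piece_domain X ?ps p"
    then show "interdiction_value l X lam = intercept (?ps ! p) + lam * slope (?ps ! p)"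
      "most_vital l X lam (vital (?ps ! p))" using best by simp_all
  qed
qed

lemma solve_scheduled:
  assumes inp: "input_ok s" and mem: "schedule_mem s" and times: "\<And>j. m \<le> j \<Longrightarrow> j < J \<Longrightarrow> reals s ''st'' j = st j"
    and "0 < l" and J: "J \<le> m + m * m"
    and zero: "nats s ''c'' = (\<lambda>_. 0)" "nats s ''in'' = (\<lambda>_. 0)" "nats s ''out_length'' = (\<lambda>_. 0)"
      "reals s ''A'' = (\<lambda>_. 0)" "reals s ''S'' = (\<lambda>_. 0)"
  shows "wp (indep X) m d (enum_prog l ;; lines_prog ;; output_prog l) (\<lambda>t s'.
    t \<le> 20 + 10 * l + m ^ l * (130 + 200 * l + (200 + d) * (J + 1)) + (40 + m ^ l * 40 + J * (220 + m ^ l * 640)) +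
      (20 + (m * m + 1) * m ^ l * (40 + l * 40)) \<and>
    is_solution l X (output_pieces l s')) s"
proof -
  have m: "0 < m" using l_le \<open>0 < l\<close> by simp
  have writes: "nwrites (enum_prog l) = {''M'', ''n'', ''t'', ''ok'', ''i'', ''f'', ''in'', ''fs'', ''e'', ''B'', ''j'', ''o'', ''ix'', ''mk'', ''qr'', ''c'', ''ca''}"
    "rwrites (enum_prog l) = {}"
    unfolding enum_prog_def tuple_prog_def mark_prog_def clear_prog_def count_prog_def sim_prog_def step_prog_def by auto
  have writes': "nwrites lines_prog = {''i'', ''j'', ''ord'', ''nu'', ''nv'', ''x'', ''V'', ''U'', ''iu'', ''iv'', ''base'', ''rk'', ''q'', ''top'', ''out_length'', ''vt''}"
    unfolding lines_prog_def line_step_prog_def by auto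
  have writes'': "nwrites (output_prog l) = {''p'', ''i'', ''out_vital''}" "rwrites (output_prog l) = {}"
    unfolding output_prog_def by auto
  show ?thesis
  proof (rule wp_SeqI[OF enum_correct[OF mem \<open>0 < l\<close>]], goal_cases)
    case (3 t1 s1)
    define K where "K = nats s1 ''n'' 0"
    have table: "K \<le> m ^ l" "\<And>n. n < K \<Longrightarrow> marks_ok s1 n" "\<And>F. F \<in> removable l X \<Longrightarrow> \<exists>n<K. fset s1 n = F"
      using 3(1) by (auto simp: table_ok_def K_def)
    note A = agree_outsideD[OF 3(2), unfolded writes]
    \<comment> \<open>A witness that the table is not empty, without which there would be no line to
      build an envelope from.\<close>
    have "{..<l} \<in> removable l X" using l_le by (auto simp: removable_def ground_def)
    then have K: "0 < K" using table(3) by force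
    have inp1: "input_ok s1" by (rule input_ok_agree[OF inp 3(2)]) (simp_all add: writes)
    have mem1: "schedule_mem s1" by (rule schedule_mem_agree[OF mem 3(2)]) (simp_all add: writes)
    have times1: "reals s1 ''st'' j = st j" if "m \<le> j" "j < J" for j using times[OF that] A by simp
    show ?case
    proof (rule wp_SeqI[OF lines_correct[OF inp1 mem1 times1 table(2) K_def[symmetric] K m]], goal_cases)
      case (7 t2 s2)
      note 6 = 7
      note B = agree_outsideD(1)[OF 6(2), unfolded writes']
      define len where "len = nats s2 ''out_length'' 0"
      have fs: "fset s2 = fset s1" by (simp add: fset_def fun_eq_iff B)
      have out: "out_ok (\<lambda>n. removal_value X (fset s2 n)) J K len (reals s2 ''out_start'')
        (reals s2 ''out_intercept'') (reals s2 ''out_slope'') (nats s2 ''vt'')"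
        using 6(1) m_le_J by (simp add: lines_inv_def len_def)
      have sol: "is_solution l X (map (\<lambda>p. \<lparr>start = reals s2 ''out_start'' p, intercept = reals s2 ''out_intercept'' p,
        slope = reals s2 ''out_slope'' p, vital = fset s2 (nats s2 ''vt'' p)\<rparr>) [0..<len])"
        by (rule solution_if_out_ok[OF out]) (use table in \<open>auto simp: fs marks_ok_def\<close>)
      have "len \<le> (Suc J - m) * K" using out by (simp add: out_ok_def)
      also have "\<dots> \<le> (m * m + 1) * m ^ l" by (rule mult_le_mono) (use J table(1) in auto)
      finally have len: "len \<le> (m * m + 1) * m ^ l" .
      show ?case
      proof (rule wp_conseq[OF output_correct[OF len_def[symmetric]]], goal_cases)
        case (1 t3 s3)
        note C = agree_outsideD[OF 1(2), unfolded writes'']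
        have "{nats s3 ''out_vital'' (l * p + i) |i. i < l} = fset s2 (nats s2 ''vt'' p)" if "p < len" for p
        proof -
          have "nats s3 ''out_vital'' (l * p + i) = nats s2 ''fs'' (l * nats s2 ''vt'' p + i)" if "i < l" for i
            using 1(1) \<open>p < len\<close> that by blast
          then have "(\<lambda>i. nats s3 ''out_vital'' (l * p + i)) ` {..<l} = fset s2 (nats s2 ''vt'' p)"
            unfolding fset_def by (intro image_cong) auto
          then show ?thesis by auto
        qed
        then have "output_pieces l s3 = map (\<lambda>p. \<lparr>start = reals s2 ''out_start'' p, intercept = reals s2 ''out_intercept'' p,
            slope = reals s2 ''out_slope'' p, vital = fset s2 (nats s2 ''vt'' p)\<rparr>) [0..<len]"
          unfolding output_pieces_def by (simp add: C len_def)
        then have "is_solution l X (output_pieces l s3)" using sol by simp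
        moreover have "t3 \<le> 20 + (m * m + 1) * m ^ l * (40 + l * 40)"
          using 1(1) mult_le_mono1[OF len, of "40 + l * 40"] by linarith
        moreover have "t2 \<le> 40 + m ^ l * 40 + J * (220 + m ^ l * 640)"
          using 6(1) table(1) mult_le_mono2[of "220 + K * 640" "220 + m ^ l * 640" J] by linarith
        ultimately show ?case using 3(1) by linarith
      qed
    qed (use zero A in simp_all)
  qed (use zero in simp_all)
qed

end

context interdiction
begin

lemma input_memory_ok: "input_ok (input_memory X)"
  by (simp add: input_ok_def input_memory_def)

lemma solve_correct:
  assumes "0 < l" "0 < d"
  shows "wp (indep X) m d (solve_prog l) (\<lambda>t s'. t \<le> (10000 + 500 * l) * (m ^ (l + 2) * d) \<and>
    is_solution l X (output_pieces l s')) (input_memory X)"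
proof -
  have m: "0 < m" using l_le \<open>0 < l\<close> by simp
  define s0 where "s0 = input_memory X"
  have in0: "input_ok s0" unfolding s0_def by (rule input_memory_ok)
  have zero: "nats s0 ''c'' = (\<lambda>_. 0)" "nats s0 ''in'' = (\<lambda>_. 0)" "nats s0 ''out_length'' = (\<lambda>_. 0)"
      "reals s0 ''A'' = (\<lambda>_. 0)" "reals s0 ''S'' = (\<lambda>_. 0)"
    by (simp_all add: s0_def input_memory_def)
  have writes: "nwrites keys_prog = {''e''}" "rwrites keys_prog = {''k1'', ''k2''}"
    "nwrites rank_prog = {''e'', ''r'', ''f'', ''so'', ''si''}" "rwrites rank_prog = {}"
    unfolding keys_prog_def rank_prog_def by auto
  have writes': "nwrites events_prog = {''lk'', ''e'', ''h'', ''f'', ''nf'', ''J'', ''q'', ''has'', ''g'', ''so'', ''si''}"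
    "rwrites events_prog = {''lv'', ''x'', ''nt'', ''st''}"
    unfolding events_prog_def row_prog_def next_prog_def advance_prog_def by auto
  show ?thesis unfolding solve_prog_def s0_def[symmetric]
  proof (rule wp_SeqI[OF keys_correct[OF in0]], goal_cases)
    case (1 t1 s1)
    note A = agree_outsideD[OF 1(2), unfolded writes]
    have in1: "input_ok s1" by (rule input_ok_agree[OF in0 1(2)]) (simp_all add: writes)
    have keys: "reals s1 ''k1'' e = key1 e \<and> reals s1 ''k2'' e = key2 e" if "e < m" for e using 1(1) that by simp
    show ?case
    proof (rule wp_SeqI[OF rank_correct[OF in1 keys]], goal_cases)
      case (2 t2 s2)
      have t2: "t2 \<le> (80 * m + 80) * m + 80" using 2(1) by simp
      note B = agree_outsideD[OF 2(2), unfolded writes]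
      have in2: "input_ok s2" by (rule input_ok_agree[OF in1 2(2)]) (simp_all add: writes)
      have order: "nats s2 ''si'' (rank e) = e \<and> nats s2 ''so'' (rank e) = m" if "e < m" for e using 2(1) that by simp
      show ?case
      proof (rule wp_SeqI[OF events_correct[OF in2 order]], goal_cases)
        case (2 t3 s3)
        have t3: "t3 \<le> 700 * (m * m * m + m * m + m + 1)" using 2(1) by simp
        note C = agree_outsideD[OF 2(2), unfolded writes']
        have in3: "input_ok s3" by (rule input_ok_agree[OF in2 2(2)]) (simp_all add: writes')
        define J where "J = nats s3 ''J'' 0"
        interpret schedule l X "nats s3 ''si''" "nats s3 ''so''" "reals s3 ''st''" J
          using 2(1) by (simp add: J_def)
        have mem: "schedule_mem s3" unfolding schedule_mem_def
          using input_okD(1)[OF in3] by (simp add: J_def)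
        have J: "J \<le> m + m * m" using 2(1) by (simp add: J_def)
        show ?case
        proof (rule wp_mono[OF solve_scheduled[OF in3 mem refl \<open>0 < l\<close> J]], goal_cases)
          case (6 t4 s4)
          have "m \<le> m ^ l" using m \<open>0 < l\<close> by (simp add: self_le_power)
          note bound = time_bound[OF m this \<open>0 < d\<close> J, of l]
          have "m ^ (l + 2) * d = m ^ l * (m * m) * d" by (simp add: power_add power2_eq_square)
          moreover have "t1 \<le> 60 * m + 60" using 1(1) by simp
          ultimately have "t1 + (t2 + (t3 + t4)) \<le> (10000 + 500 * l) * (m ^ (l + 2) * d)"
            using t2 t3 conjunct1[OF 6] bound by (elim ssubst) linarith
          then show ?case using 6 by blast
        qed (use zero A B C in simp_all)
      qed
    qed
  qed
qed

end

theorem theorem4p1: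
  fixes l :: nat
  assumes "0 < l"
  shows "\<exists>(P :: com) (C :: real). \<forall>(f :: nat \<Rightarrow> nat) (X :: problem).
    (\<forall>n. 1 \<le> f n) \<longrightarrow> interdiction_instance l X \<longrightarrow>
    (let m = ground_size X; k = matroid_rank X in
      solves_within l P X (f m)
        (C * (real m ^ (l + 1) *
          (real m * real (f m) + real k powr (1 / 3) * real l * ln (real m * real k)))))"
proof (intro exI[of _ "solve_prog l"] exI[of _ "real (10000 + 500 * l)"] allI impI)
  fix f :: "nat \<Rightarrow> nat" and X :: problem
  assume f: "\<forall>n. 1 \<le> f n" and inst: "interdiction_instance l X"
  interpret interdiction l X by unfold_locales (rule inst)
  define k d where "k = matroid_rank X" and "d = f m"
  have m: "0 < m" using l_le assms by simp
  have "0 < d" using f by (simp add: d_def Suc_le_eq)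
  have "wp (indep X) m d (solve_prog l) (\<lambda>t s'. t \<le> (10000 + 500 * l) * (m ^ (l + 2) * d) \<and>
    is_solution l X (output_pieces l s')) (input_memory X)"
    by (rule solve_correct) fact+
  then obtain t s where run: "exec (indep X) m d (solve_prog l) (input_memory X) t s"
    and t: "t \<le> (10000 + 500 * l) * (m ^ (l + 2) * d)" and sol: "is_solution l X (output_pieces l s)"
    unfolding wp_def by blast
  define Q where "Q = real k powr (1 / 3) * real l * ln (real m * real k)"
  \<comment> \<open>For \<open>k = 0\<close> the factor \<open>0 powr (1 / 3)\<close> vanishes.
    Otherwise \<open>m * k \<ge> 1\<close>, and the logarithm is nonnegative.\<close>
  have Q: "0 \<le> Q"
  proof (cases "k = 0")
    case False
    then have "1 \<le> m * k" using m by (simp add: Suc_le_eq)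
    then have "1 \<le> real m * real k" by (metis of_nat_1 of_nat_le_iff of_nat_mult)
    then show ?thesis by (simp add: Q_def)
  qed (simp add: Q_def)
  have "real t \<le> real ((10000 + 500 * l) * (m ^ (l + 2) * d))" using t by (simp only: of_nat_le_iff)
  also have "\<dots> = real (10000 + 500 * l) * (real m ^ (l + 1) * (real m * real d))" by simp
  also have "\<dots> \<le> real (10000 + 500 * l) * (real m ^ (l + 1) * (real m * real d + Q))"
    using Q by (intro mult_left_mono) auto
  finally show "let m = ground_size X; k = matroid_rank X in
      solves_within l (solve_prog l) X (f m)
        (real (10000 + 500 * l) * (real m ^ (l + 1) *
          (real m * real (f m) + real k powr (1 / 3) * real l * ln (real m * real k))))"
    using run sol unfolding solves_within_def Let_def by (auto simp: d_def k_def Q_def)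
qed

end
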